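(* Let $(\mathscr{M};\mathcal{H})$, $(\mathscr{N};\mathcal{K})$ be represented von Neumann algebras and $\Phi:\mathscr{M}\to\mathscr{N}$ be a unital normal $*$-homomorphism. Let $\Phi_{\mathrm{aff}}:\mathscr{M}_{\mathrm{aff}}\to\mathscr{N}_{\mathrm{aff}}$ be the extension of $\Phi$ given by $\Phi_{\mathrm{aff}}(A/B)=\Phi(A)/\Phi(B)$. Then the restriction of $\Phi_{\mathrm{aff}}$ to $\mathscr{M}_{\mathrm{aff}}^{\mathrm{MvN}}$ is the unique mapping from $\mathscr{M}_{\mathrm{aff}}^{\mathrm{MvN}}$ to $\mathscr{N}_{\mathrm{aff}}^{\mathrm{MvN}}$ which extends $\Phi$, and respects strong-sum, strong-product and adjoint.
   Context: A represented von Neumann algebra $(\mathscr{M};\mathcal{H})$ is a von Neumann algebra $\mathscr{M}$ acting on a complex Hilbert space $\mathcal{H}$. An unbounded operator on $\mathcal{H}$ is a linear map $T:\mathrm{dom}(T)\to\mathcal{H}$ with $\mathrm{dom}(T)$ a (not necessarily dense) linear subspace of $\mathcal{H}$, and $T$ not necessarily bounded; equality of operators includes equality of domains. $T$ is closed if its graph is closed, and pre-closed if the closure of its graph is the graph of an operator, denoted $\overline{T}$. For $A,B\in\mathcal{B}(\mathcal{H})$ with $\mathrm{null}(B)\subseteq\mathrm{null}(A)$, the quotient $A/B$ is the unbounded operator with domain $\mathrm{ran}(B)$ given by $Bx\mapsto Ax$ ($x\in\mathcal{H}$). $\mathscr{M}_{\mathrm{aff}} := \{A/B : A,B\in\mathscr{M},\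 \mathrm{null}(B)\subseteq\mathrm{null}(A)\}$. The map $\Phi_{\mathrm{aff}}$, $A/B\mapsto\Phi(A)/\Phi(B)$, makes sense and does not depend on the choice of quotient representation. $\mathscr{M}_{\mathrm{aff}}^{\mathrm{MvN}}$ is the set of closed operators $T$ on $\mathcal{H}$ with $U^*TU=T$ for every unitary $U\in\mathscr{M}'$; it coincides with the set of closed operators in $\mathscr{M}_{\mathrm{aff}}$. Sums and products: $\mathrm{dom}(S+T)=\mathrm{dom}(S)\cap\mathrm{dom}(T)$; $\mathrm{dom}(ST)=\{x\in\mathrm{dom}(T): Tx\in\mathrm{dom}(S)\}$. For closed $S,T$, if $S+T$ (resp. $ST$) is pre-closed then the strong-sum $S\,\hat{+}\,T$ (resp. strong-product $S\,\hat{\cdot}\,T$) is defined to be $\overline{S+T}$ (resp. $\overline{ST}$). The adjoint of a (not necessarily densely-defined) $T$ on $\mathcal{H}$ has domain $\{y\in\mathcal{H}: x\mapsto\langle Tx,y\rangle \text{ continuous on }\mathrm{dom}(T)\}$, and $T^*y$ is the unique $z\in\overline{\mathrm{dom}(T)}$ with $\langle Tx,y\rangle=\langle x,z\rangle$ for all $x\in\mathrm{dom}(T)$. A map $\Psi:\mathscr{M}_{\mathrm{aff}}^{\mathrm{MvN}}\to\mathscr{N}_{\mathrm{aff}}^{\mathrm{MvN}}$ respects strong-sum if, whenever $T_1,T_2\in\mathscr{M}_{\mathrm{aff}}^{\mathrm{MvN}}$ and $T_1+T_2$ is pre-closed, $\Psi(T_1)+\Psi(T_2)$ is pre-closed and $\Psi(T_1\,\hat{+}\,T_2)=\Psi(T_1)\,\hat{+}\,\Psi(T_2)$;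 similarly for strong-product; it respects adjoint if $\Psi(T^* )=\Psi(T)^*$ for all $T$. *)

theory Defs
  imports "HOL-Analysis.Analysis"
begin

section \<open>Complex Hilbert spaces\<close>

text \<open>
  The real structure (\<open>scaleR\<close>, \<open>inner\<close>, \<open>norm\<close>, topology, completeness) is the one
  of the library. The complex inner product is linear in its first argument; positive definiteness
  follows from \<open>inner_eq_Re_cinner\<close> and \<open>cinner_commute\<close>.
\<close>

class chilbert_space = real_inner + banach +
  fixes scaleC :: "complex \<Rightarrow> 'a \<Rightarrow> 'a" (infixr "*\<^sub>C" 75)
    and cinner :: "'a \<Rightarrow> 'a \<Rightarrow> complex"
  assumes scaleC_add_right: "a *\<^sub>C (x + y) = a *\<^sub>C x + a *\<^sub>C y"
    and scaleC_add_left: "(a + b) *\<^sub>C x = a *\<^sub>C x + b *\<^sub>C x"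
    and scaleC_scaleC: "a *\<^sub>C b *\<^sub>C x = (a * b) *\<^sub>C x"
    and scaleR_scaleC: "r *\<^sub>R x = complex_of_real r *\<^sub>C x"
    and cinner_commute: "cinner x y = cnj (cinner y x)"
    and cinner_add_left: "cinner (x + y) z = cinner x z + cinner y z"
    and cinner_scaleC_left: "cinner (a *\<^sub>C x) y = a * cinner x y"
    and inner_eq_Re_cinner: "inner x y = Re (cinner x y)"

instantiation complex :: chilbert_space
begin

definition scaleC_complex :: "complex \<Rightarrow> complex \<Rightarrow> complex"
  where "scaleC_complex a x = a * x"

definition cinner_complex :: "complex \<Rightarrow> complex \<Rightarrow> complex"
  where "cinner_complex x y = x * cnj y"

instance
  by standard
    (auto simp: scaleC_complex_def cinner_complex_def algebra_simps scaleR_conv_of_real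
      inner_complex_def)

end

lemma norm_scaleC: "norm (a *\<^sub>C x) = cmod a * norm (x :: 'a::chilbert_space)"
proof -
  have r: "cinner x (a *\<^sub>C y) = cnj a * cinner x y" for x y :: 'a
    by (metis cinner_commute cinner_scaleC_left complex_cnj_mult)
  have "cinner (a *\<^sub>C x) (a *\<^sub>C x) = complex_of_real ((cmod a)\<^sup>2) * cinner x x"
    by (simp add: r cinner_scaleC_left complex_norm_square mult.assoc del: of_real_power)
  then have "(norm (a *\<^sub>C x))\<^sup>2 = (cmod a * norm x)\<^sup>2"
    by (simp add: power2_norm_eq_inner inner_eq_Re_cinner power_mult_distrib del: of_real_power)
  then show ?thesis
    by (simp add: power2_eq_iff_nonneg)
qed

lemma bounded_linear_scaleC: "bounded_linear (\<lambda>x :: 'a::chilbert_space. a *\<^sub>C x)"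
  by (rule bounded_linear_intro[where K = "cmod a"])
    (auto simp: scaleC_add_right scaleR_scaleC scaleC_scaleC norm_scaleC mult.commute)


section \<open>Bounded operators and von Neumann algebras\<close>

text \<open>
  The library type \<open>'a \<Rightarrow>\<^sub>L 'a\<close> consists of the bounded real-linear maps, so the algebra
  of bounded operators of a Hilbert space is the following subset of it.
\<close>

definition bounded_ops :: "('a::chilbert_space \<Rightarrow>\<^sub>L 'a) set"
  where "bounded_ops = {A. \<forall>c x. blinfun_apply A (c *\<^sub>C x) = c *\<^sub>C blinfun_apply A x}"

definition scale_op :: "complex \<Rightarrow> ('a::chilbert_space \<Rightarrow>\<^sub>L 'a) \<Rightarrow> ('a \<Rightarrow>\<^sub>L 'a)"
  where "scale_op c A = Blinfun (\<lambda>x. c *\<^sub>C blinfun_apply A x)"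

lemma scale_op_apply: "blinfun_apply (scale_op c A) x = c *\<^sub>C blinfun_apply A x"
  unfolding scale_op_def
  by (simp add: bounded_linear_Blinfun_apply
      bounded_linear_compose[OF bounded_linear_scaleC blinfun.bounded_linear_right])

definition adj :: "('a::chilbert_space \<Rightarrow>\<^sub>L 'a) \<Rightarrow> ('a \<Rightarrow>\<^sub>L 'a)"
  where "adj A =
    (THE B. \<forall>x y. cinner (blinfun_apply A x) y = cinner x (blinfun_apply B y))"

definition unitary :: "('a::chilbert_space \<Rightarrow>\<^sub>L 'a) \<Rightarrow> bool"
  where "unitary U \<longleftrightarrow>
    U \<in> bounded_ops \<and> adj U o\<^sub>L U = id_blinfun \<and> U o\<^sub>L adj U = id_blinfun"

definition commutant :: "('a::chilbert_space \<Rightarrow>\<^sub>L 'a) set \<Rightarrow> ('a \<Rightarrow>\<^sub>L 'a) set"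
  where "commutant M = {A \<in> bounded_ops. \<forall>B\<in>M. A o\<^sub>L B = B o\<^sub>L A}"

definition von_neumann_algebra :: "('a::chilbert_space \<Rightarrow>\<^sub>L 'a) set \<Rightarrow> bool"
  where "von_neumann_algebra M \<longleftrightarrow>
    M \<subseteq> bounded_ops \<and> id_blinfun \<in> M \<and>
    (\<forall>A\<in>M. \<forall>B\<in>M. A + B \<in> M) \<and>
    (\<forall>c. \<forall>A\<in>M. scale_op c A \<in> M) \<and>
    (\<forall>A\<in>M. \<forall>B\<in>M. A o\<^sub>L B \<in> M) \<and>
    (\<forall>A\<in>M. adj A \<in> M) \<and>
    closedin strong_operator_topology M"

definition self_adjoints :: "('a::chilbert_space \<Rightarrow>\<^sub>L 'a) set \<Rightarrow> ('a \<Rightarrow>\<^sub>L 'a) set"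
  where "self_adjoints M = {A \<in> M. adj A = A}"

text \<open>The operator order, used for self-adjoint operators only; there the quadratic forms are real.\<close>

definition op_le :: "('a::chilbert_space \<Rightarrow>\<^sub>L 'a) \<Rightarrow> ('a \<Rightarrow>\<^sub>L 'a) \<Rightarrow> bool"
  where "op_le A B \<longleftrightarrow>
    (\<forall>x. Re (cinner (blinfun_apply A x) x) \<le> Re (cinner (blinfun_apply B x) x))"

definition is_op_lub ::
    "('a::chilbert_space \<Rightarrow>\<^sub>L 'a) set \<Rightarrow> ('a \<Rightarrow>\<^sub>L 'a) set \<Rightarrow> ('a \<Rightarrow>\<^sub>L 'a) \<Rightarrow> bool"
  where "is_op_lub M D S \<longleftrightarrow>
    S \<in> self_adjoints M \<and> (\<forall>A\<in>D. op_le A S) \<and>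
    (\<forall>B\<in>self_adjoints M. (\<forall>A\<in>D. op_le A B) \<longrightarrow> op_le S B)"

definition unital_star_hom ::
    "('a::chilbert_space \<Rightarrow>\<^sub>L 'a) set \<Rightarrow> ('b::chilbert_space \<Rightarrow>\<^sub>L 'b) set \<Rightarrow>
     (('a \<Rightarrow>\<^sub>L 'a) \<Rightarrow> ('b \<Rightarrow>\<^sub>L 'b)) \<Rightarrow> bool"
  where "unital_star_hom M N \<Phi> \<longleftrightarrow>
    \<Phi> \<in> M \<rightarrow> N \<and> \<Phi> id_blinfun = id_blinfun \<and>
    (\<forall>A\<in>M. \<forall>B\<in>M. \<Phi> (A + B) = \<Phi> A + \<Phi> B) \<and>
    (\<forall>c. \<forall>A\<in>M. \<Phi> (scale_op c A) = scale_op c (\<Phi> A)) \<and>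
    (\<forall>A\<in>M. \<forall>B\<in>M. \<Phi> (A o\<^sub>L B) = \<Phi> A o\<^sub>L \<Phi> B) \<and>
    (\<forall>A\<in>M. \<Phi> (adj A) = adj (\<Phi> A))"

text \<open>
  Normality: suprema of bounded increasing nets of self-adjoint elements are preserved. The range
  of an increasing net is an upward directed set, and having a least upper bound entails
  boundedness.
\<close>

definition normal_map ::
    "('a::chilbert_space \<Rightarrow>\<^sub>L 'a) set \<Rightarrow> ('b::chilbert_space \<Rightarrow>\<^sub>L 'b) set \<Rightarrow>
     (('a \<Rightarrow>\<^sub>L 'a) \<Rightarrow> ('b \<Rightarrow>\<^sub>L 'b)) \<Rightarrow> bool"
  where "normal_map M N \<Phi> \<longleftrightarrow>
    (\<forall>D S. D \<noteq> {} \<longrightarrow> D \<subseteq> self_adjoints M \<longrightarrow>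
       (\<forall>A\<in>D. \<forall>B\<in>D. \<exists>C\<in>D. op_le A C \<and> op_le B C) \<longrightarrow>
       is_op_lub M D S \<longrightarrow> is_op_lub N (\<Phi> ` D) (\<Phi> S))"


section \<open>Unbounded operators\<close>

text \<open>
  Unbounded operators are partial maps \<open>'a \<rightharpoonup> 'a\<close>, so that equality of operators includes
  equality of domains. The conditions below include that \<open>dom T\<close> is a complex linear
  subspace. The product of operators is \<open>map_comp\<close>, written \<open>S \<circ>\<^sub>m T\<close>.
\<close>

definition unbounded_op :: "('a::chilbert_space \<rightharpoonup> 'a) \<Rightarrow> bool"
  where "unbounded_op T \<longleftrightarrow>
    0 \<in> dom T \<and>
    (\<forall>x\<in>dom T. \<forall>y\<in>dom T. T (x + y) = Some (the (T x) + the (T y))) \<and>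
    (\<forall>c. \<forall>x\<in>dom T. T (c *\<^sub>C x) = Some (c *\<^sub>C the (T x)))"

definition closed_op :: "('a::chilbert_space \<rightharpoonup> 'a) \<Rightarrow> bool"
  where "closed_op T \<longleftrightarrow> unbounded_op T \<and> closed (Map.graph T)"

definition preclosed_op :: "('a::chilbert_space \<rightharpoonup> 'a) \<Rightarrow> bool"
  where "preclosed_op T \<longleftrightarrow>
    (\<exists>S. unbounded_op S \<and> Map.graph S = closure (Map.graph T))"

definition closure_op :: "('a::chilbert_space \<rightharpoonup> 'a) \<Rightarrow> ('a \<rightharpoonup> 'a)"
  where "closure_op T = (THE S. Map.graph S = closure (Map.graph T))"

definition op_of :: "('a::chilbert_space \<Rightarrow>\<^sub>L 'a) \<Rightarrow> ('a \<rightharpoonup> 'a)"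
  where "op_of A = (\<lambda>x. Some (blinfun_apply A x))"

definition op_plus :: "('a::chilbert_space \<rightharpoonup> 'a) \<Rightarrow> ('a \<rightharpoonup> 'a) \<Rightarrow> ('a \<rightharpoonup> 'a)"
  where "op_plus S T =
    (\<lambda>x. if x \<in> dom S \<inter> dom T then Some (the (S x) + the (T x)) else None)"

definition strong_sum :: "('a::chilbert_space \<rightharpoonup> 'a) \<Rightarrow> ('a \<rightharpoonup> 'a) \<Rightarrow> ('a \<rightharpoonup> 'a)"
  where "strong_sum S T = closure_op (op_plus S T)"

definition strong_prod :: "('a::chilbert_space \<rightharpoonup> 'a) \<Rightarrow> ('a \<rightharpoonup> 'a) \<Rightarrow> ('a \<rightharpoonup> 'a)"
  where "strong_prod S T = closure_op (S \<circ>\<^sub>m T)"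

definition op_adj :: "('a::chilbert_space \<rightharpoonup> 'a) \<Rightarrow> ('a \<rightharpoonup> 'a)"
  where "op_adj T =
    (\<lambda>y. if continuous_on (dom T) (\<lambda>x. cinner (the (T x)) y)
         then Some (THE z. z \<in> closure (dom T) \<and>
                      (\<forall>x\<in>dom T. cinner (the (T x)) y = cinner x z))
         else None)"


section \<open>Quotients and affiliated operators\<close>

definition null :: "('a::chilbert_space \<Rightarrow>\<^sub>L 'a) \<Rightarrow> 'a set"
  where "null A = {x. blinfun_apply A x = 0}"

text \<open>Meaningful only if \<open>null B \<subseteq> null A\<close>, which makes the described value unique.\<close>

definition quot :: "('a::chilbert_space \<Rightarrow>\<^sub>L 'a) \<Rightarrow> ('a \<Rightarrow>\<^sub>L 'a) \<Rightarrow> ('a \<rightharpoonup> 'a)"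
  where "quot A B =
    (\<lambda>y. if y \<in> range (blinfun_apply B)
         then Some (THE z. \<exists>x. y = blinfun_apply B x \<and> z = blinfun_apply A x)
         else None)"

definition aff :: "('a::chilbert_space \<Rightarrow>\<^sub>L 'a) set \<Rightarrow> ('a \<rightharpoonup> 'a) set"
  where "aff M = {quot A B | A B. A \<in> M \<and> B \<in> M \<and> null B \<subseteq> null A}"

definition aff_MvN :: "('a::chilbert_space \<Rightarrow>\<^sub>L 'a) set \<Rightarrow> ('a \<rightharpoonup> 'a) set"
  where "aff_MvN M = {T. closed_op T \<and>
    (\<forall>U\<in>commutant M. unitary U \<longrightarrow> op_of (adj U) \<circ>\<^sub>m T \<circ>\<^sub>m op_of U = T)}"

definition aff_ext ::
    "('a::chilbert_space \<Rightarrow>\<^sub>L 'a) set \<Rightarrow>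
     (('a \<Rightarrow>\<^sub>L 'a) \<Rightarrow> ('b::chilbert_space \<Rightarrow>\<^sub>L 'b)) \<Rightarrow>
     ('a \<rightharpoonup> 'a) \<Rightarrow> ('b \<rightharpoonup> 'b)"
  where "aff_ext M \<Phi> = (\<lambda>T\<in>aff M.
    THE S. \<exists>A\<in>M. \<exists>B\<in>M. null B \<subseteq> null A \<and> T = quot A B \<and> S = quot (\<Phi> A) (\<Phi> B))"


section \<open>Properties of maps between affiliated operators\<close>

definition extends ::
    "('a::chilbert_space \<Rightarrow>\<^sub>L 'a) set \<Rightarrow>
     (('a \<Rightarrow>\<^sub>L 'a) \<Rightarrow> ('b::chilbert_space \<Rightarrow>\<^sub>L 'b)) \<Rightarrow>
     (('a \<rightharpoonup> 'a) \<Rightarrow> ('b \<rightharpoonup> 'b)) \<Rightarrow> bool"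
  where "extends M \<Phi> \<Psi> \<longleftrightarrow> (\<forall>A\<in>M. \<Psi> (op_of A) = op_of (\<Phi> A))"

definition respects_strong_sum ::
    "('a::chilbert_space \<Rightarrow>\<^sub>L 'a) set \<Rightarrow>
     (('a \<rightharpoonup> 'a) \<Rightarrow> ('b::chilbert_space \<rightharpoonup> 'b)) \<Rightarrow> bool"
  where "respects_strong_sum M \<Psi> \<longleftrightarrow>
    (\<forall>S\<in>aff_MvN M. \<forall>T\<in>aff_MvN M. preclosed_op (op_plus S T) \<longrightarrow>
       preclosed_op (op_plus (\<Psi> S) (\<Psi> T)) \<and>
       \<Psi> (strong_sum S T) = strong_sum (\<Psi> S) (\<Psi> T))"

definition respects_strong_prod ::
    "('a::chilbert_space \<Rightarrow>\<^sub>L 'a) set \<Rightarrow>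
     (('a \<rightharpoonup> 'a) \<Rightarrow> ('b::chilbert_space \<rightharpoonup> 'b)) \<Rightarrow> bool"
  where "respects_strong_prod M \<Psi> \<longleftrightarrow>
    (\<forall>S\<in>aff_MvN M. \<forall>T\<in>aff_MvN M. preclosed_op (S \<circ>\<^sub>m T) \<longrightarrow>
       preclosed_op (\<Psi> S \<circ>\<^sub>m \<Psi> T) \<and>
       \<Psi> (strong_prod S T) = strong_prod (\<Psi> S) (\<Psi> T))"

definition respects_adjoint ::
    "('a::chilbert_space \<Rightarrow>\<^sub>L 'a) set \<Rightarrow>
     (('a \<rightharpoonup> 'a) \<Rightarrow> ('b::chilbert_space \<rightharpoonup> 'b)) \<Rightarrow> bool"
  where "respects_adjoint M \<Psi> \<longleftrightarrow>
    (\<forall>T\<in>aff_MvN M. \<Psi> (op_adj T) = op_adj (\<Psi> T))"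

text \<open>
  The use of \<open>\<rightarrow>\<^sub>E\<close> makes HOL equality of such maps the same as equality of maps
  on \<open>aff_MvN M\<close>.
\<close>

definition MvN_extension ::
    "('a::chilbert_space \<Rightarrow>\<^sub>L 'a) set \<Rightarrow> ('b::chilbert_space \<Rightarrow>\<^sub>L 'b) set \<Rightarrow>
     (('a \<Rightarrow>\<^sub>L 'a) \<Rightarrow> ('b \<Rightarrow>\<^sub>L 'b)) \<Rightarrow>
     (('a \<rightharpoonup> 'a) \<Rightarrow> ('b \<rightharpoonup> 'b)) \<Rightarrow> bool"
  where "MvN_extension M N \<Phi> \<Psi> \<longleftrightarrow>
    \<Psi> \<in> aff_MvN M \<rightarrow>\<^sub>E aff_MvN N \<and> extends M \<Phi> \<Psi> \<and>
    respects_strong_sum M \<Psi> \<and> respects_strong_prod M \<Psi> \<and> respects_adjoint M \<Psi>"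

end

theory Submission
  imports Defs
begin

text \<open>
  Closed operators are handled through their graphs. An operator \<open>T\<close> in \<open>\<M>\<^sub>a\<^sub>f\<^sub>f\<close> has as graph an operator range
  in \<open>H \<oplus> H\<close>, namely that of the matrix with first column \<open>(B, A)\<close> and second column zero if \<open>T = A/B\<close>. The key fact
  is that the amplification of \<open>\<Phi>\<close> to \<open>2 \<times> 2\<close> matrices maps kernel projections to kernel projections, by
  normality; hence it preserves inclusions between kernels and between closures of ranges. Graphs
  of strong sums, strong products and adjoints of quotients are closures of images of kernels of
  \<open>2 \<times> 2\<close> matrices over \<open>\<M>\<close>, so they are carried to the corresponding graphs. That the image of a
  closed quotient is closed uses only that \<open>\<Phi>\<close> is positive: \<open>V\<close> has closed range iff
  \<open>(V\<^sup>*V)\<^sup>2 \<ge> c V\<^sup>*V\<close> for some \<open>c > 0\<close>.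

  For uniqueness write \<open>T = A \<cdot> R\<close> with \<open>R = E/B\<close> and \<open>E\<close> the projection onto the orthogonal complement of the kernel
  of \<open>B\<close>. The products \<open>R \<cdot> B = E\<close> and \<open>B \<cdot> R\<close>, whose closure \<open>J\<close> is the identity on the closure of the range of \<open>B\<close>,
  together with \<open>J + (-1) = 0 \<cdot> J\<close>, determine the image of \<open>R\<close>.
\<close>

section \<open>Real Hilbert spaces\<close>

text \<open>All analysis uses the real inner product. On complex-linear operators the real adjoint
  \<open>radj\<close> is the usual one, and pairs are then a Hilbert space on which the 2 x 2
  matrices act. Kernels are the natural invariants because a sum or product of closed operators need
  not be closed, while an inclusion ker X \<subseteq> ker Y is the algebraic equation Y p = 0 for
  the projection p onto ker X. A homomorphism thus controls kernels and, through adjoints, closures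
  of ranges. That a closed range stays closed is a separate matter: it means that V*V has a spectral
  gap above 0, which is an operator inequality. Passing from affiliation to quotients rests on the
  double commutant theorem, since affiliation speaks only of unitaries of the commutant. In the
  uniqueness part the difficulty is the domain: an extension is only known to respect closures of
  sums and products, so the image of R might a priori be defined on too many vectors. The detour
  through J excludes this, because the image of J must act as an identity.\<close>

text \<open>
  The semi-inner product \<open>q\<close> lives on an arbitrary real vector space, so that the lemma also covers
  algebras of operators, seminormed by their values on finitely many vectors.
\<close>

lemma riesz_sequence:
  fixes q :: "'v::real_vector \<Rightarrow> 'v \<Rightarrow> real"
  assumes V: "0 \<in> V" "\<And>x y. x \<in> V \<Longrightarrow> y \<in> V \<Longrightarrow> x + y \<in> V" "\<And>c x. x \<in> V \<Longrightarrow> c *\<^sub>R x \<in> V"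
    and q_add: "\<And>x y z. q (x + y) z = q x z + q y z"
    and q_scale: "\<And>c x z. q (c *\<^sub>R x) z = c * q x z"
    and q_sym: "\<And>x y. q x y = q y x"
    and q_pos: "\<And>x. 0 \<le> q x x"
    and f_add: "\<And>x y. x \<in> V \<Longrightarrow> y \<in> V \<Longrightarrow> f (x + y) = f x + f y"
    and f_scale: "\<And>c x. x \<in> V \<Longrightarrow> f (c *\<^sub>R x) = c * f x"
    and f_bound: "\<And>x. x \<in> V \<Longrightarrow> \<bar>f x\<bar> \<le> K * sqrt (q x x)"
  obtains a :: "nat \<Rightarrow> 'v" where "\<And>n. a n \<in> V"
    "\<And>m n. q (a m - a n) (a m - a n) \<le> 2 / real (Suc m) + 2 / real (Suc n)"
    "\<And>x. x \<in> V \<Longrightarrow> (\<lambda>n. q x (a n)) \<longlonglongrightarrow> f x"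
proof -
  have q_add': "q z (x + y) = q z x + q z y" for x y z
    by (metis q_add q_sym)
  have q_scale': "q z (c *\<^sub>R x) = c * q z x" for c x z
    by (metis q_scale q_sym)
  \<comment> \<open>If z represents f, then \<phi> x is the squared distance from x to z minus the
    squared norm of z. A minimising sequence of \<phi> therefore approaches the representing
    vector.\<close>
  define \<phi> where "\<phi> x = q x x - 2 * f x" for x
  have low: "- (K\<^sup>2) \<le> \<phi> x" if "x \<in> V" for x
  proof -
    have "q x x = (sqrt (q x x))\<^sup>2" using q_pos by simp
    moreover have "0 \<le> (sqrt (q x x) - K)\<^sup>2" by simp
    ultimately have "2 * (K * sqrt (q x x)) \<le> q x x + K\<^sup>2"
      by (simp add: power2_diff mult.commute)
    then show ?thesis using f_bound[OF that] unfolding \<phi>_def by linarith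
  qed
  define I where "I = Inf (\<phi> ` V)"
  have bdd: "bdd_below (\<phi> ` V)" using low by (auto intro!: bdd_belowI)
  have I_le: "I \<le> \<phi> x" if "x \<in> V" for x
    unfolding I_def by (rule cInf_lower) (use that bdd in auto)
  have "\<exists>x\<in>V. \<phi> x < I + 1 / real (Suc n)" for n
  proof -
    have "Inf (\<phi> ` V) < I + 1 / real (Suc n)" by (simp add: I_def)
    then show ?thesis using cInf_lessD[of "\<phi> ` V"] V(1) by blast
  qed
  then obtain a where a: "\<And>n. a n \<in> V" "\<And>n. \<phi> (a n) < I + 1 / real (Suc n)" by metis
  \<comment> \<open>Parallelogram law: the midpoint of two near-minimisers lies in V again and
    cannot fall below the infimum.\<close>
  have cau: "q (a m - a n) (a m - a n) \<le> 2 / real (Suc m) + 2 / real (Suc n)" for m n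
  proof -
    let ?s = "(1/2) *\<^sub>R (a m + a n)"
    have s: "?s \<in> V" using V a by blast
    have "a m - a n = a m + (-1) *\<^sub>R a n" by simp
    then have "q (a m - a n) (a m - a n) = q (a m) (a m) - 2 * q (a m) (a n) + q (a n) (a n)"
      by (simp only: q_add q_add' q_scale q_scale' q_sym[of "a n" "a m"]) (simp add: algebra_simps)
    moreover have "q ?s ?s = (q (a m) (a m) + 2 * q (a m) (a n) + q (a n) (a n)) / 4"
      by (simp only: q_add q_add' q_scale q_scale' q_sym[of "a n" "a m"]) (simp add: algebra_simps)
    moreover have "f ?s = (f (a m) + f (a n)) / 2"
      using f_scale[of "a m + a n" "1/2"] f_add V a by simp
    ultimately have "q (a m - a n) (a m - a n) = 2 * \<phi> (a m) + 2 * \<phi> (a n) - 4 * \<phi> ?s"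
      unfolding \<phi>_def by (simp add: field_simps)
    then show ?thesis using I_le[OF s] a(2)[of m] a(2)[of n] by simp
  qed
  have lim: "(\<lambda>n. q x (a n)) \<longlonglongrightarrow> f x" if x: "x \<in> V" for x
  proof -
    \<comment> \<open>As q is only semidefinite, q x x may vanish; adding 1 gives a positive
      denominator.\<close>
    define s where "s = q x x + 1"
    have s: "s > 0" "q x x \<le> s" using q_pos[of x] by (auto simp: s_def)
    have bound: "(q x (a n) - f x)\<^sup>2 \<le> s * (1 / real (Suc n))" for n
    proof -
      define d where "d = q x (a n) - f x"
      \<comment> \<open>The minimiser of the quadratic 2 t d + t^2 s, whose minimum is - d^2 /
        s.\<close>
      define t where "t = - d / s"
      have y: "t *\<^sub>R x \<in> V" "a n + t *\<^sub>R x \<in> V" using V a x by auto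
      have "\<phi> (a n + t *\<^sub>R x) = \<phi> (a n) + 2 * t * d + t\<^sup>2 * q x x"
        unfolding \<phi>_def d_def f_add[OF a(1) y(1)] f_scale[OF x]
        by (simp only: q_add q_add' q_scale q_scale' q_sym[of "a n" x])
          (simp add: algebra_simps power2_eq_square)
      also have "\<dots> \<le> \<phi> (a n) + 2 * t * d + t\<^sup>2 * s"
        using s by (simp add: mult_left_mono)
      finally have "\<phi> (a n + t *\<^sub>R x) \<le> \<phi> (a n) + (2 * t * d + t\<^sup>2 * s)" by simp
      moreover have "2 * t * d + t\<^sup>2 * s = - (d\<^sup>2 / s)"
        using s by (simp add: t_def field_simps power2_eq_square)
      ultimately have "d\<^sup>2 / s \<le> 1 / real (Suc n)"
        using I_le[OF y(2)] a(2)[of n] by linarith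
      then show ?thesis using s by (simp add: d_def field_simps)
    qed
    have "(\<lambda>n. s * (1 / real (Suc n))) \<longlonglongrightarrow> s * 0"
      by (rule tendsto_mult_left[OF LIMSEQ_Suc[OF lim_1_over_n]])
    then have lim0: "(\<lambda>n. s * (1 / real (Suc n))) \<longlonglongrightarrow> 0" by simp
    have "(\<lambda>n. (q x (a n) - f x)\<^sup>2) \<longlonglongrightarrow> 0"
    proof (rule tendsto_sandwich[OF _ _ tendsto_const lim0])
      show "\<forall>\<^sub>F n in sequentially. 0 \<le> (q x (a n) - f x)\<^sup>2" by simp
      show "\<forall>\<^sub>F n in sequentially. (q x (a n) - f x)\<^sup>2 \<le> s * (1 / real (Suc n))"
        using bound by (intro always_eventually allI)
    qed
    then have "(\<lambda>n. q x (a n) - f x) \<longlonglongrightarrow> 0"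
      using tendsto_real_sqrt[of "\<lambda>n. (q x (a n) - f x)\<^sup>2" 0]
      by (simp add: tendsto_rabs_zero_iff)
    then show ?thesis by (simp add: LIM_zero_iff)
  qed
  show ?thesis using that a(1) cau lim by blast
qed

lemma CauchyI_sq_bound:
  fixes x :: "nat \<Rightarrow> 'a::real_inner"
  assumes "\<And>m n. (norm (x m - x n))\<^sup>2 \<le> 2 / real (Suc m) + 2 / real (Suc n)"
  shows "Cauchy x"
proof (rule CauchyI)
  fix e :: real assume e: "0 < e"
  obtain N where N: "4 / e\<^sup>2 < real N" using reals_Archimedean2 by blast
  have "norm (x m - x n) < e" if "m \<ge> N" "n \<ge> N" for m n
  proof -
    have N0: "0 < real (Suc N)" by simp
    have "2 / real (Suc m) \<le> 2 / real (Suc N)" "2 / real (Suc n) \<le> 2 / real (Suc N)"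
      using that by (auto intro!: divide_left_mono)
    then have "(norm (x m - x n))\<^sup>2 \<le> 4 / real (Suc N)" using assms[of m n] by linarith
    also have "\<dots> < e\<^sup>2"
    proof -
      have "4 / e\<^sup>2 < real (Suc N)" using N by simp
      then show ?thesis using e by (simp add: field_simps del: of_nat_Suc)
    qed
    finally show ?thesis using e by (simp add: power_less_imp_less_base)
  qed
  then show "\<exists>M. \<forall>m\<ge>M. \<forall>n\<ge>M. norm (x m - x n) < e" by blast
qed

text \<open>V need not be closed. The minimising sequence converges in the ambient space, so the
  representing vector lies in \<open>closure V\<close>, exactly where \<open>op_adj\<close> looks
  for its value.\<close>

lemma riesz_subspace:
  fixes V :: "'a::{real_inner,banach} set"
  assumes "subspace V"
    and "\<And>x y. x \<in> V \<Longrightarrow> y \<in> V \<Longrightarrow> f (x + y) = f x + f y"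
    and "\<And>c x. x \<in> V \<Longrightarrow> f (c *\<^sub>R x) = c * f x"
    and "\<And>x. x \<in> V \<Longrightarrow> \<bar>f x\<bar> \<le> K * norm x"
  obtains z where "z \<in> closure V" "\<And>x. x \<in> V \<Longrightarrow> f x = inner x z"
proof -
  obtain a where a: "\<And>n. a n \<in> V"
    "\<And>m n. inner (a m - a n) (a m - a n) \<le> 2 / real (Suc m) + 2 / real (Suc n)"
    "\<And>x. x \<in> V \<Longrightarrow> (\<lambda>n. inner x (a n)) \<longlonglongrightarrow> f x"
    by (rule riesz_sequence[of V inner f K])
      (use assms in \<open>auto simp: inner_add_left inner_add_right inner_commute subspace_0
        subspace_add subspace_scale norm_eq_sqrt_inner\<close>)
  have "Cauchy a"
    by (rule CauchyI_sq_bound) (use a(2) in \<open>simp add: power2_norm_eq_inner\<close>)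
  then obtain z where z: "a \<longlonglongrightarrow> z" using Cauchy_convergent convergent_def by blast
  have "z \<in> closure V" using a(1) z closure_sequential by blast
  moreover have "f x = inner x z" if "x \<in> V" for x
    using tendsto_inner[OF tendsto_const z, of x] a(3)[OF that] LIMSEQ_unique by blast
  ultimately show ?thesis using that by blast
qed

lemma closed_subspace_projection:
  fixes V :: "'a::{real_inner,banach} set"
  assumes "subspace V" "closed V"
  obtains p where "p \<in> V" "\<And>x. x \<in> V \<Longrightarrow> inner x (w - p) = 0"
proof -
  obtain z where "z \<in> closure V" "\<And>x. x \<in> V \<Longrightarrow> inner x w = inner x z"
    by (rule riesz_subspace[OF assms(1), of "\<lambda>x. inner x w" "norm w"])
      (auto simp: inner_add_left Cauchy_Schwarz_ineq2 mult.commute)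
  with assms show ?thesis using that[of z] by (simp add: inner_diff_right closure_closed)
qed

text \<open>The adjoint for the real inner product, between possibly different spaces. This allows
  embeddings of H into H \<oplus> H to have adjoints too; on complex-linear operators it agrees with
  \<open>adj\<close>.\<close>

definition radj :: "('a::{real_inner,banach} \<Rightarrow>\<^sub>L 'b::{real_inner,banach}) \<Rightarrow> ('b \<Rightarrow>\<^sub>L 'a)"
  where "radj A = (SOME B :: 'b \<Rightarrow>\<^sub>L 'a. \<forall>x y. inner (A x) y = inner x (B y))"

lemma inner_ext: "(\<And>x. inner x y = inner x z) \<Longrightarrow> y = (z :: 'a::real_inner)"
  by (metis inner_diff_right inner_eq_zero_iff right_minus_eq)

lemma inner_radj_right: "inner (blinfun_apply A x) y = inner x (radj A y)"
proof -
  have "\<exists>z. \<forall>x. inner (A x) y = inner x z" for y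
  proof -
    obtain z where "\<And>x. x \<in> UNIV \<Longrightarrow> inner (A x) y = inner x z"
    proof (rule riesz_subspace[of UNIV "\<lambda>x. inner (A x) y" "norm A * norm y"])
      show "\<bar>inner (A x) y\<bar> \<le> norm A * norm y * norm x" for x
      proof -
        have "\<bar>inner (A x) y\<bar> \<le> norm (A x) * norm y" by (rule Cauchy_Schwarz_ineq2)
        also have "\<dots> \<le> norm A * norm x * norm y" by (simp add: mult_right_mono norm_blinfun)
        finally show ?thesis by (simp add: mult_ac)
      qed
    qed (auto simp: blinfun.bilinear_simps inner_add_left)
    then show ?thesis by blast
  qed
  then obtain B where B: "\<And>x y. inner (A x) y = inner x (B y)" by metis
  have lin: "bounded_linear B"
  proof (rule bounded_linear_intro[where K = "norm A"])
    show "B (x + y) = B x + B y" for x y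
      by (rule inner_ext) (simp add: B[symmetric] inner_add_right)
    show "B (r *\<^sub>R x) = r *\<^sub>R B x" for r x
      by (rule inner_ext) (simp add: B[symmetric])
    show "norm (B x) \<le> norm x * norm A" for x
    proof (cases "B x = 0")
      case False
      have "(norm (B x))\<^sup>2 = inner (A (B x)) x" by (simp add: B power2_norm_eq_inner)
      also have "\<dots> \<le> norm (A (B x)) * norm x" by (rule norm_cauchy_schwarz)
      also have "\<dots> \<le> norm A * norm (B x) * norm x" by (simp add: mult_right_mono norm_blinfun)
      finally show ?thesis using False by (simp add: power2_eq_square mult_ac)
    qed auto
  qed
  have "\<forall>x y. inner (A x) y = inner x (radj A y)"
    unfolding radj_def
    by (rule someI[of _ "Blinfun B"]) (simp add: B bounded_linear_Blinfun_apply[OF lin])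
  then show ?thesis by blast
qed

lemma inner_radj_left: "inner (radj A x) y = inner x (blinfun_apply A y)"
  by (metis inner_commute inner_radj_right)

lemma radj_unique:
  assumes "\<And>x y. inner (blinfun_apply A x) y = inner x (blinfun_apply B y)"
  shows "radj A = B"
  by (rule blinfun_eqI, rule inner_ext) (simp add: assms inner_radj_right[symmetric])

lemma radj_radj [simp]: "radj (radj A) = A"
  by (rule radj_unique) (simp add: inner_radj_left)

lemma radj_compose: "radj (A o\<^sub>L B) = radj B o\<^sub>L radj A"
  by (rule radj_unique) (simp add: inner_radj_right)

lemma radj_add: "radj (A + B) = radj A + radj B"
  by (rule radj_unique) (simp add: blinfun.bilinear_simps inner_add_left inner_add_right inner_radj_right)

lemma radj_diff: "radj (A - B) = radj A - radj B"
  by (rule radj_unique) (simp add: blinfun.bilinear_simps inner_diff_left inner_diff_right inner_radj_right)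

lemma radj_scaleR: "radj (c *\<^sub>R A) = c *\<^sub>R radj A"
  by (rule radj_unique) (simp add: blinfun.bilinear_simps inner_radj_right)

lemma radj_id [simp]: "radj id_blinfun = id_blinfun"
  by (rule radj_unique) simp

lemma radj_zero [simp]: "radj 0 = 0"
  by (rule radj_unique) simp

lemma norm_radj: "norm (radj A) = norm A"
proof -
  have le: "norm (radj A) \<le> norm A" for A :: "'x::{real_inner,banach} \<Rightarrow>\<^sub>L 'y::{real_inner,banach}"
  proof (rule norm_blinfun_bound)
    fix x
    show "norm (radj A x) \<le> norm A * norm x"
    proof (cases "radj A x = 0")
      case False
      have "(norm (radj A x))\<^sup>2 = inner x (A (radj A x))"
        by (simp add: inner_radj_left[symmetric] power2_norm_eq_inner)
      also have "\<dots> \<le> norm x * norm (A (radj A x))" by (rule norm_cauchy_schwarz)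
      also have "\<dots> \<le> norm x * (norm A * norm (radj A x))" by (simp add: mult_left_mono norm_blinfun)
      finally show ?thesis using False by (simp add: power2_eq_square mult_ac)
    qed auto
  qed auto
  show ?thesis using le[of A] le[of "radj A"] by simp
qed

section \<open>Ranges, kernels and closures of subspaces\<close>

lemma blinfun_linear: "linear (blinfun_apply A)"
  by (simp add: blinfun.bounded_linear_right bounded_linear.linear)

lemma subspace_range_blinfun: "subspace (range (blinfun_apply A))"
  by (rule linear_subspace_image[OF blinfun_linear subspace_UNIV])

lemma closed_null_blinfun: "closed {x. blinfun_apply A x = 0}"
  by (intro closed_Collect_eq continuous_intros)

lemma subspace_closure:
  fixes V :: "'a::real_normed_vector set"
  assumes "subspace V"
  shows "subspace (closure V)"
proof (rule subspaceI)
  show "0 \<in> closure V"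
    using assms closure_subset subspace_0 by blast
  show "x + y \<in> closure V" if xy: "x \<in> closure V" "y \<in> closure V" for x y
  proof -
    obtain f g where fg: "\<forall>n. f n \<in> V" "f \<longlonglongrightarrow> x" "\<forall>n. g n \<in> V" "g \<longlonglongrightarrow> y"
      using xy unfolding closure_sequential by blast
    have "\<forall>n. f n + g n \<in> V" using fg assms by (simp add: subspace_add)
    then show ?thesis unfolding closure_sequential
      using tendsto_add[OF fg(2,4)] by (intro exI[of _ "\<lambda>n. f n + g n"] conjI)
  qed
  show "c *\<^sub>R x \<in> closure V" if x: "x \<in> closure V" for x c
  proof -
    obtain f where f: "\<forall>n. f n \<in> V" "f \<longlonglongrightarrow> x"
      using x unfolding closure_sequential by blast
    have "\<forall>n. c *\<^sub>R f n \<in> V" using f assms by (simp add: subspace_scale)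
    then show ?thesis unfolding closure_sequential
      using tendsto_scaleR[OF tendsto_const f(2)] by (intro exI[of _ "\<lambda>n. c *\<^sub>R f n"] conjI)
  qed
qed

text \<open>The closure of a range is the orthogonal complement of the kernel of the adjoint. For
  the harder direction, y minus its projection p onto the closure is orthogonal to the range, hence
  lies in that kernel.\<close>

lemma closure_range_iff:
  "y \<in> closure (range (blinfun_apply A)) \<longleftrightarrow> (\<forall>z. radj A z = 0 \<longrightarrow> inner y z = 0)"
proof
  assume y: "y \<in> closure (range (blinfun_apply A))"
  have "closed (\<Inter>z\<in>{z. radj A z = 0}. {y. inner y z = 0})"
    by (intro closed_INT ballI closed_Collect_eq continuous_intros)
  moreover have "range (blinfun_apply A) \<subseteq> (\<Inter>z\<in>{z. radj A z = 0}. {y. inner y z = 0})"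
    by (auto simp: inner_radj_right)
  ultimately show "\<forall>z. radj A z = 0 \<longrightarrow> inner y z = 0"
    using y closure_minimal by blast
next
  assume y: "\<forall>z. radj A z = 0 \<longrightarrow> inner y z = 0"
  obtain p where p: "p \<in> closure (range A)" "\<And>x. x \<in> closure (range A) \<Longrightarrow> inner x (y - p) = 0"
    using closed_subspace_projection[OF subspace_closure[OF subspace_range_blinfun] closed_closure]
    by blast
  have "radj A (y - p) = 0"
  proof (rule inner_ext)
    show "inner x (radj A (y - p)) = inner x 0" for x
      using p(2)[of "A x"] closure_subset[of "range A"] by (auto simp: inner_radj_right)
  qed
  then have "inner y (y - p) = 0" using y by blast
  then have "inner (y - p) (y - p) = 0" using p by (simp add: inner_diff_left)
  then show "y \<in> closure (range A)" using p by simp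
qed

subsection \<open>Projections onto kernels\<close>

primrec bpow :: "('a::real_normed_vector \<Rightarrow>\<^sub>L 'a) \<Rightarrow> nat \<Rightarrow> 'a \<Rightarrow>\<^sub>L 'a"
  where
    "bpow C 0 = id_blinfun"
  | "bpow C (Suc n) = C o\<^sub>L bpow C n"

lemma bpow_add: "bpow C (m + n) x = bpow C m (bpow C n x)"
  by (induction m) auto

text \<open>Characterises the orthogonal projection onto the kernel of X: idempotence follows from
  the last two clauses.\<close>

definition is_nproj ::
    "('a::{real_inner,banach} \<Rightarrow>\<^sub>L 'b::{real_inner,banach}) \<Rightarrow> ('a \<Rightarrow>\<^sub>L 'a) \<Rightarrow> bool"
  where "is_nproj X Q \<longleftrightarrow> radj Q = Q \<and> (\<forall>x. X (Q x) = 0) \<and> (\<forall>x. X x = 0 \<longrightarrow> Q x = x)"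

lemma is_nproj_unique:
  assumes "is_nproj X Q" "is_nproj X Q'"
  shows "Q = Q'"
proof -
  have "Q o\<^sub>L Q' = Q'" and "Q' o\<^sub>L Q = Q"
    using assms unfolding is_nproj_def by (auto intro: blinfun_eqI)
  moreover have "radj (Q o\<^sub>L Q') = Q' o\<^sub>L Q"
    using assms unfolding is_nproj_def by (simp add: radj_compose)
  ultimately show ?thesis using assms unfolding is_nproj_def by metis
qed

lemma decseq_bounded_convergent:
  fixes a :: "nat \<Rightarrow> real"
  assumes "\<And>n. a (Suc n) \<le> a n" "\<And>n. 0 \<le> a n"
  obtains L where "a \<longlonglongrightarrow> L" "\<And>n. L \<le> a n"
proof -
  have "decseq a" using assms(1) by (rule decseq_SucI)
  then show ?thesis using decseq_convergent[of a 0] assms(2) that by blast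
qed

text \<open>For a contraction X the operator C = 1 - X*X lies between 0 and 1, and its powers
  decrease strongly to the projection onto its fixed vectors, which form the kernel of X. The
  monotonicity and the lower bound are recorded because normality is a statement about monotone
  limits.\<close>

lemma nproj_limit:
  fixes X :: "'a::{real_inner,banach} \<Rightarrow>\<^sub>L 'b::{real_inner,banach}"
  assumes X: "norm X \<le> 1"
  defines "C \<equiv> id_blinfun - (radj X o\<^sub>L X)"
  obtains Q where "is_nproj X Q" "\<And>x. (\<lambda>n. bpow C n x) \<longlonglongrightarrow> Q x"
    "\<And>n x. inner (bpow C (Suc n) x) x \<le> inner (bpow C n x) x"
    "\<And>n x. inner (Q x) x \<le> inner (bpow C n x) x"
proof -
  have C_app: "C x = x - radj X (X x)" for x by (simp add: C_def blinfun.bilinear_simps)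
  have C_sym: "inner (C x) y = inner x (C y)" for x y
    by (simp add: C_app inner_diff_left inner_diff_right inner_radj_left inner_radj_right)
  have pow_sym: "inner (bpow C n x) y = inner x (bpow C n y)" for n x y
  proof (induction n arbitrary: x y)
    case (Suc n)
    have "bpow C n (C y) = C (bpow C n y)" for y by (induction n) auto
    then show ?case by (simp add: C_sym Suc)
  qed auto
  have contr: "norm (X x) \<le> norm x" "norm (radj X y) \<le> norm y" for x y
    using norm_blinfun[of X x] norm_blinfun[of "radj X" y] X norm_radj[of X]
    by (smt (verit) mult_right_mono norm_ge_zero mult_cancel_right1 mult_left_le_one_le)+
  have form1: "inner (C x) x = (norm x)\<^sup>2 - (norm (X x))\<^sup>2" for x
    by (simp add: C_app inner_diff_left inner_radj_left power2_norm_eq_inner)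
  have form2: "inner (C x) (C x) \<le> inner (C x) x" for x
  proof -
    have "inner (C x) x - inner (C x) (C x) = (norm (X x))\<^sup>2 - (norm (radj X (X x)))\<^sup>2"
      by (simp add: C_app inner_diff_left inner_diff_right inner_radj_left inner_radj_right
          power2_norm_eq_inner inner_commute)
    moreover have "(norm (radj X (X x)))\<^sup>2 \<le> (norm (X x))\<^sup>2"
      using contr(2) by (simp add: power_mono)
    ultimately show ?thesis by linarith
  qed
  have form0: "0 \<le> inner (C x) x" for x
    using form1[of x] contr(1)[of x] by (simp add: power_mono)
  \<comment> \<open>Moments of C at x. Since inner products of powers depend only on m + n, even
    moments are squared norms and odd ones are values of the form of C; monotonicity then alternates
    between C \<le> 1 (\<open>form1\<close>) and C^2 \<le> C (\<open>form2\<close>).\<close>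
  define a where "a n x = inner (bpow C n x) x" for n x
  have a_eq: "inner (bpow C m x) (bpow C n x) = a (m + n) x" for m n x
    by (simp add: a_def pow_sym bpow_add)
       (metis add.commute bpow_add pow_sym)
  have a_cases: "(\<exists>k. n = k + k) \<or> (\<exists>k. n = Suc (k + k))" for n :: nat
    by (metis add.right_neutral add_Suc_right nat_arith.suc1 oddE evenE mult_2 Suc_eq_plus1)
  have a_nonneg: "0 \<le> a n x" for n x
    using a_cases[of n]
  proof (elim disjE exE)
    fix k assume "n = k + k"
    then show ?thesis using a_eq[of k x k] by (metis inner_ge_zero)
  next
    fix k assume "n = Suc (k + k)"
    then have "a n x = inner (C (bpow C k x)) (bpow C k x)"
      using a_eq[of "Suc k" x k] by simp
    then show ?thesis using form0 by simp
  qed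
  have a_dec: "a (Suc n) x \<le> a n x" for n x
    using a_cases[of n]
  proof (elim disjE exE)
    fix k assume n: "n = k + k"
    have "a (Suc n) x = inner (C (bpow C k x)) (bpow C k x)"
      using a_eq[of "Suc k" x k] n by simp
    then show ?thesis using a_eq[of k x k] n form1[of "bpow C k x"]
      by (simp add: power2_norm_eq_inner)
  next
    fix k assume n: "n = Suc (k + k)"
    have "a (Suc n) x = inner (C (bpow C k x)) (C (bpow C k x))"
      using a_eq[of "Suc k" x "Suc k"] n by simp
    moreover have "a n x = inner (C (bpow C k x)) (bpow C k x)"
      using a_eq[of "Suc k" x k] n by simp
    ultimately show ?thesis using form2 by simp
  qed
  have "\<exists>q. (\<lambda>n. bpow C n x) \<longlonglongrightarrow> q" for x
  proof -
    obtain L where L: "(\<lambda>n. a n x) \<longlonglongrightarrow> L"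
      by (rule decseq_bounded_convergent[of "\<lambda>n. a n x", OF a_dec a_nonneg], rule that)
    have "Cauchy (\<lambda>n. bpow C n x)"
    proof (rule CauchyI)
      fix e :: real assume e: "0 < e"
      then have "0 < e\<^sup>2 / 4" by simp
      then obtain N where N: "\<And>n. n \<ge> N \<Longrightarrow> \<bar>a n x - L\<bar> < e\<^sup>2 / 4"
        using L unfolding LIMSEQ_iff by (metis real_norm_def)
      have "norm (bpow C m x - bpow C n x) < e" if "m \<ge> N" "n \<ge> N" for m n
      proof -
        \<comment> \<open>All three moments tend to the same limit L, with coefficients 1, -2 and
          1.\<close>
        have "(norm (bpow C m x - bpow C n x))\<^sup>2 = a (m + m) x - 2 * a (m + n) x + a (n + n) x"
          by (simp add: power2_norm_eq_inner inner_diff_left inner_diff_right a_eq add.commute)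
        also have "\<dots> < e\<^sup>2"
          using N[of "m + m"] N[of "m + n"] N[of "n + n"] that unfolding abs_less_iff by simp
        finally show ?thesis using e by (simp add: power_less_imp_less_base)
      qed
      then show "\<exists>M. \<forall>m\<ge>M. \<forall>n\<ge>M. norm (bpow C m x - bpow C n x) < e" by blast
    qed
    then show ?thesis using Cauchy_convergent convergent_def by blast
  qed
  then obtain f where f: "\<And>x. (\<lambda>n. bpow C n x) \<longlonglongrightarrow> f x" by metis
  have norm_pow: "norm (bpow C n x) \<le> norm x" for n x
  proof (induction n)
    case (Suc n)
    have "(norm (C y))\<^sup>2 \<le> (norm y)\<^sup>2" for y
      using form1[of y] form2[of y] inner_ge_zero[of "X y"]
      unfolding power2_norm_eq_inner by linarith
    then have "norm (C y) \<le> norm y" for y by (rule power2_le_imp_le) simp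
    then show ?case using Suc order_trans by auto
  qed auto
  have lin: "bounded_linear f"
  proof (rule bounded_linear_intro[where K = 1])
    show "f (x + y) = f x + f y" for x y
      using tendsto_add[OF f f, of x y] f[of "x + y"] by (simp add: blinfun.bilinear_simps LIMSEQ_unique)
    show "f (r *\<^sub>R x) = r *\<^sub>R f x" for r x
      using tendsto_scaleR[OF tendsto_const f, of r x] f[of "r *\<^sub>R x"]
      by (simp add: blinfun.bilinear_simps LIMSEQ_unique)
    show "norm (f x) \<le> norm x * 1" for x
      using tendsto_norm[OF f, of x] norm_pow Lim_bounded[of "\<lambda>n. norm (bpow C n x)" _ 0 "norm x"] by auto
  qed
  define Q where "Q = Blinfun f"
  have Q: "Q x = f x" for x by (simp add: Q_def bounded_linear_Blinfun_apply[OF lin])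
  have "inner (Q x) y = inner x (Q y)" for x y
  proof -
    have "(\<lambda>n. inner (bpow C n x) y) \<longlonglongrightarrow> inner (f x) y"
      by (intro tendsto_intros f)
    moreover have "(\<lambda>n. inner (bpow C n x) y) \<longlonglongrightarrow> inner x (f y)"
      unfolding pow_sym by (intro tendsto_intros f)
    ultimately show ?thesis using LIMSEQ_unique Q by metis
  qed
  then have "radj Q = Q" by (rule radj_unique)
  moreover have "X (Q x) = 0" for x
  proof -
    have "(\<lambda>n. C (bpow C n x)) \<longlonglongrightarrow> f x" using LIMSEQ_Suc[OF f[of x]] by simp
    moreover have "(\<lambda>n. C (bpow C n x)) \<longlonglongrightarrow> C (f x)" by (intro tendsto_intros f)
    ultimately have "C (f x) = f x" using LIMSEQ_unique by blast
    then have "radj X (X (f x)) = 0" by (simp add: C_app)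
    then have "inner (X (f x)) (X (f x)) = 0" by (metis inner_radj_right inner_zero_right)
    then show ?thesis using Q by simp
  qed
  moreover have "Q x = x" if "X x = 0" for x
  proof -
    have "bpow C n x = x" for n using that by (induction n) (auto simp: C_app)
    then show ?thesis using f[of x] Q[of x] LIMSEQ_unique[OF tendsto_const, of x "f x"] by simp
  qed
  ultimately have "is_nproj X Q" unfolding is_nproj_def by blast
  moreover have "inner (Q x) x \<le> inner (bpow C n x) x" for n x
  proof -
    have "(\<lambda>n. a n x) \<longlonglongrightarrow> inner (f x) x"
      unfolding a_def by (intro tendsto_intros f)
    then have "inner (f x) x \<le> a n x"
      using decseq_ge[of "\<lambda>n. a n x"] a_dec decseq_SucI[of "\<lambda>n. a n x"] by blast
    then show ?thesis by (simp add: a_def Q)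
  qed
  ultimately show ?thesis using that[of Q] f Q a_dec unfolding a_def by simp
qed

lemma is_nproj_scaleR:
  assumes "is_nproj (c *\<^sub>R X) Q" "c \<noteq> 0"
  shows "is_nproj X Q"
  using assms unfolding is_nproj_def by (simp add: blinfun.bilinear_simps)

definition nproj :: "('a::{real_inner,banach} \<Rightarrow>\<^sub>L 'b::{real_inner,banach}) \<Rightarrow> ('a \<Rightarrow>\<^sub>L 'a)"
  where "nproj X = (SOME Q. is_nproj X Q)"

lemma nproj_is_nproj: "is_nproj X (nproj X)"
proof -
  \<comment> \<open>Scaling by a nonzero constant keeps the kernel and makes X a contraction; the
    summand 1 covers X = 0.\<close>
  define c where "c = 1 / (norm X + 1)"
  have "0 < norm X + 1" by (simp add: add_nonneg_pos)
  then have c: "0 < c" "norm (c *\<^sub>R X) \<le> 1" by (auto simp: c_def)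
  obtain Q where "is_nproj (c *\<^sub>R X) Q"
    by (rule nproj_limit[OF c(2)], rule that, assumption)
  then have "is_nproj X Q" using is_nproj_scaleR c by force
  then show ?thesis unfolding nproj_def by (rule someI)
qed

lemma radj_nproj: "radj (nproj X) = nproj X"
  and apply_nproj: "X (nproj X x) = 0"
  and nproj_fix: "X x = 0 \<Longrightarrow> nproj X x = x"
  using nproj_is_nproj[of X] unfolding is_nproj_def by auto

lemma nproj_eq: "is_nproj X Q \<Longrightarrow> nproj X = Q"
  using is_nproj_unique nproj_is_nproj by blast

lemma range_nproj: "range (nproj X) = {x. X x = 0}"
  using apply_nproj nproj_fix by (metis (mono_tags, lifting) mem_Collect_eq rangeE rangeI subset_antisym subsetI)

subsection \<open>Square roots and closed ranges\<close>

text \<open>Evaluating the positive form at x - C x and using C \<le> 1 at C x leaves norm (C x)^2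
  \<le> norm x^2.\<close>

lemma norm_le_1_of_form:
  assumes "radj C = C" "\<And>x. 0 \<le> inner (C x) x" "\<And>x. inner (C x) x \<le> (norm x)\<^sup>2"
  shows "norm C \<le> 1"
proof (rule norm_blinfun_bound)
  fix x
  define y where "y = C x"
  have sym: "inner (C u) v = inner u (C v)" for u v by (metis assms(1) inner_radj_right)
  have "0 \<le> inner (C (x - y)) (x - y)" by (rule assms(2))
  also have "\<dots> = inner (C x) x - 2 * inner y y + inner (C y) y"
    using sym[of x y] sym[of y x]
    by (simp add: blinfun.bilinear_simps inner_diff_left inner_diff_right y_def[symmetric] inner_commute)
  also have "\<dots> \<le> (norm x)\<^sup>2 - (norm y)\<^sup>2"
    using assms(3)[of x] assms(3)[of y] by (simp add: power2_norm_eq_inner)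
  finally have "(norm y)\<^sup>2 \<le> (norm x)\<^sup>2" by linarith
  then have "norm y \<le> norm x" by (rule power2_le_imp_le) simp
  then show "norm (C x) \<le> 1 * norm x" by (simp add: y_def)
qed auto

text \<open>Closure is asked under strong limits of sequences. This passes from \<A> to matrices
  over \<A> entry by entry and covers the limits taken here: powers tending to a kernel projection
  and iterates tending to a square root.\<close>

locale op_alg =
  fixes \<A> :: "('a::{real_inner,banach} \<Rightarrow>\<^sub>L 'a) set"
  assumes id_in: "id_blinfun \<in> \<A>"
    and add_in: "\<And>A B. A \<in> \<A> \<Longrightarrow> B \<in> \<A> \<Longrightarrow> A + B \<in> \<A>"
    and scaleR_in: "\<And>c A. A \<in> \<A> \<Longrightarrow> c *\<^sub>R A \<in> \<A>"
    and comp_in: "\<And>A B. A \<in> \<A> \<Longrightarrow> B \<in> \<A> \<Longrightarrow> A o\<^sub>L B \<in> \<A>"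
    and radj_in: "\<And>A. A \<in> \<A> \<Longrightarrow> radj A \<in> \<A>"
    and lim_in: "\<And>F A. (\<And>n::nat. F n \<in> \<A>) \<Longrightarrow> (\<And>x. (\<lambda>n. blinfun_apply (F n) x) \<longlonglongrightarrow> blinfun_apply A x) \<Longrightarrow> A \<in> \<A>"
begin

lemma diff_in: "A \<in> \<A> \<Longrightarrow> B \<in> \<A> \<Longrightarrow> A - B \<in> \<A>"
  using add_in[of A "(-1) *\<^sub>R B"] scaleR_in[of B "-1"] by simp

lemma uminus_in: "A \<in> \<A> \<Longrightarrow> - A \<in> \<A>"
  using scaleR_in[of A "-1"] by simp

lemma zero_in: "0 \<in> \<A>"
  using scaleR_in[OF id_in, of 0] by simp

lemma bpow_in: "C \<in> \<A> \<Longrightarrow> bpow C n \<in> \<A>"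
  by (induction n) (auto simp: id_in comp_in)

lemma nproj_in:
  assumes X: "X \<in> \<A>"
  shows "nproj X \<in> \<A>"
proof -
  define c where "c = 1 / (norm X + 1)"
  have "0 < norm X + 1" by (simp add: add_nonneg_pos)
  then have c: "0 < c" "norm (c *\<^sub>R X) \<le> 1" by (auto simp: c_def)
  define C where "C = id_blinfun - (radj (c *\<^sub>R X) o\<^sub>L (c *\<^sub>R X))"
  obtain Q where Q: "is_nproj (c *\<^sub>R X) Q" "\<And>x. (\<lambda>n. bpow C n x) \<longlonglongrightarrow> Q x"
    by (rule nproj_limit[OF c(2), folded C_def], rule that, assumption+)
  have "nproj X = Q" using Q c is_nproj_scaleR nproj_eq by force
  moreover have "C \<in> \<A>" unfolding C_def by (intro diff_in id_in comp_in radj_in scaleR_in X)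
  ultimately show ?thesis using lim_in[of "bpow C"] bpow_in Q by blast
qed

text \<open>With B = 1 - L the equation B^2 = 1 - C becomes L = (C + L^2) / 2, which is solved by
  iteration from 0. The iterates are polynomials in C, so they commute with each other and with
  whatever commutes with C.\<close>

lemma sqrt_exists:
  assumes C: "C \<in> \<A>" "radj C = C" "norm C \<le> 1"
  obtains B where "B \<in> \<A>" "radj B = B" "B o\<^sub>L B = id_blinfun - C"
    "\<And>Z. Z o\<^sub>L C = C o\<^sub>L Z \<Longrightarrow> Z o\<^sub>L B = B o\<^sub>L Z"
proof -
  define Y where "Y = rec_nat 0 (\<lambda>_ Z. (1/2) *\<^sub>R (C + (Z o\<^sub>L Z)))"
  have Y0: "Y 0 = 0" and YS: "Y (Suc n) = (1/2) *\<^sub>R (C + (Y n o\<^sub>L Y n))" for n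
    by (simp_all add: Y_def)
  \<comment> \<open>The same recursion with C replaced by its norm bound 1. It increases within
    [0, 1] and dominates both the norms and the increments of Y.\<close>
  define y :: "nat \<Rightarrow> real" where "y = rec_nat 0 (\<lambda>_ z. (1 + z\<^sup>2) / 2)"
  have y0: "y 0 = 0" and yS: "y (Suc n) = (1 + (y n)\<^sup>2) / 2" for n
    by (simp_all add: y_def)
  have y_bounds: "0 \<le> y n \<and> y n \<le> 1" for n
  proof (induction n)
    case (Suc n)
    then have "(y n)\<^sup>2 \<le> 1" by (simp add: power_le_one)
    then show ?case by (simp add: yS)
  qed (simp add: y0)
  have y_inc: "y n \<le> y (Suc n)" for n
  proof -
    have "0 \<le> (1 - y n)\<^sup>2" by simp
    then show ?thesis unfolding yS power2_diff by simp
  qed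
  have Y_in: "Y n \<in> \<A>" for n
    by (induction n) (auto simp: Y0 YS zero_in intro!: scaleR_in add_in comp_in C)
  have Y_sym: "radj (Y n) = Y n" for n
    by (induction n) (auto simp: Y0 YS radj_scaleR radj_add radj_compose C)
  have Y_comm: "Z o\<^sub>L Y n = Y n o\<^sub>L Z" if "Z o\<^sub>L C = C o\<^sub>L Z" for Z n
  proof -
    have ZC: "Z (C v) = C (Z v)" for v using that by (metis blinfun_apply_blinfun_compose)
    have "Z (Y n v) = Y n (Z v)" for v
      by (induction n arbitrary: v) (auto simp: Y0 YS blinfun.bilinear_simps ZC)
    then show ?thesis by (auto intro: blinfun_eqI)
  qed
  have comm: "Y m o\<^sub>L Y n = Y n o\<^sub>L Y m" for m n
    using Y_comm Y_comm[of C] by metis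
  have norm_Y: "norm (Y n) \<le> y n" for n
  proof (induction n)
    case (Suc n)
    have "norm (Y n o\<^sub>L Y n) \<le> norm (Y n) * norm (Y n)" by (rule norm_blinfun_compose)
    also have "\<dots> \<le> y n * y n" using Suc y_bounds by (intro mult_mono) auto
    finally have "norm (C + (Y n o\<^sub>L Y n)) \<le> 1 + (y n)\<^sup>2"
      using C(3) norm_triangle_ineq[of C "Y n o\<^sub>L Y n"] by (simp add: power2_eq_square)
    then show ?case by (simp add: YS yS)
  qed (simp add: Y0 y0)
  have norm_step: "norm (Y (Suc n) - Y n) \<le> y (Suc n) - y n" for n
  proof (induction n)
    case 0
    show ?case using C(3) by (simp add: Y0 YS y0 yS)
  next
    case (Suc n)
    let ?Z = "Y (Suc n)"
    have "Y (Suc (Suc n)) - ?Z = (1/2) *\<^sub>R ((?Z o\<^sub>L ?Z) - (Y n o\<^sub>L Y n))"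
      by (subst (1) YS, subst (3) YS) (simp add: algebra_simps)
    \<comment> \<open>The difference of squares factors because the iterates commute; its norm can
      then be compared with the scalar increment.\<close>
    also have "(?Z o\<^sub>L ?Z) - (Y n o\<^sub>L Y n) = (?Z - Y n) o\<^sub>L (?Z + Y n)"
    proof (rule blinfun_eqI)
      fix v
      have "?Z (Y n v) = Y n (?Z v)" using comm by (metis blinfun_apply_blinfun_compose)
      then show "((?Z o\<^sub>L ?Z) - (Y n o\<^sub>L Y n)) v = ((?Z - Y n) o\<^sub>L (?Z + Y n)) v"
        by (simp add: blinfun.bilinear_simps)
    qed
    finally have "norm (Y (Suc (Suc n)) - ?Z) = (1/2) * norm ((?Z - Y n) o\<^sub>L (?Z + Y n))" by simp
    also have "\<dots> \<le> (1/2) * (norm (?Z - Y n) * norm (?Z + Y n))"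
      by (simp add: norm_blinfun_compose)
    also have "\<dots> \<le> (1/2) * ((y (Suc n) - y n) * (y (Suc n) + y n))"
      using Suc norm_Y[of n] norm_Y[of "Suc n"] norm_triangle_ineq[of ?Z "Y n"] y_inc[of n]
      by (intro mult_left_mono mult_mono) auto
    also have "\<dots> = y (Suc (Suc n)) - y (Suc n)"
    proof -
      have "(1/2) * ((a - b) * (a + b)) = (1 + a\<^sup>2) / 2 - (1 + b\<^sup>2) / 2" for a b :: real
        by (simp add: power2_eq_square field_simps)
      then show ?thesis by (simp only: yS[of n, symmetric] yS[of "Suc n", symmetric])
    qed
    finally show ?case .
  qed
  have norm_diff: "norm (Y (n + k) - Y n) \<le> y (n + k) - y n" for n k
  proof (induction k)
    case (Suc k)
    then show ?case
      using norm_step[of "n + k"] norm_triangle_ineq[of "Y (Suc (n + k)) - Y (n + k)" "Y (n + k) - Y n"]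
      by simp
  qed auto
  have "incseq y" using y_inc by (rule incseq_SucI)
  then obtain l where l: "y \<longlonglongrightarrow> l" "\<And>n. y n \<le> l"
    using incseq_convergent[of y 1] y_bounds by blast
  have "Cauchy Y"
  proof (rule CauchyI)
    fix e :: real assume "0 < e"
    then have "0 < e / 2" by simp
    then obtain N where N: "\<And>n. n \<ge> N \<Longrightarrow> \<bar>y n - l\<bar> < e / 2"
      using l(1) unfolding LIMSEQ_iff by (metis real_norm_def)
    have "norm (Y n - Y N) < e / 2" if "n \<ge> N" for n
      using norm_diff[of N "n - N"] that N[of N] l(2)[of n] abs_ge_minus_self[of "y N - l"]
      by simp
    then have "norm (Y m - Y n) < e" if "m \<ge> N" "n \<ge> N" for m n
      using that norm_triangle_ineq4[of "Y m - Y N" "Y n - Y N"]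
      by (smt (verit, ccfv_SIG) diff_diff_eq2 diff_add_cancel field_sum_of_halves)
    then show "\<exists>M. \<forall>m\<ge>M. \<forall>n\<ge>M. norm (Y m - Y n) < e" by blast
  qed
  then obtain L where L: "Y \<longlonglongrightarrow> L" using Cauchy_convergent convergent_def by blast
  have Lx: "(\<lambda>n. Y n x) \<longlonglongrightarrow> L x" for x by (intro tendsto_intros L)
  have "(\<lambda>n. Y (Suc n)) \<longlonglongrightarrow> (1/2) *\<^sub>R (C + (L o\<^sub>L L))"
    unfolding YS by (intro tendsto_intros bounded_bilinear.tendsto[OF bounded_bilinear_blinfun_compose] L)
  then have fixL: "L = (1/2) *\<^sub>R (C + (L o\<^sub>L L))" using LIMSEQ_Suc[OF L] LIMSEQ_unique by blast
  have fixL': "2 *\<^sub>R L x = C x + L (L x)" for x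
    by (subst fixL) (simp add: blinfun.bilinear_simps)
  define B where "B = id_blinfun - L"
  have "L \<in> \<A>" using lim_in[of Y] Y_in Lx by blast
  then have "B \<in> \<A>" unfolding B_def by (intro diff_in id_in)
  moreover have "radj L = L"
  proof (rule radj_unique)
    fix x z
    have "(\<lambda>n. inner (Y n x) z) \<longlonglongrightarrow> inner (L x) z" by (intro tendsto_intros Lx)
    moreover have "(\<lambda>n. inner (Y n x) z) \<longlonglongrightarrow> inner x (L z)"
      unfolding inner_radj_right Y_sym by (intro tendsto_intros Lx)
    ultimately show "inner (L x) z = inner x (L z)" using LIMSEQ_unique by blast
  qed
  then have "radj B = B" by (simp add: B_def radj_diff)
  moreover have "B o\<^sub>L B = id_blinfun - C"
  proof (rule blinfun_eqI)
    fix x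
    have "(B o\<^sub>L B) x = x - 2 *\<^sub>R L x + L (L x)"
      by (simp add: B_def blinfun.bilinear_simps scaleR_2)
    then show "(B o\<^sub>L B) x = (id_blinfun - C) x" by (simp add: fixL' blinfun.bilinear_simps)
  qed
  moreover have "Z o\<^sub>L B = B o\<^sub>L Z" if "Z o\<^sub>L C = C o\<^sub>L Z" for Z
  proof (rule blinfun_eqI)
    fix x
    have "Z (Y n x) = Y n (Z x)" for n
      using Y_comm[OF that] by (metis blinfun_apply_blinfun_compose)
    moreover have "(\<lambda>n. Z (Y n x)) \<longlonglongrightarrow> Z (L x)" by (intro tendsto_intros Lx)
    ultimately have "(\<lambda>n. Y n (Z x)) \<longlonglongrightarrow> Z (L x)" by simp
    then have "Z (L x) = L (Z x)" using Lx LIMSEQ_unique by blast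
    then show "(Z o\<^sub>L B) x = (B o\<^sub>L Z) x" by (simp add: B_def blinfun.bilinear_simps)
  qed
  ultimately show ?thesis using that by blast
qed

end

text \<open>Open mapping argument: the closed range is complete, so by Baire the closure of the
  image of some ball has interior relative to it. Pairing with a vector w of the range converts this
  into a lower bound for \<open>radj V\<close> at w.\<close>

lemma closed_range_bounded_below:
  fixes V :: "'a::{real_inner,banach} \<Rightarrow>\<^sub>L 'b::{real_inner,banach}"
  assumes closed: "closed (range (blinfun_apply V))"
  obtains c where "0 < c" "\<And>x. c * norm (V x) \<le> norm (radj V (V x))"
proof -
  let ?R = "range (blinfun_apply V)"
  \<comment> \<open>Intersecting with the range makes each piece relatively closed and the union
    exactly the range.\<close>
  define F where "F n = closure (blinfun_apply V ` cball 0 (real n)) \<inter> ?R" for n :: nat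
  have "?R \<subseteq> (\<Union>n. F n)"
  proof
    fix y assume "y \<in> ?R"
    then obtain x where x: "y = V x" by blast
    obtain n where "norm x \<le> real n" using real_arch_simple by blast
    then have "y \<in> blinfun_apply V ` cball 0 (real n)" using x by auto
    then show "y \<in> (\<Union>n. F n)" using closure_subset[of "blinfun_apply V ` cball 0 (real n)"] \<open>y \<in> ?R\<close>
      unfolding F_def by blast
  qed
  then have un: "(\<Union>n. F n) = ?R" by (auto simp: F_def)
  have metrizable: "completely_metrizable_space (top_of_set ?R)"
    using closed completely_metrizable_space_closedin[OF completely_metrizable_space_euclidean] by simp
  have closedin: "closedin (top_of_set ?R) (F n)" for n
    unfolding F_def by (simp add: closedin_closed_Int inf.commute)
  have "\<exists>n. top_of_set ?R interior_of F n \<noteq> {}"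
  proof (rule ccontr)
    assume "\<not> (\<exists>n. top_of_set ?R interior_of F n \<noteq> {})"
    then have "top_of_set ?R interior_of (\<Union>n. F n) = {}"
      using metrizable closedin by (intro Baire_category_alt) auto
    moreover have "top_of_set ?R interior_of ?R = ?R"
      using interior_of_topspace[of "top_of_set ?R"] by simp
    ultimately show False using un by auto
  qed
  then obtain n y0 where "y0 \<in> top_of_set ?R interior_of F n" by blast
  then obtain T where T: "openin (top_of_set ?R) T" "y0 \<in> T" "T \<subseteq> F n"
    unfolding interior_of_def by blast
  then obtain e where e: "0 < e" "ball y0 e \<inter> ?R \<subseteq> F n"
    unfolding openin_contains_ball by (meson order_trans)
  obtain x0 where x0: "y0 = V x0" using T by (auto simp: F_def)
  have key: "(e / 2) * norm w \<le> 2 * real n * norm (radj V w)" if w: "w \<in> ?R" for w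
  proof (cases "w = 0")
    case False
    have approx: "inner y w \<le> real n * norm (radj V w)" if "y \<in> closure (blinfun_apply V ` cball 0 (real n))" for y
    proof -
      have "closed {y. inner y w \<le> real n * norm (radj V w)}"
        by (intro closed_Collect_le continuous_intros)
      moreover have "blinfun_apply V ` cball 0 (real n) \<subseteq> {y. inner y w \<le> real n * norm (radj V w)}"
      proof clarsimp
        fix x :: 'a assume "norm x \<le> real n"
        then show "inner (V x) w \<le> real n * norm (radj V w)"
          unfolding inner_radj_right
          by (meson mult_right_mono norm_cauchy_schwarz norm_ge_zero order_trans)
      qed
      ultimately show ?thesis using that closure_minimal by blast
    qed
    have approx': "inner (- y) w \<le> real n * norm (radj V w)" if "y \<in> closure (blinfun_apply V ` cball 0 (real n))" for y
    proof -
      have "closed {y. inner (- y) w \<le> real n * norm (radj V w)}"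
        by (intro closed_Collect_le continuous_intros)
      moreover have "blinfun_apply V ` cball 0 (real n) \<subseteq> {y. inner (- y) w \<le> real n * norm (radj V w)}"
      proof clarsimp
        fix x :: 'a assume x: "norm x \<le> real n"
        have "- inner x (radj V w) \<le> norm x * norm (radj V w)"
          using Cauchy_Schwarz_ineq2[of x "radj V w"] by linarith
        also have "\<dots> \<le> real n * norm (radj V w)" using x by (simp add: mult_right_mono)
        finally show "- inner (V x) w \<le> real n * norm (radj V w)" by (simp add: inner_radj_right)
      qed
      ultimately show ?thesis using that closure_minimal by blast
    qed
    \<comment> \<open>A step of length e/2 from y0 along w stays in the ball. Adding the bounds for
      y and for -y0 estimates the inner product of s w with w, which is (e/2) norm w.\<close>
    define s where "s = e / (2 * norm w)"
    define y where "y = y0 + s *\<^sub>R w"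
    obtain u where u: "w = V u" using w by blast
    have "y = V (x0 + s *\<^sub>R u)" by (simp add: y_def x0 u blinfun.bilinear_simps)
    moreover have "dist y0 y < e" using e False by (simp add: y_def s_def dist_norm)
    ultimately have "y \<in> F n" using e by auto
    moreover have "y0 \<in> F n" using T by blast
    ultimately have "inner y w \<le> real n * norm (radj V w)" "inner (- y0) w \<le> real n * norm (radj V w)"
      using approx approx' by (auto simp: F_def)
    then have "inner (s *\<^sub>R w) w \<le> 2 * (real n * norm (radj V w))"
      by (simp add: y_def inner_add_left)
    moreover have "inner (s *\<^sub>R w) w = (e / 2) * norm w"
      using False by (simp add: s_def power2_norm_eq_inner[symmetric] power2_eq_square)
    ultimately show ?thesis by simp
  qed simp
  \<comment> \<open>The 4 n clears the denominator in \<open>key\<close>; adding 1 keeps the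
    denominator positive when n = 0.\<close>
  define c where "c = e / (4 * real n + 1)"
  have "0 < c" using e by (simp add: c_def add_nonneg_pos)
  moreover have "c * norm (V x) \<le> norm (radj V (V x))" for x
  proof -
    have "(4 * real n + 1) * norm (radj V (V x)) \<ge> e * norm (V x)"
      using key[of "V x"] by (simp add: algebra_simps add_increasing)
    then show ?thesis by (simp add: c_def field_simps)
  qed
  ultimately show ?thesis using that by blast
qed

text \<open>For y in the closure, the functional w \<mapsto> inner w y on the range is bounded for
  the form inner (radj V w) (radj V w'), by the lower bound. The limit x of
  \<open>radj V (a n)\<close> then satisfies V x = y, as V x - y is in the closure of the range and
  orthogonal to it.\<close>

lemma closed_range_if_bounded_below:
  fixes V :: "'a::{real_inner,banach} \<Rightarrow>\<^sub>L 'b::{real_inner,banach}"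
  assumes c: "0 < c" "\<And>x. c * norm (V x) \<le> norm (radj V (V x))"
  shows "closed (range (blinfun_apply V))"
proof -
  have "y \<in> range (blinfun_apply V)" if y: "y \<in> closure (range (blinfun_apply V))" for y
  proof -
    have bd: "norm w \<le> norm (radj V w) / c" if "w \<in> range (blinfun_apply V)" for w
      using that c by (auto simp: field_simps)
    obtain a where a: "\<And>n. a n \<in> range (blinfun_apply V)"
      "\<And>m n. inner (radj V (a m - a n)) (radj V (a m - a n)) \<le> 2 / real (Suc m) + 2 / real (Suc n)"
      "\<And>w. w \<in> range (blinfun_apply V) \<Longrightarrow> (\<lambda>n. inner (radj V w) (radj V (a n))) \<longlonglongrightarrow> inner w y"
    proof (rule riesz_sequence[of "range (blinfun_apply V)" "\<lambda>w w'. inner (radj V w) (radj V w')" "\<lambda>w. inner w y" "norm y / c"])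
      fix w assume "w \<in> range (blinfun_apply V)"
      have "\<bar>inner w y\<bar> \<le> norm w * norm y" by (rule Cauchy_Schwarz_ineq2)
      also have "\<dots> \<le> norm (radj V w) / c * norm y"
        using bd[OF \<open>w \<in> range (blinfun_apply V)\<close>] by (rule mult_right_mono) simp
      finally show "\<bar>inner w y\<bar> \<le> norm y / c * sqrt (inner (radj V w) (radj V w))"
        by (simp add: norm_eq_sqrt_inner[symmetric] mult.commute)
    next
      fix w w' c assume "w \<in> range (blinfun_apply V)" "w' \<in> range (blinfun_apply V)"
      then show "w + w' \<in> range (blinfun_apply V)"
        using subspace_range_blinfun[of V] subspace_add by blast
    next
      fix w c assume "w \<in> range (blinfun_apply V)"
      then show "c *\<^sub>R w \<in> range (blinfun_apply V)"
        using subspace_range_blinfun[of V] subspace_scale by blast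
    next
      show "0 \<in> range (blinfun_apply V)" using subspace_range_blinfun[of V] subspace_0 by blast
    next
      show "inner (radj V x) (radj V z) = inner (radj V z) (radj V x)" for x z by (rule inner_commute)
    qed (auto simp: blinfun.bilinear_simps inner_add_left)
    have "Cauchy (\<lambda>n. radj V (a n))"
      by (rule CauchyI_sq_bound) (use a(2) in \<open>simp add: power2_norm_eq_inner blinfun.bilinear_simps\<close>)
    then obtain x where x: "(\<lambda>n. radj V (a n)) \<longlonglongrightarrow> x" using Cauchy_convergent convergent_def by blast
    have eq: "inner w (V x - y) = 0" if "w \<in> range (blinfun_apply V)" for w
    proof -
      have "(\<lambda>n. inner (radj V w) (radj V (a n))) \<longlonglongrightarrow> inner (radj V w) x"
        by (intro tendsto_intros x)
      then show ?thesis using a(3)[OF that] LIMSEQ_unique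
        by (auto simp: inner_diff_right inner_radj_left)
    qed
    have "closed {w. inner w (V x - y) = 0}" by (intro closed_Collect_eq continuous_intros)
    then have "closure (range (blinfun_apply V)) \<subseteq> {w. inner w (V x - y) = 0}"
      using eq by (intro closure_minimal) auto
    moreover have "V x - y \<in> closure (range (blinfun_apply V))"
      using y closure_subset[of "range (blinfun_apply V)"] subspace_closure[OF subspace_range_blinfun[of V]]
      by (simp add: rangeI subset_iff subspace_diff)
    ultimately have "inner (V x - y) (V x - y) = 0" by blast
    then show ?thesis by (simp add: eq_iff_diff_eq_0[symmetric]) (metis rangeI)
  qed
  then show ?thesis using closure_subset_eq by blast
qed

section \<open>Star-homomorphisms, positivity and closed ranges\<close>

locale op_hom = A: op_alg \<A> + B: op_alg \<B>
  for \<A> :: "('a::{real_inner,banach} \<Rightarrow>\<^sub>L 'a) set" and \<B> :: "('b::{real_inner,banach} \<Rightarrow>\<^sub>L 'b) set" +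
  fixes \<Theta> :: "('a \<Rightarrow>\<^sub>L 'a) \<Rightarrow> ('b \<Rightarrow>\<^sub>L 'b)"
  assumes hom_in: "\<And>A. A \<in> \<A> \<Longrightarrow> \<Theta> A \<in> \<B>"
    and hom_id: "\<Theta> id_blinfun = id_blinfun"
    and hom_add: "\<And>A B. A \<in> \<A> \<Longrightarrow> B \<in> \<A> \<Longrightarrow> \<Theta> (A + B) = \<Theta> A + \<Theta> B"
    and hom_scaleR: "\<And>c A. A \<in> \<A> \<Longrightarrow> \<Theta> (c *\<^sub>R A) = c *\<^sub>R \<Theta> A"
    and hom_comp: "\<And>A B. A \<in> \<A> \<Longrightarrow> B \<in> \<A> \<Longrightarrow> \<Theta> (A o\<^sub>L B) = \<Theta> A o\<^sub>L \<Theta> B"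
    and hom_radj: "\<And>A. A \<in> \<A> \<Longrightarrow> \<Theta> (radj A) = radj (\<Theta> A)"
begin

lemma hom_diff: "A \<in> \<A> \<Longrightarrow> B \<in> \<A> \<Longrightarrow> \<Theta> (A - B) = \<Theta> A - \<Theta> B"
  using hom_add[of A "(-1) *\<^sub>R B"] hom_scaleR[of B "-1"] A.scaleR_in[of B "-1"] by simp

lemma hom_uminus: "A \<in> \<A> \<Longrightarrow> \<Theta> (- A) = - \<Theta> A"
  using hom_scaleR[of A "-1"] by simp

lemma hom_zero: "\<Theta> 0 = 0"
  using hom_scaleR[OF A.id_in, of 0] by simp

lemma hom_bpow: "C \<in> \<A> \<Longrightarrow> \<Theta> (bpow C n) = bpow (\<Theta> C) n"
  by (induction n) (auto simp: hom_id hom_comp A.bpow_in)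

text \<open>A positive element is, up to a positive factor, the square of a self-adjoint element of
  the algebra, and a homomorphism maps such squares to such squares.\<close>

lemma hom_positive:
  assumes P: "P \<in> \<A>" "radj P = P" "\<And>x. 0 \<le> inner (P x) x"
  shows "0 \<le> inner (\<Theta> P y) y"
proof -
  \<comment> \<open>Chosen so that s P lies between 0 and 1; then C = 1 - s P is a contraction and
    \<open>sqrt_exists\<close> gives a square root of s P.\<close>
  define s where "s = 1 / (norm P + 1)"
  have s: "0 < s" by (simp add: s_def add_nonneg_pos)
  define C where "C = id_blinfun - s *\<^sub>R P"
  have Cx: "inner (C x) x = (norm x)\<^sup>2 - s * inner (P x) x" for x
    by (simp add: C_def blinfun.bilinear_simps inner_diff_left power2_norm_eq_inner)
  have "norm C \<le> 1"
  proof (rule norm_le_1_of_form)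
    show "radj C = C" by (simp add: C_def radj_diff radj_scaleR P)
    fix x
    show "inner (C x) x \<le> (norm x)\<^sup>2" using s P(3)[of x] by (simp add: Cx)
    have "inner (P x) x \<le> norm (P x) * norm x" by (rule norm_cauchy_schwarz)
    also have "\<dots> \<le> (norm P * norm x) * norm x" by (simp add: mult_right_mono norm_blinfun)
    also have "\<dots> \<le> (norm P + 1) * (norm x)\<^sup>2" by (simp add: power2_eq_square algebra_simps)
    finally show "0 \<le> inner (C x) x"
      by (simp add: Cx s_def) (smt (verit) divide_le_eq mult.commute norm_ge_zero)
  qed
  moreover have "C \<in> \<A>" "radj C = C"
    by (simp_all add: C_def A.diff_in A.id_in A.scaleR_in P radj_diff radj_scaleR)
  ultimately obtain B where B: "B \<in> \<A>" "radj B = B" "B o\<^sub>L B = id_blinfun - C"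
    using A.sqrt_exists by blast
  then have "B o\<^sub>L B = s *\<^sub>R P" by (simp add: C_def)
  then have "\<Theta> B o\<^sub>L \<Theta> B = s *\<^sub>R \<Theta> P" using hom_comp[of B B] hom_scaleR B P by simp
  then have "s * inner (\<Theta> P y) y = inner ((\<Theta> B o\<^sub>L \<Theta> B) y) y" by (simp add: blinfun.bilinear_simps)
  also have "\<dots> = inner (\<Theta> B y) (\<Theta> B y)"
    using hom_radj[of B] B by (simp add: inner_radj_right)
  finally have "0 \<le> s * inner (\<Theta> P y) y" by simp
  then show ?thesis using s by (simp add: zero_le_mult_iff)
qed

lemma hom_closed_range:
  assumes V: "V \<in> \<A>" and closed: "closed (range (blinfun_apply V))"
  shows "closed (range (blinfun_apply (\<Theta> V)))"
proof -
  obtain c where c: "0 < c" "\<And>x. c * norm (V x) \<le> norm (radj V (V x))"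
    using closed_range_bounded_below[OF closed] by blast
  define D where "D = radj V o\<^sub>L V"
  have D: "D \<in> \<A>" by (simp add: D_def A.comp_in A.radj_in V)
  have D_sym: "radj D = D" by (simp add: D_def radj_compose)
  \<comment> \<open>Its form at x is norm (radj V (V x))^2 - (c * norm (V x))^2, so the lower bound
    becomes positivity of an element of the algebra.\<close>
  define P where "P = (D o\<^sub>L D) - c\<^sup>2 *\<^sub>R D"
  have pos: "0 \<le> inner (\<Theta> P y) y" for y
  proof (rule hom_positive)
    show "P \<in> \<A>" by (simp add: P_def A.diff_in A.comp_in A.scaleR_in D)
    show "radj P = P" by (simp add: P_def radj_diff radj_compose radj_scaleR D_sym)
    fix x
    have "inner (P x) x = inner (D x) (D x) - c\<^sup>2 * inner (D x) x"
      using inner_radj_right[of D "D x" x] by (simp add: P_def D_sym blinfun.bilinear_simps inner_diff_left)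
    also have "\<dots> = (norm (radj V (V x)))\<^sup>2 - (c * norm (V x))\<^sup>2"
      by (simp add: D_def inner_radj_left power2_norm_eq_inner power_mult_distrib)
    finally show "0 \<le> inner (P x) x" using c by (simp add: power_mono)
  qed
  have hom_P: "\<Theta> P = (\<Theta> D o\<^sub>L \<Theta> D) - c\<^sup>2 *\<^sub>R \<Theta> D"
    by (simp add: P_def hom_diff hom_comp hom_scaleR A.comp_in A.scaleR_in D)
  have hom_D: "\<Theta> D = radj (\<Theta> V) o\<^sub>L \<Theta> V"
    by (simp add: D_def hom_comp hom_radj A.radj_in V)
  have "(c * norm (\<Theta> V y))\<^sup>2 \<le> (norm (radj (\<Theta> V) (\<Theta> V y)))\<^sup>2" for y
  proof -
    have "inner (\<Theta> D (\<Theta> D y)) y = inner (\<Theta> D y) (\<Theta> D y)"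
      using inner_radj_right[of "\<Theta> D" "\<Theta> D y" y] by (simp add: hom_D radj_compose)
    then have "inner (\<Theta> P y) y = (norm (radj (\<Theta> V) (\<Theta> V y)))\<^sup>2 - (c * norm (\<Theta> V y))\<^sup>2"
      by (simp add: hom_P blinfun.bilinear_simps inner_diff_left)
         (simp add: hom_D inner_radj_left power2_norm_eq_inner power_mult_distrib)
    then show ?thesis using pos[of y] by simp
  qed
  then have "c * norm (\<Theta> V y) \<le> norm (radj (\<Theta> V) (\<Theta> V y))" for y
    by (rule power2_le_imp_le) simp
  then show ?thesis using closed_range_if_bounded_below c(1) by blast
qed

end

section \<open>Two by two matrices of operators\<close>

text \<open>The type \<open>bool\<close> indexes rows and columns: \<open>False\<close> stands for
  the first coordinate, \<open>True\<close> for the second.\<close>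

definition emb :: "bool \<Rightarrow> 'a::real_normed_vector \<Rightarrow>\<^sub>L ('a \<times> 'a)"
  where "emb i = Blinfun (\<lambda>x. if i then (0, x) else (x, 0))"

lemma emb_apply: "emb i x = (if i then (0, x) else (x, 0))"
proof -
  have "bounded_linear (\<lambda>x::'a. if i then (0, x) else (x, 0))"
    by (rule bounded_linear_intro[where K = 1]) (auto simp: norm_Pair)
  then show ?thesis by (simp add: emb_def bounded_linear_Blinfun_apply)
qed

definition ent :: "bool \<Rightarrow> bool \<Rightarrow> (('a::{real_inner,banach} \<times> 'a) \<Rightarrow>\<^sub>L ('a \<times> 'a)) \<Rightarrow> ('a \<Rightarrow>\<^sub>L 'a)"
  where "ent i j X = radj (emb i) o\<^sub>L X o\<^sub>L emb j"

lemma radj_emb: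
  fixes u :: "'a::{real_inner,banach} \<times> 'a"
  shows "radj (emb i) u = (if i then snd u else fst u)"
proof -
  have "radj (emb i :: 'a \<Rightarrow>\<^sub>L _) = (if i then snd_blinfun else fst_blinfun)"
    by (rule radj_unique) (auto simp: emb_apply inner_prod_def)
  then show ?thesis by (cases i) simp_all
qed

lemma ent_apply: "ent i j X x = (if i then snd else fst) (X (emb j x))"
  by (simp add: ent_def radj_emb)

lemma inner_ent: "inner (ent i i X x) x = inner (X (emb i x)) (emb i x)"
  by (simp add: ent_apply emb_apply inner_prod_def)

lemma ent_ext:
  fixes X Y :: "('a::{real_inner,banach} \<times> 'a) \<Rightarrow>\<^sub>L ('a \<times> 'a)"
  assumes "\<And>i j. ent i j X = ent i j Y"
  shows "X = Y"
proof (rule blinfun_eqI)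
  fix u :: "'a \<times> 'a"
  have u: "u = emb False (fst u) + emb True (snd u)" by (simp add: emb_apply prod_eq_iff)
  have "X (emb j x) = Y (emb j x)" for j x
  proof (rule prod_eqI)
    show "fst (X (emb j x)) = fst (Y (emb j x))"
      using arg_cong[OF assms[of False j], of "\<lambda>Z. blinfun_apply Z x"] by (simp add: ent_apply)
    show "snd (X (emb j x)) = snd (Y (emb j x))"
      using arg_cong[OF assms[of True j], of "\<lambda>Z. blinfun_apply Z x"] by (simp add: ent_apply)
  qed
  then show "X u = Y u" by (subst (1 2) u) (simp add: blinfun.bilinear_simps)
qed

lemma blinfun_compose_assoc: "(A o\<^sub>L B) o\<^sub>L C = A o\<^sub>L (B o\<^sub>L C)"
  by (rule blinfun_eqI) simp

lemma ent_add: "ent i j (X + Y) = ent i j X + ent i j Y"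
  by (rule blinfun_eqI) (simp add: ent_apply blinfun.bilinear_simps)

lemma ent_scaleR: "ent i j (c *\<^sub>R X) = c *\<^sub>R ent i j X"
  by (rule blinfun_eqI) (simp add: ent_apply blinfun.bilinear_simps)

lemma ent_radj: "ent i j (radj X) = radj (ent j i X)"
  by (simp add: ent_def radj_compose blinfun_compose_assoc)

lemma ent_id: "ent i j id_blinfun = (if i = j then id_blinfun else 0)"
  by (rule blinfun_eqI) (simp add: ent_apply emb_apply)

lemma ent_comp: "ent i j (X o\<^sub>L Y) = (ent i False X o\<^sub>L ent False j Y) + (ent i True X o\<^sub>L ent True j Y)"
proof (rule blinfun_eqI)
  fix x
  define u where "u = Y (emb j x)"
  have u: "u = emb False (fst u) + emb True (snd u)" by (simp add: emb_apply prod_eq_iff)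
  have "X u = X (emb False (fst u)) + X (emb True (snd u))"
    by (subst u) (simp add: blinfun.bilinear_simps)
  then show "ent i j (X o\<^sub>L Y) x = ((ent i False X o\<^sub>L ent False j Y) + (ent i True X o\<^sub>L ent True j Y)) x"
    by (simp add: ent_apply blinfun.bilinear_simps u_def)
qed

definition opmat ::
    "('a::{real_inner,banach} \<Rightarrow>\<^sub>L 'a) \<Rightarrow> ('a \<Rightarrow>\<^sub>L 'a) \<Rightarrow> ('a \<Rightarrow>\<^sub>L 'a) \<Rightarrow> ('a \<Rightarrow>\<^sub>L 'a) \<Rightarrow>
      (('a \<times> 'a) \<Rightarrow>\<^sub>L ('a \<times> 'a))"
  where "opmat A B C D =
    (emb False o\<^sub>L A o\<^sub>L fst_blinfun) + (emb False o\<^sub>L B o\<^sub>L snd_blinfun) +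
    (emb True o\<^sub>L C o\<^sub>L fst_blinfun) + (emb True o\<^sub>L D o\<^sub>L snd_blinfun)"

lemma opmat_apply: "opmat A B C D u = (A (fst u) + B (snd u), C (fst u) + D (snd u))"
  by (simp add: opmat_def blinfun.bilinear_simps emb_apply)

lemma ent_opmat [simp]:
  "ent False False (opmat A B C D) = A" "ent False True (opmat A B C D) = B"
  "ent True False (opmat A B C D) = C" "ent True True (opmat A B C D) = D"
  by (auto intro!: blinfun_eqI simp: ent_apply opmat_apply emb_apply)

lemma radj_opmat: "radj (opmat A B C D) = opmat (radj A) (radj C) (radj B) (radj D)"
  by (rule radj_unique)
    (simp add: opmat_apply inner_prod_def inner_add_left inner_add_right inner_radj_right)

definition mats :: "('a::{real_inner,banach} \<Rightarrow>\<^sub>L 'a) set \<Rightarrow> (('a \<times> 'a) \<Rightarrow>\<^sub>L ('a \<times> 'a)) set"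
  where "mats \<A> = {X. \<forall>i j. ent i j X \<in> \<A>}"

definition mat_hom ::
    "(('a::{real_inner,banach} \<Rightarrow>\<^sub>L 'a) \<Rightarrow> ('b::{real_inner,banach} \<Rightarrow>\<^sub>L 'b)) \<Rightarrow>
      (('a \<times> 'a) \<Rightarrow>\<^sub>L ('a \<times> 'a)) \<Rightarrow> (('b \<times> 'b) \<Rightarrow>\<^sub>L ('b \<times> 'b))"
  where "mat_hom \<Theta> X =
    opmat (\<Theta> (ent False False X)) (\<Theta> (ent False True X)) (\<Theta> (ent True False X)) (\<Theta> (ent True True X))"

lemma opmat_in_mats:
  assumes "A \<in> \<A>" "B \<in> \<A>" "C \<in> \<A>" "D \<in> \<A>"
  shows "opmat A B C D \<in> mats \<A>"
proof -
  have "ent i j (opmat A B C D) \<in> \<A>" for i j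
    by (cases i; cases j) (simp_all add: assms)
  then show ?thesis by (simp add: mats_def)
qed

lemma mat_hom_opmat: "mat_hom \<Theta> (opmat A B C D) = opmat (\<Theta> A) (\<Theta> B) (\<Theta> C) (\<Theta> D)"
  by (simp add: mat_hom_def)

lemma ent_mat_hom: "ent i j (mat_hom \<Theta> X) = \<Theta> (ent i j X)"
  by (cases i; cases j) (simp_all add: mat_hom_def)

lemma op_alg_mats:
  assumes "op_alg \<A>"
  shows "op_alg (mats \<A>)"
proof -
  interpret op_alg \<A> by fact
  show ?thesis
  proof
    show "id_blinfun \<in> mats \<A>" by (simp add: mats_def ent_id id_in zero_in)
    show "X + Y \<in> mats \<A>" if "X \<in> mats \<A>" "Y \<in> mats \<A>" for X Y
      using that by (simp add: mats_def ent_add add_in)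
    show "c *\<^sub>R X \<in> mats \<A>" if "X \<in> mats \<A>" for c X
      using that by (simp add: mats_def ent_scaleR scaleR_in)
    show "X o\<^sub>L Y \<in> mats \<A>" if "X \<in> mats \<A>" "Y \<in> mats \<A>" for X Y
      using that by (simp add: mats_def ent_comp add_in comp_in)
    show "radj X \<in> mats \<A>" if "X \<in> mats \<A>" for X
      using that by (simp add: mats_def ent_radj radj_in)
    fix F :: "nat \<Rightarrow> (('a \<times> 'a) \<Rightarrow>\<^sub>L ('a \<times> 'a))" and X
    assume F: "\<And>n. F n \<in> mats \<A>" "\<And>u. (\<lambda>n. F n u) \<longlonglongrightarrow> blinfun_apply X u"
    have "ent i j X \<in> \<A>" for i j
    proof (rule lim_in)
      show "ent i j (F n) \<in> \<A>" for n using F(1) by (simp add: mats_def)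
      show "(\<lambda>n. ent i j (F n) x) \<longlonglongrightarrow> ent i j X x" for x
        unfolding ent_apply
        by (cases i) (simp_all add: tendsto_fst[OF F(2)] tendsto_snd[OF F(2)])
    qed
    then show "X \<in> mats \<A>" by (simp add: mats_def)
  qed
qed

lemma op_hom_mats:
  assumes "op_hom \<A> \<B> \<Theta>"
  shows "op_hom (mats \<A>) (mats \<B>) (mat_hom \<Theta>)"
proof -
  interpret op_hom \<A> \<B> \<Theta> by fact
  interpret A2: op_alg "mats \<A>" by (rule op_alg_mats) unfold_locales
  interpret B2: op_alg "mats \<B>" by (rule op_alg_mats) unfold_locales
  have e: "ent i j X \<in> \<A>" if "X \<in> mats \<A>" for i j X using that by (simp add: mats_def)
  show ?thesis
  proof
    show "mat_hom \<Theta> X \<in> mats \<B>" if "X \<in> mats \<A>" for X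
      using that by (simp add: mats_def ent_mat_hom hom_in)
    show "mat_hom \<Theta> id_blinfun = id_blinfun"
      by (rule ent_ext) (simp add: ent_mat_hom ent_id hom_id hom_zero)
    show "mat_hom \<Theta> (X + Y) = mat_hom \<Theta> X + mat_hom \<Theta> Y" if "X \<in> mats \<A>" "Y \<in> mats \<A>" for X Y
      by (rule ent_ext) (simp add: ent_mat_hom ent_add hom_add e that)
    show "mat_hom \<Theta> (c *\<^sub>R X) = c *\<^sub>R mat_hom \<Theta> X" if "X \<in> mats \<A>" for c X
      by (rule ent_ext) (simp add: ent_mat_hom ent_scaleR hom_scaleR e that)
    show "mat_hom \<Theta> (X o\<^sub>L Y) = mat_hom \<Theta> X o\<^sub>L mat_hom \<Theta> Y" if "X \<in> mats \<A>" "Y \<in> mats \<A>" for X Y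
      by (rule ent_ext) (simp add: ent_mat_hom ent_comp hom_add hom_comp A.comp_in e that)
    show "mat_hom \<Theta> (radj X) = radj (mat_hom \<Theta> X)" if "X \<in> mats \<A>" for X
      by (rule ent_ext) (simp add: ent_mat_hom ent_radj hom_radj e that)
  qed
qed

section \<open>Normal homomorphisms preserve kernel projections\<close>

text \<open>Normality for decreasing sequences with infimum 0, phrased with self-adjoint lower
  bounds G taken from \<B>. This matches an order in which suprema are formed inside the algebra,
  and presupposes no convergence of the image sequence.\<close>

locale normal_hom = op_hom +
  assumes normal: "\<And>F G y. \<lbrakk>\<And>n::nat. F n \<in> \<A>; \<And>n. radj (F n) = F n;
      \<And>n x. inner (blinfun_apply (F (Suc n)) x) x \<le> inner (blinfun_apply (F n) x) x;
      \<And>x. (\<lambda>n. inner (blinfun_apply (F n) x) x) \<longlonglongrightarrow> 0;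
      G \<in> \<B>; radj G = G;
      \<And>n y. inner (blinfun_apply G y) y \<le> inner (blinfun_apply (\<Theta> (F n)) y) y\<rbrakk>
    \<Longrightarrow> inner (blinfun_apply G y) y \<le> 0"
begin

sublocale M2: op_hom "mats \<A>" "mats \<B>" "mat_hom \<Theta>"
  by (rule op_hom_mats) unfold_locales

text \<open>
  The powers \<open>(1 - X\<^sup>*X)\<^sup>n\<close> decrease to the kernel projection of \<open>X\<close>. Normality of \<open>\<Theta>\<close> applies to
  their diagonal entries only, but a positive matrix with zero diagonal is zero.
\<close>

lemma mat_hom_nproj:
  assumes X: "X \<in> mats \<A>"
  shows "mat_hom \<Theta> (nproj X) = nproj (mat_hom \<Theta> X)"
proof -
  let ?h = "mat_hom \<Theta>"
  \<comment> \<open>One constant that makes both X and its image contractions, so that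
    \<open>?h C\<close> is the operator belonging to the scaled image.\<close>
  define c where "c = 1 / (norm X + norm (?h X) + 1)"
  have "0 < norm X + norm (?h X) + 1" by (simp add: add_nonneg_pos)
  then have c: "0 < c" "norm (c *\<^sub>R X) \<le> 1" "norm (c *\<^sub>R ?h X) \<le> 1" by (auto simp: c_def)
  define C where "C = id_blinfun - (radj (c *\<^sub>R X) o\<^sub>L (c *\<^sub>R X))"
  have C: "C \<in> mats \<A>" unfolding C_def
    by (intro M2.A.diff_in M2.A.id_in M2.A.comp_in M2.A.radj_in M2.A.scaleR_in X)
  have hC: "?h C = id_blinfun - (radj (c *\<^sub>R ?h X) o\<^sub>L (c *\<^sub>R ?h X))"
    unfolding C_def
    by (simp add: M2.hom_diff M2.hom_id M2.hom_comp M2.hom_radj M2.hom_scaleR M2.A.id_in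
        M2.A.comp_in M2.A.radj_in M2.A.scaleR_in X)
  obtain Q where Q: "is_nproj (c *\<^sub>R X) Q" "\<And>x. (\<lambda>n. bpow C n x) \<longlonglongrightarrow> Q x"
      "\<And>n x. inner (bpow C (Suc n) x) x \<le> inner (bpow C n x) x"
    by (rule nproj_limit[OF c(2), folded C_def], rule that, assumption+)
  have Q_eq: "nproj X = Q" using Q(1) c(1) by (metis is_nproj_scaleR less_irrefl nproj_eq)
  obtain L where L: "is_nproj (c *\<^sub>R ?h X) L"
      "\<And>n x. inner (L x) x \<le> inner (bpow (?h C) n x) x"
    by (rule nproj_limit[OF c(3), folded hC], rule that, assumption+)
  have L_eq: "nproj (?h X) = L" using L(1) c(1) by (metis is_nproj_scaleR less_irrefl nproj_eq)
  have Q_in: "Q \<in> mats \<A>" using M2.A.nproj_in[OF X] Q_eq by simp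
  have L_in: "L \<in> mats \<B>" using M2.B.nproj_in[OF M2.hom_in[OF X]] L_eq by simp
  have Q_props: "radj Q = Q" "X o\<^sub>L Q = 0"
    using radj_nproj[of X] apply_nproj[of X] unfolding Q_eq by (simp_all add: blinfun_eqI)
  have "?h X o\<^sub>L ?h Q = 0" using M2.hom_comp[OF X Q_in] Q_props M2.hom_zero by simp
  then have "?h X (?h Q u) = 0" for u by (metis blinfun_apply_blinfun_compose zero_blinfun.rep_eq)
  \<comment> \<open>The image of Q has its range in the kernel of the image of X, so it is a
    subprojection of L and E = L - \<open>?h Q\<close> is again a projection.\<close>
  then have LQ: "L o\<^sub>L ?h Q = ?h Q"
    using nproj_fix[of "?h X"] L_eq by (intro blinfun_eqI) simp
  have rQ: "radj (?h Q) = ?h Q" using M2.hom_radj[OF Q_in] Q_props by simp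
  have rL: "radj L = L" using radj_nproj L_eq by metis
  have QL: "?h Q o\<^sub>L L = ?h Q" using arg_cong[OF LQ, of radj] by (simp add: radj_compose rQ rL)
  define E where "E = L - ?h Q"
  have rE: "radj E = E" by (simp add: E_def radj_diff rQ rL)
  have QQ: "Q o\<^sub>L Q = Q"
    using nproj_fix[of X] apply_nproj[of X] Q_eq by (intro blinfun_eqI) simp
  have LL: "L o\<^sub>L L = L"
    using nproj_fix[of "?h X"] apply_nproj[of "?h X"] L_eq by (intro blinfun_eqI) simp
  have "?h Q o\<^sub>L ?h Q = ?h Q" using M2.hom_comp[OF Q_in Q_in] QQ by simp
  then have "E (E u) = E u" for u
    using LQ QL LL unfolding E_def
    by (auto simp: blinfun.bilinear_simps dest!: arg_cong[of _ _ "\<lambda>X. blinfun_apply X u"])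
  then have E_form: "inner (E u) u = (norm (E u))\<^sup>2" for u
    by (metis inner_radj_right power2_norm_eq_inner rE inner_commute)
  have E0: "E (emb i y) = 0" for i y
  proof -
    \<comment> \<open>The diagonal entries of C^n - Q decrease to 0, and E lies below all their
      images because L lies below every power of \<open>?h C\<close>.\<close>
    have "inner (ent i i E y) y \<le> 0"
    proof (rule normal[of "\<lambda>n. ent i i (bpow C n - Q)"])
      show "ent i i (bpow C n - Q) \<in> \<A>" for n
        using M2.A.diff_in[OF M2.A.bpow_in[OF C] Q_in] by (simp add: mats_def)
      show "radj (ent i i (bpow C n - Q)) = ent i i (bpow C n - Q)" for n
      proof -
        have rC: "radj C = C" by (simp add: C_def radj_diff radj_compose)
        have "bpow C n o\<^sub>L C = C o\<^sub>L bpow C n" for n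
          by (induction n) (auto simp: blinfun_compose_assoc intro: blinfun_eqI)
        then have "radj (bpow C n) = bpow C n"
          by (induction n) (auto simp: radj_compose rC)
        then show ?thesis by (simp add: ent_radj[symmetric] radj_diff Q_props)
      qed
      show "inner (ent i i (bpow C (Suc n) - Q) x) x \<le> inner (ent i i (bpow C n - Q) x) x" for n x
        using Q(3) by (simp add: inner_ent blinfun.diff_left inner_diff_left del: bpow.simps)
      show "(\<lambda>n. inner (ent i i (bpow C n - Q) x) x) \<longlonglongrightarrow> 0" for x
      proof -
        have "(\<lambda>n. inner (bpow C n (emb i x) - Q (emb i x)) (emb i x)) \<longlonglongrightarrow>
            inner (Q (emb i x) - Q (emb i x)) (emb i x)"
          by (intro tendsto_intros Q(2))
        then show ?thesis by (simp add: inner_ent blinfun.diff_left)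
      qed
      show "ent i i E \<in> \<B>"
        using M2.B.diff_in[OF L_in M2.hom_in[OF Q_in]] by (simp add: mats_def E_def)
      show "radj (ent i i E) = ent i i E" by (simp add: ent_radj[symmetric] rE)
      show "inner (ent i i E y) y \<le> inner (\<Theta> (ent i i (bpow C n - Q)) y) y" for n y
        using L(2) unfolding ent_mat_hom[symmetric] inner_ent
        by (simp add: M2.hom_diff M2.hom_bpow M2.A.bpow_in C Q_in E_def blinfun.diff_left inner_diff_left)
    qed
    then show ?thesis by (simp add: inner_ent E_form)
  qed
  have "E = 0"
    by (rule ent_ext) (auto intro!: blinfun_eqI simp: ent_apply E0)
  then show ?thesis by (simp add: E_def Q_eq L_eq)
qed

text \<open>The inclusion of kernels is equivalent to the vanishing of Y times the kernel projection
  of X, and this equation is preserved together with the projection.\<close>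

lemma mat_hom_null_mono:
  assumes X: "X \<in> mats \<A>" and Y: "Y \<in> mats \<A>"
    and sub: "\<And>u. X u = 0 \<Longrightarrow> Y u = 0"
    and v: "mat_hom \<Theta> X v = 0"
  shows "mat_hom \<Theta> Y v = 0"
proof -
  have "Y o\<^sub>L nproj X = 0" using sub[OF apply_nproj] by (intro blinfun_eqI) simp
  then have "mat_hom \<Theta> Y o\<^sub>L nproj (mat_hom \<Theta> X) = 0"
    using M2.hom_comp[OF Y M2.A.nproj_in[OF X]] mat_hom_nproj[OF X] M2.hom_zero by simp
  then have "mat_hom \<Theta> Y (nproj (mat_hom \<Theta> X) v) = 0"
    by (metis blinfun_apply_blinfun_compose zero_blinfun.rep_eq)
  then show ?thesis using nproj_fix[OF v] by simp
qed

text \<open>Orthogonal complements turn the inclusion into the reverse one between kernels of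
  adjoints.\<close>

lemma mat_hom_closure_range_mono:
  assumes Z: "Z \<in> mats \<A>" and W: "W \<in> mats \<A>"
    and sub: "closure (range (blinfun_apply Z)) \<subseteq> closure (range (blinfun_apply W))"
  shows "closure (range (blinfun_apply (mat_hom \<Theta> Z))) \<subseteq> closure (range (blinfun_apply (mat_hom \<Theta> W)))"
proof -
  have "radj Z u = 0" if "radj W u = 0" for u
  proof (rule inner_ext)
    fix x
    have "Z x \<in> closure (range W)"
      using sub closure_subset[of "range (blinfun_apply Z)"] by auto
    then have "inner (Z x) u = 0" using that closure_range_iff by blast
    then show "inner x (radj Z u) = inner x 0" by (simp add: inner_radj_right)
  qed
  then have "radj (mat_hom \<Theta> Z) u = 0" if "radj (mat_hom \<Theta> W) u = 0" for u
    using mat_hom_null_mono[of "radj W" "radj Z" u] that W Z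
    by (simp add: M2.A.radj_in M2.hom_radj)
  then show ?thesis unfolding subset_iff closure_range_iff by blast
qed

text \<open>B is placed in a corner of a matrix. The second coordinate lies entirely in the kernel,
  which accounts for the entry \<open>id_blinfun\<close>.\<close>

lemma hom_nproj:
  assumes B: "B \<in> \<A>"
  shows "\<Theta> (nproj B) = nproj (\<Theta> B)"
proof -
  have *: "nproj (opmat B 0 0 0) = opmat (nproj B) 0 0 id_blinfun"
    for B :: "'x::{real_inner,banach} \<Rightarrow>\<^sub>L 'x"
    by (rule nproj_eq)
      (auto simp: is_nproj_def radj_opmat radj_nproj opmat_apply apply_nproj nproj_fix prod_eq_iff)
  have "mat_hom \<Theta> (nproj (opmat B 0 0 0)) = nproj (mat_hom \<Theta> (opmat B 0 0 0))"
    by (intro mat_hom_nproj opmat_in_mats B A.zero_in)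
  then have eq: "opmat (\<Theta> (nproj B)) 0 0 id_blinfun = opmat (nproj (\<Theta> B)) 0 0 id_blinfun"
    by (simp add: * mat_hom_opmat hom_zero hom_id)
  show ?thesis using arg_cong[OF eq, of "ent False False"] by simp
qed

end

section \<open>Complex Hilbert spaces and the double commutant theorem\<close>

lemma scaleC_one [simp]: "1 *\<^sub>C x = x"
  by (metis of_real_1 scaleR_one scaleR_scaleC)

lemma scaleC_zero_right [simp]: "c *\<^sub>C 0 = 0"
  by (metis add_cancel_right_left scaleC_add_right)

lemma scaleC_zero_left [simp]: "0 *\<^sub>C x = 0"
  by (metis of_real_0 scaleR_zero_left scaleR_scaleC)

lemma scaleC_minus_right: "c *\<^sub>C (- x) = - (c *\<^sub>C x)"
  by (metis add_eq_0_iff scaleC_add_right scaleC_zero_right)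

lemma scaleC_minus_left: "(- c) *\<^sub>C x = - (c *\<^sub>C x)"
  by (metis add_eq_0_iff scaleC_add_left scaleC_zero_left)

lemma scaleC_diff_right: "c *\<^sub>C (x - y) = c *\<^sub>C x - c *\<^sub>C y"
  by (metis add_diff_cancel diff_add_cancel scaleC_add_right)

lemma scaleC_minus1: "(-1) *\<^sub>C x = - x"
  using scaleR_scaleC[of "-1" x] by simp

lemma cinner_scaleC_right: "cinner x (a *\<^sub>C y) = cnj a * cinner x y"
  by (metis cinner_commute cinner_scaleC_left complex_cnj_mult)

lemma inner_scaleC_left: "inner (c *\<^sub>C x) y = inner x (cnj c *\<^sub>C y)"
  by (simp add: inner_eq_Re_cinner cinner_scaleC_left cinner_scaleC_right)

lemma Im_cinner: "Im (cinner x y) = inner (- \<i> *\<^sub>C x) y"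
  by (simp add: inner_eq_Re_cinner cinner_scaleC_left)

lemma bounded_opsD: "A \<in> bounded_ops \<Longrightarrow> A (c *\<^sub>C x) = c *\<^sub>C A x"
  by (simp add: bounded_ops_def)

lemma radj_bounded_ops:
  assumes "A \<in> bounded_ops"
  shows "radj A \<in> bounded_ops"
proof -
  have "radj A (c *\<^sub>C y) = c *\<^sub>C radj A y" for c y
  proof (rule inner_ext)
    fix x
    have "inner x (radj A (c *\<^sub>C y)) = inner (A (cnj c *\<^sub>C x)) y"
      by (simp add: inner_radj_right[symmetric] bounded_opsD[OF assms] inner_scaleC_left)
    then show "inner x (radj A (c *\<^sub>C y)) = inner x (c *\<^sub>C radj A y)"
      by (simp add: inner_radj_right inner_scaleC_left)
  qed
  then show ?thesis by (simp add: bounded_ops_def)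
qed

lemma cinner_eqI:
  assumes "\<And>c. inner (c *\<^sub>C x) y = inner (c *\<^sub>C x') y'"
  shows "cinner x y = cinner x' y'"
  using assms[of 1] assms[of "- \<i>"] by (intro complex_eqI) (simp_all add: Im_cinner inner_eq_Re_cinner)

text \<open>Complex linearity of A lets the real adjoint identity be applied to c x for every scalar
  c, which recovers imaginary parts. Uniqueness is visible on real parts already.\<close>

lemma adj_eq_radj:
  assumes "A \<in> bounded_ops"
  shows "adj A = radj A"
  unfolding adj_def
proof (rule the_equality)
  show "\<forall>x y. cinner (A x) y = cinner x (radj A y)"
    by (intro allI cinner_eqI)
      (simp add: inner_radj_right[symmetric] bounded_opsD[OF assms])
  show "B = radj A" if "\<forall>x y. cinner (A x) y = cinner x (blinfun_apply B y)" for B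
    using that by (intro radj_unique[symmetric]) (simp add: inner_eq_Re_cinner)
qed

lemma scale_op_bounded_ops: "A \<in> bounded_ops \<Longrightarrow> scale_op c A \<in> bounded_ops"
  by (simp add: bounded_ops_def scale_op_apply scaleC_scaleC mult.commute)

lemma radj_scale_op:
  assumes "A \<in> bounded_ops"
  shows "radj (scale_op c A) = scale_op (cnj c) (radj A)"
  by (rule radj_unique)
    (simp add: scale_op_apply inner_scaleC_left inner_radj_right
      bounded_opsD[OF radj_bounded_ops[OF assms]])

lemma scale_op_of_real: "scale_op (of_real r) A = r *\<^sub>R A"
  by (rule blinfun_eqI) (simp add: scale_op_apply blinfun.bilinear_simps scaleR_scaleC)

lemma unitary_radj:
  assumes "unitary U"
  shows "unitary (radj U)" "radj U o\<^sub>L U = id_blinfun" "U o\<^sub>L radj U = id_blinfun"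
  using assms unfolding unitary_def by (auto simp: adj_eq_radj radj_bounded_ops)

text \<open>The strong topology is pulled back from pointwise convergence, and a basic product
  neighbourhood constrains only finitely many vectors.\<close>

lemma closedin_strong_operator_topologyI:
  fixes T :: "'a::real_normed_vector \<Rightarrow>\<^sub>L 'b::real_normed_vector"
  assumes closed: "closedin strong_operator_topology M"
    and approx: "\<And>I e. finite I \<Longrightarrow> 0 < e \<Longrightarrow> \<exists>A\<in>M. \<forall>x\<in>I. norm (blinfun_apply A x - T x) < e"
  shows "T \<in> M"
proof (rule ccontr)
  assume "T \<notin> M"
  have "openin strong_operator_topology (UNIV - M)"
    using closed by (simp add: closedin_def strong_operator_topology_topspace)
  then obtain W where W: "open W" "UNIV - M = blinfun_apply -` W"
    unfolding strong_operator_topology_def openin_pullback_topology by auto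
  have "blinfun_apply T \<in> W" using W \<open>T \<notin> M\<close> by auto
  then obtain X where X: "blinfun_apply T \<in> Pi\<^sub>E UNIV X" "\<And>i. open (X i)"
      "finite {i. X i \<noteq> UNIV}" "Pi\<^sub>E UNIV X \<subseteq> W"
    using product_topology_open_contains_basis[of "\<lambda>_. euclidean" UNIV W "blinfun_apply T"] W(1)
    by (auto simp: open_fun_def)
  define I where "I = {i. X i \<noteq> UNIV}"
  have "\<exists>e>0. ball (T i) e \<subseteq> X i" for i
    using X(1,2) openE by blast
  then obtain \<epsilon> where \<epsilon>: "\<And>i. 0 < \<epsilon> i" "\<And>i. ball (T i) (\<epsilon> i) \<subseteq> X i" by metis
  \<comment> \<open>The element 1 keeps the set nonempty when no coordinate is constrained.\<close>
  define e where "e = Min (insert 1 (\<epsilon> ` I))"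
  have "finite I" using X by (simp add: I_def)
  then have e: "0 < e" "\<And>i. i \<in> I \<Longrightarrow> e \<le> \<epsilon> i" using \<epsilon>(1) by (auto simp: e_def)
  obtain A where A: "A \<in> M" "\<And>x. x \<in> I \<Longrightarrow> norm (blinfun_apply A x - T x) < e"
    using approx[OF \<open>finite I\<close> e(1)] by blast
  have "A i \<in> X i" for i
  proof (cases "i \<in> I")
    case True
    then have "A i \<in> ball (T i) (\<epsilon> i)"
      using A(2)[of i] e(2)[of i] by (simp add: dist_norm norm_minus_commute)
    then show ?thesis using \<epsilon> by blast
  qed (simp add: I_def)
  then have "blinfun_apply A \<in> W" using X by auto
  then show False using W A by blast
qed

locale vn_alg =
  fixes M :: "('a::chilbert_space \<Rightarrow>\<^sub>L 'a) set"
  assumes vn: "von_neumann_algebra M"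
begin

lemma sub_bounded_ops: "A \<in> M \<Longrightarrow> A \<in> bounded_ops"
  using vn unfolding von_neumann_algebra_def by blast

lemma scale_op_in: "A \<in> M \<Longrightarrow> scale_op c A \<in> M"
  using vn unfolding von_neumann_algebra_def by blast

sublocale op_alg M
proof
  show "id_blinfun \<in> M" "\<And>A B. A \<in> M \<Longrightarrow> B \<in> M \<Longrightarrow> A + B \<in> M"
    "\<And>A B. A \<in> M \<Longrightarrow> B \<in> M \<Longrightarrow> A o\<^sub>L B \<in> M"
    using vn unfolding von_neumann_algebra_def by blast+
  show "c *\<^sub>R A \<in> M" if "A \<in> M" for c A
    using scale_op_in[OF that, of "of_real c"] by (simp add: scale_op_of_real)
  show "radj A \<in> M" if "A \<in> M" for A
    using vn that adj_eq_radj[OF sub_bounded_ops[OF that]] unfolding von_neumann_algebra_def by metis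
  fix F :: "nat \<Rightarrow> ('a \<Rightarrow>\<^sub>L 'a)" and A
  assume F: "\<And>n. F n \<in> M" "\<And>x. (\<lambda>n. F n x) \<longlonglongrightarrow> blinfun_apply A x"
  show "A \<in> M"
  proof (rule closedin_strong_operator_topologyI)
    show "closedin strong_operator_topology M"
      using vn unfolding von_neumann_algebra_def by blast
    fix I :: "'a set" and e :: real
    assume "finite I" "0 < e"
    then have "\<forall>\<^sub>F n in sequentially. \<forall>x\<in>I. norm (F n x - A x) < e"
      using F(2) by (intro eventually_ball_finite) (auto simp: tendsto_iff dist_norm)
    then have "\<exists>n. \<forall>x\<in>I. norm (F n x - A x) < e"
      using eventually_happens' sequentially_bot by blast
    then show "\<exists>A'\<in>M. \<forall>x\<in>I. norm (blinfun_apply A' x - A x) < e" using F(1) by blast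
  qed
qed

section \<open>The commutant and double commutant\<close>

lemma commutant_bounded_ops: "Z \<in> commutant M \<Longrightarrow> Z \<in> bounded_ops"
  by (simp add: commutant_def)

lemma commutantD:
  assumes "Z \<in> commutant M" "B \<in> M"
  shows "Z (B x) = B (Z x)"
proof -
  have "Z o\<^sub>L B = B o\<^sub>L Z" using assms by (simp add: commutant_def)
  from arg_cong[OF this, of "\<lambda>X. blinfun_apply X x"] show ?thesis by simp
qed

lemma commutantI: "Z \<in> bounded_ops \<Longrightarrow> (\<And>B x. B \<in> M \<Longrightarrow> Z (B x) = B (Z x)) \<Longrightarrow> Z \<in> commutant M"
  unfolding commutant_def by (auto intro!: blinfun_eqI)

lemma commutant_scale_op: "Z \<in> commutant M \<Longrightarrow> scale_op c Z \<in> commutant M"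
  by (rule commutantI)
    (auto simp: scale_op_bounded_ops commutant_bounded_ops scale_op_apply commutantD
      bounded_opsD[OF sub_bounded_ops])

text \<open>Makes \<open>sqrt_exists\<close> available in the commutant, where unitaries are to be
  built from self-adjoint contractions.\<close>

lemma op_alg_commutant: "op_alg (commutant M)"
proof
  show "id_blinfun \<in> commutant M" by (rule commutantI) (auto simp: bounded_ops_def)
  show "A + B \<in> commutant M" if "A \<in> commutant M" "B \<in> commutant M" for A B
    using that commutant_bounded_ops[OF that(1)] commutant_bounded_ops[OF that(2)]
    by (intro commutantI)
      (auto simp: bounded_ops_def blinfun.bilinear_simps scaleC_add_right commutantD)
  show "c *\<^sub>R A \<in> commutant M" if "A \<in> commutant M" for A c
    using commutant_scale_op[OF that, of "of_real c"] by (simp add: scale_op_of_real)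
  show "A o\<^sub>L B \<in> commutant M" if "A \<in> commutant M" "B \<in> commutant M" for A B
    using that commutant_bounded_ops[OF that(1)] commutant_bounded_ops[OF that(2)]
    by (intro commutantI) (auto simp: bounded_ops_def commutantD)
  show "radj Z \<in> commutant M" if Z: "Z \<in> commutant M" for Z
  proof (rule commutantI)
    show "radj Z \<in> bounded_ops" using Z by (simp add: radj_bounded_ops commutant_bounded_ops)
    fix B x assume B: "B \<in> M"
    show "radj Z (B x) = B (radj Z x)"
    proof (rule inner_ext)
      fix y
      have "inner y (radj Z (B x)) = inner (radj B (Z y)) x"
        by (simp add: inner_radj_right[symmetric] inner_radj_left)
      also have "\<dots> = inner y (B (radj Z x))"
        by (simp add: commutantD[OF Z radj_in[OF B], symmetric] inner_radj_right)
      finally show "inner y (radj Z (B x)) = inner y (B (radj Z x))" .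
    qed
  qed
  fix F :: "nat \<Rightarrow> ('a \<Rightarrow>\<^sub>L 'a)" and A
  assume F: "\<And>n. F n \<in> commutant M" "\<And>x. (\<lambda>n. F n x) \<longlonglongrightarrow> blinfun_apply A x"
  show "A \<in> commutant M"
  proof (rule commutantI)
    have "A (c *\<^sub>C x) = c *\<^sub>C A x" for c x
    proof -
      have "(\<lambda>n. F n (c *\<^sub>C x)) \<longlonglongrightarrow> c *\<^sub>C A x"
        using bounded_linear.tendsto[OF bounded_linear_scaleC F(2), of c x]
        by (simp add: bounded_opsD commutant_bounded_ops F(1))
      then show ?thesis using F(2) LIMSEQ_unique by blast
    qed
    then show "A \<in> bounded_ops" by (simp add: bounded_ops_def)
    fix B x assume B: "B \<in> M"
    have "(\<lambda>n. B (F n x)) \<longlonglongrightarrow> B (A x)" by (intro tendsto_intros F(2))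
    then have "(\<lambda>n. F n (B x)) \<longlonglongrightarrow> B (A x)" by (simp add: commutantD F(1) B)
    then show "A (B x) = B (A x)" using F(2) LIMSEQ_unique by blast
  qed
qed

text \<open>
  The proof projects in the space of tuples indexed by the finite set \<open>I\<close> onto the closure of
  \<open>{(A x)\<^sub>x | A \<in> M}\<close>; the matrix entries of this projection lie in the commutant.
\<close>

lemma bicommutant_approx:
  assumes T: "\<And>Z x. Z \<in> commutant M \<Longrightarrow> blinfun_apply T (Z x) = Z (T x)"
    and I: "finite I" and e: "0 < e"
  shows "\<exists>A\<in>M. \<forall>x\<in>I. norm (blinfun_apply A x - T x) < e"
proof -
  \<comment> \<open>Only the values of p on I matter: L says that this tuple is a limit of tuples (A
    x) with A in M.\<close>
  define L :: "('a \<Rightarrow> 'a) \<Rightarrow> bool" where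
    "L p \<longleftrightarrow> (\<exists>a::nat \<Rightarrow> 'a \<Rightarrow>\<^sub>L 'a. (\<forall>k. a k \<in> M) \<and> (\<forall>x\<in>I. (\<lambda>k. a k x) \<longlonglongrightarrow> p x))" for p
  define orth where "orth v \<longleftrightarrow> (\<forall>A\<in>M. (\<Sum>x\<in>I. inner (blinfun_apply A x) (v x)) = 0)" for v :: "'a \<Rightarrow> 'a"
  have L_add: "L (\<lambda>x. p x + p' x)" if "L p" "L p'" for p p'
  proof -
    obtain a a' where "\<And>k. a k \<in> M" "\<And>k. a' k \<in> M" "\<And>x. x \<in> I \<Longrightarrow> (\<lambda>k::nat. a k x) \<longlonglongrightarrow> p x"
      "\<And>x. x \<in> I \<Longrightarrow> (\<lambda>k::nat. a' k x) \<longlonglongrightarrow> p' x"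
      using \<open>L p\<close> \<open>L p'\<close> unfolding L_def by metis
    then show ?thesis unfolding L_def
      by (intro exI[of _ "\<lambda>k. a k + a' k"]) (simp add: add_in blinfun.bilinear_simps tendsto_add)
  qed
  have L_map: "L (\<lambda>x. B (p x))" if "L p" "B \<in> M" for p B
  proof -
    obtain a where "\<And>k. a k \<in> M" "\<And>x. x \<in> I \<Longrightarrow> (\<lambda>k::nat. a k x) \<longlonglongrightarrow> p x"
      using \<open>L p\<close> unfolding L_def by metis
    then show ?thesis unfolding L_def using \<open>B \<in> M\<close>
      by (intro exI[of _ "\<lambda>k. B o\<^sub>L a k"]) (auto simp: comp_in intro!: tendsto_intros)
  qed
  have L_scale: "L (\<lambda>x. c *\<^sub>C p x)" if "L p" for p c
    using L_map[OF that scale_op_in[OF id_in, of c]] by (simp add: scale_op_apply)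
  have L_zero: "L (\<lambda>x. 0)"
    unfolding L_def by (intro exI[of _ "\<lambda>_. 0"]) (simp add: zero_in)
  have L_diff: "L (\<lambda>x. p x - p' x)" if "L p" "L p'" for p p'
    using L_add[OF that(1) L_scale[OF that(2), of "-1"]] by (simp add: scaleC_minus1)
  have L_sum: "L (\<lambda>x. \<Sum>y\<in>J. p y x)" if "finite J" "\<And>y. y \<in> J \<Longrightarrow> L (p y)" for J :: "'a set" and p
    using that by (induction J rule: finite_induct) (auto simp: L_zero L_add)
  have O_add: "orth (\<lambda>x. v x + v' x)" if "orth v" "orth v'" for v v'
    using that by (simp add: orth_def inner_add_right sum.distrib)
  have O_map: "orth (\<lambda>x. B (v x))" if "orth v" "B \<in> M" for v B
    unfolding orth_def
  proof
    fix A assume A: "A \<in> M"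
    have "(\<Sum>x\<in>I. inner ((radj B o\<^sub>L A) x) (v x)) = 0"
      using that A by (simp add: orth_def comp_in radj_in del: blinfun_apply_blinfun_compose)
    then show "(\<Sum>x\<in>I. inner (A x) (B (v x))) = 0" by (simp add: inner_radj_left)
  qed
  have O_scale: "orth (\<lambda>x. c *\<^sub>C v x)" if "orth v" for v c
    using O_map[OF that scale_op_in[OF id_in, of c]] by (simp add: scale_op_apply)
  have O_diff: "orth (\<lambda>x. v x - v' x)" if "orth v" "orth v'" for v v'
    using O_add[OF that(1) O_scale[OF that(2), of "-1"]] by (simp add: scaleC_minus1)
  have O_sum: "orth (\<lambda>x. \<Sum>y\<in>J. v y x)" if "finite J" "\<And>y. y \<in> J \<Longrightarrow> orth (v y)" for J :: "'a set" and v
    using that by (induction J rule: finite_induct) (auto simp: orth_def[of "\<lambda>x. 0"] O_add)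
  have LO: "(\<Sum>x\<in>I. inner (p x) (v x)) = 0" if "L p" "orth v" for p v
  proof -
    obtain a where a: "\<And>k. a k \<in> M" "\<And>x. x \<in> I \<Longrightarrow> (\<lambda>k::nat. a k x) \<longlonglongrightarrow> p x"
      using \<open>L p\<close> unfolding L_def by metis
    have "(\<lambda>k. \<Sum>x\<in>I. inner (a k x) (v x)) \<longlonglongrightarrow> (\<Sum>x\<in>I. inner (p x) (v x))"
      by (intro tendsto_sum tendsto_inner tendsto_const a)
    moreover have "(\<Sum>x\<in>I. inner (a k x) (v x)) = 0" for k
      using \<open>orth v\<close> a(1) unfolding orth_def by blast
    ultimately have "(\<lambda>k::nat. 0) \<longlonglongrightarrow> (\<Sum>x\<in>I. inner (p x) (v x))" by simp
    then show ?thesis using LIMSEQ_unique[OF tendsto_const] by force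
  qed
  have L_orth_zero: "d x = 0" if "L d" "orth d" "x \<in> I" for d x
    using LO[OF that(1,2)] that(3) I by (simp add: sum_nonneg_eq_0_iff)
  \<comment> \<open>Projection of an arbitrary tuple w. The minimisation runs over M itself,
    seminormed by the values on I.\<close>
  have ex: "\<exists>p. L p \<and> orth (\<lambda>x. w x - p x)" for w
  proof -
    define q where "q A B = (\<Sum>x\<in>I. inner (blinfun_apply A x) (blinfun_apply B x))" for A B :: "'a \<Rightarrow>\<^sub>L 'a"
    define f where "f A = (\<Sum>x\<in>I. inner (blinfun_apply A x) (w x))" for A :: "'a \<Rightarrow>\<^sub>L 'a"
    have norm_le: "norm (blinfun_apply A x) \<le> sqrt (q A A)" if "x \<in> I" for A x
    proof -
      have "inner (A x) (A x) \<le> q A A"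
        unfolding q_def by (rule member_le_sum[OF that]) (auto simp: I)
      then show ?thesis by (simp add: norm_eq_sqrt_inner)
    qed
    obtain a where a: "\<And>n. a n \<in> M"
      "\<And>m n. q (a m - a n) (a m - a n) \<le> 2 / real (Suc m) + 2 / real (Suc n)"
      "\<And>A. A \<in> M \<Longrightarrow> (\<lambda>n. q A (a n)) \<longlonglongrightarrow> f A"
    proof (rule riesz_sequence[of M q f "\<Sum>x\<in>I. norm (w x)"])
      show "q A B = q B A" for A B unfolding q_def by (simp only: inner_commute)
      show "0 \<le> q A A" for A by (simp add: q_def sum_nonneg)
      fix A
      have "\<bar>f A\<bar> \<le> (\<Sum>x\<in>I. \<bar>inner (A x) (w x)\<bar>)" unfolding f_def by (rule sum_abs)
      also have "\<dots> \<le> (\<Sum>x\<in>I. sqrt (q A A) * norm (w x))"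
      proof (rule sum_mono)
        fix x assume "x \<in> I"
        have "\<bar>inner (A x) (w x)\<bar> \<le> norm (A x) * norm (w x)" by (rule Cauchy_Schwarz_ineq2)
        also have "\<dots> \<le> sqrt (q A A) * norm (w x)"
          using norm_le[OF \<open>x \<in> I\<close>] by (rule mult_right_mono) simp
        finally show "\<bar>inner (A x) (w x)\<bar> \<le> sqrt (q A A) * norm (w x)" .
      qed
      finally show "\<bar>f A\<bar> \<le> (\<Sum>x\<in>I. norm (w x)) * sqrt (q A A)"
        by (simp add: sum_distrib_left mult.commute)
    qed (auto simp: zero_in add_in scaleR_in q_def f_def blinfun.bilinear_simps inner_add_left
        sum.distrib sum_distrib_left)
    have "\<exists>l. (\<lambda>n. a n x) \<longlonglongrightarrow> l" if "x \<in> I" for x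
    proof -
      have "Cauchy (\<lambda>n. a n x)"
      proof (rule CauchyI_sq_bound)
        fix m n
        have "(norm (a m x - a n x))\<^sup>2 \<le> q (a m - a n) (a m - a n)"
          unfolding q_def power2_norm_eq_inner blinfun.diff_left[symmetric]
          by (rule member_le_sum[OF that]) (auto simp: I)
        then show "(norm (a m x - a n x))\<^sup>2 \<le> 2 / real (Suc m) + 2 / real (Suc n)"
          using a(2) order_trans by blast
      qed
      then show ?thesis using Cauchy_convergent convergent_def by blast
    qed
    then obtain p where p: "\<And>x. x \<in> I \<Longrightarrow> (\<lambda>n. a n x) \<longlonglongrightarrow> p x" by metis
    have "L p" unfolding L_def using a(1) p by blast
    moreover have "orth (\<lambda>x. w x - p x)"
      unfolding orth_def
    proof
      fix A assume A: "A \<in> M"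
      have "(\<lambda>n. q A (a n)) \<longlonglongrightarrow> (\<Sum>x\<in>I. inner (A x) (p x))"
        unfolding q_def by (intro tendsto_sum tendsto_inner tendsto_const p)
      then have "f A = (\<Sum>x\<in>I. inner (A x) (p x))" using a(3)[OF A] LIMSEQ_unique by blast
      then show "(\<Sum>x\<in>I. inner (A x) (w x - p x)) = 0"
        by (simp add: f_def inner_diff_right sum_subtractf)
    qed
    ultimately show ?thesis by blast
  qed
  \<comment> \<open>The tuple with v in position y. The map v \<mapsto> p y v x is then the (x, y)
    entry of the matrix of the projection.\<close>
  define unit where "unit y v = (\<lambda>x. if x = y then v else 0)" for y v :: 'a
  obtain p where p: "\<And>y v. L (p y v)" "\<And>y v. orth (\<lambda>x. unit y v x - p y v x)"
    using ex[of "unit _ _"] by metis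
  have uniq: "p y v x = p' x" if "L p'" "orth (\<lambda>x. unit y v x - p' x)" "x \<in> I" for y v p' x
  proof -
    have "orth (\<lambda>x. (unit y v x - p' x) - (unit y v x - p y v x))"
      using O_diff that p by blast
    then have "orth (\<lambda>x. p y v x - p' x)" by simp
    then show ?thesis using L_orth_zero[OF L_diff[OF p(1) that(1)]] that(3) by fastforce
  qed
  have p_add: "p y (v + v') x = p y v x + p y v' x" if "x \<in> I" for y v v' x
  proof (rule uniq[OF L_add[OF p(1) p(1)] _ that])
    have "orth (\<lambda>x. (unit y v x - p y v x) + (unit y v' x - p y v' x))" by (rule O_add[OF p(2) p(2)])
    moreover have "(\<lambda>x. (unit y v x - p y v x) + (unit y v' x - p y v' x)) =
      (\<lambda>x. unit y (v + v') x - (p y v x + p y v' x))" by (auto simp: unit_def)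
    ultimately show "orth (\<lambda>x. unit y (v + v') x - (p y v x + p y v' x))" by simp
  qed
  have p_map: "p y (B v) x = B (p y v x)" if "x \<in> I" "B \<in> M" for y v B x
  proof (rule uniq[OF L_map[OF p(1) that(2)] _ that(1)])
    have "orth (\<lambda>x. B (unit y v x - p y v x))" by (rule O_map[OF p(2) that(2)])
    moreover have "(\<lambda>x. B (unit y v x - p y v x)) = (\<lambda>x. unit y (B v) x - B (p y v x))"
      by (auto simp: unit_def blinfun.bilinear_simps)
    ultimately show "orth (\<lambda>x. unit y (B v) x - B (p y v x))" by simp
  qed
  have p_scale: "p y (c *\<^sub>C v) x = c *\<^sub>C p y v x" if "x \<in> I" for y v c x
    using p_map[OF that scale_op_in[OF id_in, of c]] by (simp add: scale_op_apply)
  have p_norm: "norm (p y v x) \<le> norm v" if "x \<in> I" "y \<in> I" for y v x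
  proof -
    have "(\<Sum>x\<in>I. (norm (unit y v x - p y v x))\<^sup>2) =
      (\<Sum>x\<in>I. (norm (unit y v x))\<^sup>2) - (\<Sum>x\<in>I. (norm (p y v x))\<^sup>2)
        - 2 * (\<Sum>x\<in>I. inner (p y v x) (unit y v x - p y v x))"
      unfolding sum_distrib_left sum_subtractf[symmetric]
      by (rule sum.cong)
        (auto simp: power2_norm_eq_inner inner_diff_left inner_diff_right inner_commute algebra_simps)
    moreover have "0 \<le> (\<Sum>x\<in>I. (norm (unit y v x - p y v x))\<^sup>2)" by (simp add: sum_nonneg)
    ultimately have "(\<Sum>x\<in>I. (norm (p y v x))\<^sup>2) \<le> (\<Sum>x\<in>I. (norm (unit y v x))\<^sup>2)"
      using LO[OF p(1) p(2)] by simp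
    also have "\<dots> = (\<Sum>x\<in>I. if x = y then (norm v)\<^sup>2 else 0)"
      by (rule sum.cong) (auto simp: unit_def)
    also have "\<dots> = (norm v)\<^sup>2" using that I by simp
    finally have "(\<Sum>x\<in>I. (norm (p y v x))\<^sup>2) \<le> (norm v)\<^sup>2" .
    moreover have "(norm (p y v x))\<^sup>2 \<le> (\<Sum>x\<in>I. (norm (p y v x))\<^sup>2)"
      by (rule member_le_sum[OF that(1)]) (auto simp: I)
    ultimately have "(norm (p y v x))\<^sup>2 \<le> (norm v)\<^sup>2" by linarith
    then show ?thesis by (rule power2_le_imp_le) simp
  qed
  \<comment> \<open>The subspace and its complement are invariant under M acting diagonally, so each
    entry of the projection lies in the commutant and T commutes with it.\<close>
  have T_p: "T (p y v x) = p y (T v) x" if "x \<in> I" "y \<in> I" for x y v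
  proof -
    have lin: "bounded_linear (\<lambda>v. p y v x)"
      by (rule bounded_linear_intro[where K = 1])
        (use that in \<open>auto simp: p_add p_scale scaleR_scaleC p_norm\<close>)
    define Z where "Z = Blinfun (\<lambda>v. p y v x)"
    have Z: "Z v = p y v x" for v by (simp add: Z_def bounded_linear_Blinfun_apply[OF lin])
    have "Z \<in> commutant M"
      by (rule commutantI) (simp_all add: bounded_ops_def Z p_scale p_map that)
    from T[OF this] show ?thesis by (simp add: Z)
  qed
  \<comment> \<open>The tuple (x) belongs to the subspace, through A = 1, and is therefore fixed by
    the projection. Applying T puts (T x) into the subspace as well.\<close>
  have id_sum: "x = (\<Sum>y\<in>I. p y y x)" if "x \<in> I" for x
  proof -
    have "L (\<lambda>x. x)" unfolding L_def by (intro exI[of _ "\<lambda>_. id_blinfun"]) (simp add: id_in)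
    then have L1: "L (\<lambda>x. x - (\<Sum>y\<in>I. p y y x))" by (intro L_diff L_sum I p)
    have "orth (\<lambda>x. \<Sum>y\<in>I. unit y y x - p y y x)" by (intro O_sum I p)
    moreover have "(\<Sum>y\<in>I. unit y y x - p y y x) = x - (\<Sum>y\<in>I. p y y x)" if "x \<in> I" for x
      using that I by (simp add: sum_subtractf unit_def)
    ultimately have "orth (\<lambda>x. x - (\<Sum>y\<in>I. p y y x))" by (simp add: orth_def)
    then show ?thesis using L_orth_zero[OF L1] that by fastforce
  qed
  have "L (\<lambda>x. \<Sum>y\<in>I. p y (T y) x)" by (intro L_sum I p)
  moreover have "(\<Sum>y\<in>I. p y (T y) x) = T x" if "x \<in> I" for x
  proof -
    have "T x = T (\<Sum>y\<in>I. p y y x)" using id_sum[OF that] by simp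
    also have "\<dots> = (\<Sum>y\<in>I. T (p y y x))" by (rule blinfun.sum_right)
    finally show ?thesis using T_p that by simp
  qed
  ultimately obtain a where a: "\<And>k::nat. a k \<in> M" "\<And>x. x \<in> I \<Longrightarrow> (\<lambda>k. a k x) \<longlonglongrightarrow> T x"
    unfolding L_def by auto
  have "\<forall>\<^sub>F n in sequentially. \<forall>x\<in>I. norm (a n x - T x) < e"
    using a(2) I e by (intro eventually_ball_finite) (auto simp: tendsto_iff dist_norm)
  then have "\<exists>n. \<forall>x\<in>I. norm (a n x - T x) < e"
    using eventually_happens' sequentially_bot by blast
  then show ?thesis using a(1) by blast
qed

lemma bicommutant:
  assumes "\<And>Z x. Z \<in> commutant M \<Longrightarrow> blinfun_apply T (Z x) = Z (T x)"
  shows "T \<in> M"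
proof (rule closedin_strong_operator_topologyI)
  show "closedin strong_operator_topology M"
    using vn unfolding von_neumann_algebra_def by blast
qed (rule bicommutant_approx[OF assms])

text \<open>
  A self-adjoint contraction \<open>A\<close> is the real part of the unitary \<open>A + \<i> \<surd>(1 - A\<^sup>2)\<close>, so the
  commutant is spanned by its unitaries.
\<close>

lemma in_if_commutes_unitaries:
  assumes T: "T \<in> bounded_ops"
    and comm: "\<And>U x. U \<in> commutant M \<Longrightarrow> unitary U \<Longrightarrow> blinfun_apply T (U x) = U (T x)"
  shows "T \<in> M"
proof (rule bicommutant)
  interpret C: op_alg "commutant M" by (rule op_alg_commutant)
  have sa1: "T (A x) = A (T x)" if A: "A \<in> commutant M" "radj A = A" "norm A \<le> 1" for A x
  proof -
    have "norm (A o\<^sub>L A) \<le> norm A * norm A" by (rule norm_blinfun_compose)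
    also have "\<dots> \<le> 1" using A(3) by (simp add: mult_le_one)
    finally have n: "norm (A o\<^sub>L A) \<le> 1" .
    \<comment> \<open>A commutes with its square and hence with this square root; this is what makes
      U and its adjoint inverse to each other.\<close>
    obtain S where S: "S \<in> commutant M" "radj S = S" "S o\<^sub>L S = id_blinfun - (A o\<^sub>L A)"
      "A o\<^sub>L S = S o\<^sub>L A"
      using C.sqrt_exists[of "A o\<^sub>L A"] n A
      by (metis C.comp_in blinfun_compose_assoc radj_compose)
    define U where "U = A + scale_op \<i> S"
    have U: "U \<in> commutant M" unfolding U_def by (intro C.add_in A commutant_scale_op S)
    have Sb: "S \<in> bounded_ops" "A \<in> bounded_ops" using S A by (auto simp: commutant_bounded_ops)
    have rU: "radj U = A + scale_op (- \<i>) S"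
      by (simp add: U_def radj_add radj_scale_op Sb S A)
    have AS: "A (S v) = S (A v)" for v using S(4) by (metis blinfun_apply_blinfun_compose)
    have SS: "S (S v) = v - A (A v)" for v
      using arg_cong[OF S(3), of "\<lambda>X. blinfun_apply X v"] by (simp add: blinfun.bilinear_simps)
    have "radj U o\<^sub>L U = id_blinfun" "U o\<^sub>L radj U = id_blinfun"
      by (rule blinfun_eqI,
        simp add: rU, simp add: U_def blinfun.bilinear_simps scale_op_apply scaleC_add_right scaleC_scaleC
          bounded_opsD[OF Sb(1)] bounded_opsD[OF Sb(2)] AS SS
          scaleC_minus1 scaleC_minus_right scaleC_diff_right algebra_simps scaleC_add_left[symmetric])+
    then have "unitary U"
      unfolding unitary_def using U by (simp add: adj_eq_radj commutant_bounded_ops)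
    then have c1: "T (U x) = U (T x)" and c2: "T (radj U x) = radj U (T x)"
      using comm U unitary_radj(1) C.radj_in by auto
    have "U v + radj U v = 2 *\<^sub>R A v" for v
      by (simp add: rU) (simp add: U_def blinfun.bilinear_simps scale_op_apply scaleR_2
          scaleC_add_left[symmetric])
    then have "T (2 *\<^sub>R A x) = 2 *\<^sub>R A (T x)"
      using c1 c2 by (metis blinfun.add_right)
    then show ?thesis by (simp add: blinfun.bilinear_simps)
  qed
  have sa: "T (A x) = A (T x)" if A: "A \<in> commutant M" "radj A = A" for A x
  proof -
    define c where "c = 1 / (norm A + 1)"
    have "0 < norm A + 1" by (simp add: add_nonneg_pos)
    then have c: "0 < c" "norm (c *\<^sub>R A) \<le> 1" by (auto simp: c_def)
    have "T ((c *\<^sub>R A) x) = (c *\<^sub>R A) (T x)"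
      by (rule sa1) (use A c in \<open>auto simp: C.scaleR_in radj_scaleR\<close>)
    then show ?thesis using c by (simp add: blinfun.bilinear_simps)
  qed
  fix Z x assume Z: "Z \<in> commutant M"
  have Zb: "Z \<in> bounded_ops" "radj Z \<in> bounded_ops"
    using Z by (auto simp: commutant_bounded_ops radj_bounded_ops)
  \<comment> \<open>Twice the real part of Z; together with Z2 it gives 2 Z = Z1 - i Z2 with both
    summands built from self-adjoint elements.\<close>
  define Z1 where "Z1 = Z + radj Z"
  define Z2 where "Z2 = scale_op \<i> (Z - radj Z)"
  have Z1: "Z1 \<in> commutant M" "radj Z1 = Z1"
    unfolding Z1_def by (auto intro!: C.add_in C.radj_in Z simp: radj_add add.commute)
  have "Z - radj Z \<in> bounded_ops" using Zb
    by (simp add: bounded_ops_def blinfun.bilinear_simps scaleC_diff_right)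
  then have "radj Z2 = scale_op (- \<i>) (radj Z - Z)"
    by (simp add: Z2_def radj_scale_op radj_diff)
  also have "\<dots> = Z2"
    by (rule blinfun_eqI)
      (simp add: Z2_def scale_op_apply blinfun.bilinear_simps scaleC_diff_right scaleC_minus_left)
  finally have Z2: "Z2 \<in> commutant M" "radj Z2 = Z2"
    unfolding Z2_def by (auto intro!: commutant_scale_op C.diff_in C.radj_in Z)
  have ZZ: "2 *\<^sub>R Z v = Z1 v + (- \<i>) *\<^sub>C Z2 v" for v
    by (simp add: Z1_def Z2_def scale_op_apply blinfun.bilinear_simps scaleC_scaleC scaleR_2)
  have "2 *\<^sub>R T (Z x) = T (2 *\<^sub>R Z x)" by (simp add: blinfun.bilinear_simps)
  also have "\<dots> = Z1 (T x) + (- \<i>) *\<^sub>C Z2 (T x)"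
    unfolding ZZ by (simp add: blinfun.bilinear_simps bounded_opsD[OF T] sa Z1 Z2)
  also have "\<dots> = 2 *\<^sub>R Z (T x)" by (simp add: ZZ)
  finally show "T (Z x) = Z (T x)" by simp
qed

end

section \<open>Graphs of unbounded operators\<close>

lemma in_graph_iff: "(x, y) \<in> Map.graph T \<longleftrightarrow> T x = Some y"
  by (simp add: Map.graph_def)

lemma pair_set_eqI: "(\<And>x y. (x, y) \<in> S \<longleftrightarrow> (x, y) \<in> T) \<Longrightarrow> S = T"
  by auto

lemma graph_inject: "Map.graph S = Map.graph T \<longleftrightarrow> S = T"
proof
  assume g: "Map.graph S = Map.graph T"
  have "S x = T x" for x
    using g in_graph_iff[of x _ S] in_graph_iff[of x _ T] by (metis not_Some_eq)
  then show "S = T" by (rule ext)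
qed simp

text \<open>Pairs are treated as a real Hilbert space, so invariance under complex scalars is
  spelled out on the components.\<close>

definition csubspace :: "('a::chilbert_space \<times> 'a) set \<Rightarrow> bool"
  where "csubspace V \<longleftrightarrow> 0 \<in> V \<and> (\<forall>u\<in>V. \<forall>v\<in>V. u + v \<in> V) \<and>
    (\<forall>c x y. (x, y) \<in> V \<longrightarrow> (c *\<^sub>C x, c *\<^sub>C y) \<in> V)"

lemma csubspace_imp_subspace: "csubspace V \<Longrightarrow> subspace V"
  by (auto simp: csubspace_def subspace_def scaleR_scaleC zero_prod_def)

lemma unbounded_op_iff_csubspace: "unbounded_op T \<longleftrightarrow> csubspace (Map.graph T)"
proof
  assume T: "unbounded_op T"
  then obtain z where z: "T 0 = Some z" unfolding unbounded_op_def by blast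
  have "T (0 *\<^sub>C 0) = Some (0 *\<^sub>C the (T 0))" using T z unfolding unbounded_op_def by blast
  then have "T 0 = Some 0" by simp
  moreover have "T (x + x') = Some (y + y')" if "T x = Some y" "T x' = Some y'" for x x' y y'
    using T that unfolding unbounded_op_def by (metis domI option.sel)
  moreover have "T (c *\<^sub>C x) = Some (c *\<^sub>C y)" if "T x = Some y" for c x y
    using T that unfolding unbounded_op_def by (metis domI option.sel)
  ultimately show "csubspace (Map.graph T)"
    by (auto simp: csubspace_def in_graph_iff zero_prod_def)
next
  assume "csubspace (Map.graph T)"
  then show "unbounded_op T"
    unfolding unbounded_op_def csubspace_def zero_prod_def
    by (auto simp: in_graph_iff dom_def) (metis in_graph_iff add_Pair)
qed

lemma ex_op_of_csubspace:
  assumes "csubspace V" "\<And>y. (0, y) \<in> V \<Longrightarrow> y = 0"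
  obtains T where "unbounded_op T" "Map.graph T = V"
proof -
  define T where "T x = (if \<exists>y. (x, y) \<in> V then Some (SOME y. (x, y) \<in> V) else None)" for x
  have uniq: "y = y'" if "(x, y) \<in> V" "(x, y') \<in> V" for x y y'
    using subspace_diff[OF csubspace_imp_subspace[OF assms(1)] that] assms(2)[of "y - y'"] by simp
  have "T x = Some y \<longleftrightarrow> (x, y) \<in> V" for x y
    unfolding T_def using uniq someI[of "\<lambda>y. (x, y) \<in> V"] by auto
  then have "Map.graph T = V" by (auto simp: Map.graph_def)
  then show ?thesis using that assms(1) unbounded_op_iff_csubspace by metis
qed

lemma closure_op_eqI: "Map.graph S = closure (Map.graph T) \<Longrightarrow> closure_op T = S"
  unfolding closure_op_def by (rule the_equality) (auto simp: graph_inject[symmetric])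

lemma graph_closure_op:
  assumes "preclosed_op T"
  shows "unbounded_op (closure_op T)" "Map.graph (closure_op T) = closure (Map.graph T)"
  using assms closure_op_eqI unfolding preclosed_op_def by auto

lemma closed_op_imp_preclosed:
  assumes "closed_op T"
  shows "preclosed_op T" "closure_op T = T"
  using assms closure_op_eqI[of T T] unfolding preclosed_op_def closed_op_def
  by (auto simp: closure_closed)

section \<open>Quotients and the graphs of their sums, products and adjoints\<close>

lemma quot_eq_Some_iff:
  assumes "null B \<subseteq> null A"
  shows "quot A B y = Some z \<longleftrightarrow> (\<exists>x. y = B x \<and> z = A x)"
proof -
  have uniq: "A x = A x'" if "B x = B x'" for x x'
  proof -
    have "x - x' \<in> null B" using that by (simp add: null_def blinfun.diff_right)
    then have "x - x' \<in> null A" using assms by blast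
    then show ?thesis by (simp add: null_def blinfun.diff_right)
  qed
  have "(THE z. \<exists>x'. B x = B x' \<and> z = A x') = A x" for x
    by (rule the_equality) (auto dest: uniq)
  then show ?thesis unfolding quot_def by auto
qed

lemma graph_quot:
  assumes "null B \<subseteq> null A"
  shows "Map.graph (quot A B) = range (blinfun_apply (opmat B 0 A 0))"
proof -
  have "(y, z) \<in> Map.graph (quot A B) \<longleftrightarrow> (y, z) \<in> range (blinfun_apply (opmat B 0 A 0))" for y z
    by (auto simp: in_graph_iff quot_eq_Some_iff[OF assms] opmat_apply image_iff)
  then show ?thesis by auto
qed

lemma dom_quot: "dom (quot A B) = range (blinfun_apply B)"
  by (auto simp: quot_def dom_def split: if_splits)

text \<open>Complex scaling of pairs is a diagonal matrix, which commutes with every matrix of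
  complex-linear entries.\<close>

lemma csubspace_range:
  assumes "Z \<in> mats bounded_ops"
  shows "csubspace (range (blinfun_apply Z))"
  unfolding csubspace_def
proof (intro conjI ballI allI impI)
  show "0 \<in> range (blinfun_apply Z)"
    using subspace_range_blinfun[of Z] subspace_0 by blast
  show "u + v \<in> range (blinfun_apply Z)" if "u \<in> range (blinfun_apply Z)" "v \<in> range (blinfun_apply Z)" for u v
    using that subspace_range_blinfun[of Z] subspace_add by blast
  fix c x y assume "(x, y) \<in> range (blinfun_apply Z)"
  then obtain u where u: "(x, y) = Z u" by blast
  define D :: "('a \<times> 'a) \<Rightarrow>\<^sub>L ('a \<times> 'a)"
    where "D = opmat (scale_op c id_blinfun) 0 0 (scale_op c id_blinfun)"
  have "Z o\<^sub>L D = D o\<^sub>L Z"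
  proof (rule ent_ext)
    have "scale_op c id_blinfun o\<^sub>L ent i j Z = ent i j Z o\<^sub>L scale_op c id_blinfun" for i j
      using assms by (intro blinfun_eqI) (simp add: mats_def scale_op_apply bounded_opsD)
    then show "ent i j (Z o\<^sub>L D) = ent i j (D o\<^sub>L Z)" for i j
      by (cases i; cases j) (simp_all add: ent_comp D_def)
  qed
  from arg_cong[OF this, of "\<lambda>X. blinfun_apply X u"] have "Z (D u) = D (x, y)"
    by (simp add: u)
  also have "\<dots> = (c *\<^sub>C x, c *\<^sub>C y)" by (simp add: D_def opmat_apply scale_op_apply)
  finally show "(c *\<^sub>C x, c *\<^sub>C y) \<in> range (blinfun_apply Z)" by (metis rangeI)
qed

lemma csubspace_closure:
  assumes "csubspace V"
  shows "csubspace (closure V)"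
  unfolding csubspace_def
proof (intro conjI ballI allI impI)
  note sub = subspace_closure[OF csubspace_imp_subspace[OF assms]]
  show "0 \<in> closure V" by (rule subspace_0[OF sub])
  show "u + v \<in> closure V" if "u \<in> closure V" "v \<in> closure V" for u v
    by (rule subspace_add[OF sub that])
  fix c x y assume "(x, y) \<in> closure V"
  then obtain w where w: "\<forall>n. w n \<in> V" "w \<longlonglongrightarrow> (x, y)" unfolding closure_sequential by blast
  have "(\<lambda>n. (c *\<^sub>C fst (w n), c *\<^sub>C snd (w n))) \<longlonglongrightarrow> (c *\<^sub>C x, c *\<^sub>C y)"
    using bounded_linear.tendsto[OF bounded_linear_scaleC tendsto_fst[OF w(2)], of c]
      bounded_linear.tendsto[OF bounded_linear_scaleC tendsto_snd[OF w(2)], of c]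
    by (simp add: tendsto_Pair)
  moreover have "\<forall>n. (c *\<^sub>C fst (w n), c *\<^sub>C snd (w n)) \<in> V"
    using assms w(1) unfolding csubspace_def by (metis prod.collapse)
  ultimately show "(c *\<^sub>C x, c *\<^sub>C y) \<in> closure V" unfolding closure_sequential
    by (intro exI[of _ "\<lambda>n. (c *\<^sub>C fst (w n), c *\<^sub>C snd (w n))"] conjI)
qed

text \<open>Replaces a closure by the kernel of an operator that belongs to the same algebra, hence
  can be transported by a homomorphism.\<close>

lemma mem_closure_range_iff_nproj: "u \<in> closure (range (blinfun_apply Z)) \<longleftrightarrow> nproj (radj Z) u = 0"
proof
  let ?N = "nproj (radj Z)"
  have sym: "inner (?N x) y = inner x (?N y)" for x y
    using inner_radj_right[of ?N] by (simp add: radj_nproj)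
  show "?N u = 0" if "u \<in> closure (range (blinfun_apply Z))"
  proof -
    have "inner u (?N (?N u)) = 0" using that closure_range_iff apply_nproj by blast
    then show ?thesis using sym[of u "?N u"] by simp
  qed
  show "u \<in> closure (range (blinfun_apply Z))" if "?N u = 0"
    unfolding closure_range_iff
  proof (intro allI impI)
    fix z assume "radj Z z = 0"
    then have "inner u z = inner u (?N z)" by (simp add: nproj_fix)
    also have "\<dots> = 0" using sym[of u z] that by simp
    finally show "inner u z = 0" .
  qed
qed

text \<open>Continuity of a linear functional on the domain is boundedness, so
  \<open>riesz_subspace\<close> supplies the value. The complex equation reduces to the real one
  because the domain is stable under complex scalars.\<close>

lemma op_adj_eq_Some_iff:
  assumes T: "unbounded_op T"
  shows "op_adj T y = Some z \<longleftrightarrow>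
    z \<in> closure (dom T) \<and> (\<forall>x\<in>dom T. inner (the (T x)) y = inner x z)"
proof -
  have T_add: "x + x' \<in> dom T \<and> the (T (x + x')) = the (T x) + the (T x')"
    if "x \<in> dom T" "x' \<in> dom T" for x x'
    using T that unfolding unbounded_op_def by (metis domI option.sel)
  have T_scale: "c *\<^sub>C x \<in> dom T \<and> the (T (c *\<^sub>C x)) = c *\<^sub>C the (T x)" if "x \<in> dom T" for c x
    using T that unfolding unbounded_op_def by (metis domI option.sel)
  have sub: "subspace (dom T)"
    using T T_add T_scale unfolding subspace_def unbounded_op_def by (auto simp: scaleR_scaleC)
  have adj_iff: "(\<forall>x\<in>dom T. cinner (the (T x)) y = cinner x z) \<longleftrightarrow>
      (\<forall>x\<in>dom T. inner (the (T x)) y = inner x z)" for z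
  proof
    show "\<forall>x\<in>dom T. inner (the (T x)) y = inner x z" if "\<forall>x\<in>dom T. cinner (the (T x)) y = cinner x z"
      using that by (simp add: inner_eq_Re_cinner)
    assume r: "\<forall>x\<in>dom T. inner (the (T x)) y = inner x z"
    show "\<forall>x\<in>dom T. cinner (the (T x)) y = cinner x z"
    proof
      fix x assume x: "x \<in> dom T"
      show "cinner (the (T x)) y = cinner x z"
      proof (rule cinner_eqI)
        show "inner (c *\<^sub>C the (T x)) y = inner (c *\<^sub>C x) z" for c
          using bspec[OF r, of "c *\<^sub>C x"] T_scale[OF x, of c] by simp
      qed
    qed
  qed
  let ?P = "\<lambda>z. z \<in> closure (dom T) \<and> (\<forall>x\<in>dom T. inner (the (T x)) y = inner x z)"
  have uniq: "z = z'" if "?P z" "?P z'" for z z'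
  proof -
    have "closed {x. inner x (z - z') = 0}" by (intro closed_Collect_eq continuous_intros)
    moreover have "dom T \<subseteq> {x. inner x (z - z') = 0}"
    proof
      fix x assume "x \<in> dom T"
      then have "inner (the (T x)) y = inner x z" "inner (the (T x)) y = inner x z'"
        using that by blast+
      then show "x \<in> {x. inner x (z - z') = 0}" by (simp add: inner_diff_right)
    qed
    ultimately have "closure (dom T) \<subseteq> {x. inner x (z - z') = 0}" using closure_minimal by blast
    moreover have "z - z' \<in> closure (dom T)"
      using that subspace_diff[OF subspace_closure[OF sub]] by blast
    ultimately have "inner (z - z') (z - z') = 0" by blast
    then show ?thesis by simp
  qed
  have cont_iff: "continuous_on (dom T) (\<lambda>x. cinner (the (T x)) y) \<longleftrightarrow> (\<exists>z. ?P z)"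
  proof
    assume "\<exists>z. ?P z"
    then obtain z where z: "\<forall>x\<in>dom T. cinner (the (T x)) y = cinner x z" using adj_iff by blast
    have "cinner x z = complex_of_real (inner x z) + \<i> * complex_of_real (inner (- \<i> *\<^sub>C x) z)" for x
      by (intro complex_eqI) (simp_all add: Im_cinner inner_eq_Re_cinner)
    moreover have "continuous_on (dom T) (\<lambda>x. complex_of_real (inner x z) +
        \<i> * complex_of_real (inner (- \<i> *\<^sub>C x) z))"
      by (intro continuous_intros bounded_linear.continuous_on[OF bounded_linear_scaleC])
    ultimately have "continuous_on (dom T) (\<lambda>x. cinner x z)" by simp
    then show "continuous_on (dom T) (\<lambda>x. cinner (the (T x)) y)"
      using z by (simp cong: continuous_on_cong)
  next
    assume cont: "continuous_on (dom T) (\<lambda>x. cinner (the (T x)) y)"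
    define f where "f x = inner (the (T x)) y" for x
    have f: "f (x + x') = f x + f x'" "f (r *\<^sub>R x) = r * f x" if "x \<in> dom T" "x' \<in> dom T" for x x' r
      using T_add[OF that] T_scale[OF that(1), of "of_real r"]
      by (simp_all add: f_def inner_add_left scaleR_scaleC[symmetric])
    have "continuous_on (dom T) f"
      using continuous_on_Re[OF cont] by (simp add: f_def inner_eq_Re_cinner[abs_def])
    moreover have T0: "0 \<in> dom T" using sub by (rule subspace_0)
    ultimately obtain \<delta> where \<delta>: "0 < \<delta>" "\<And>x. x \<in> dom T \<Longrightarrow> dist x 0 < \<delta> \<Longrightarrow> dist (f x) (f 0) < 1"
      unfolding continuous_on_iff by (metis zero_less_one)
    have f0: "f 0 = 0" using f(2)[OF T0 T0, of 0] by simp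
    have "\<bar>f x\<bar> \<le> (2 / \<delta>) * norm x" if x: "x \<in> dom T" for x
    proof (cases "x = 0")
      case False
      \<comment> \<open>Scales x to length \<delta>/2, where f is below 1 in absolute value; this
        yields the bound 2 / \<delta>.\<close>
      define r where "r = \<delta> / (2 * norm x)"
      have "dist (r *\<^sub>R x) 0 < \<delta>" using \<delta>(1) False by (simp add: r_def)
      moreover have "r *\<^sub>R x \<in> dom T" using sub x by (rule subspace_scale)
      ultimately have "\<bar>f (r *\<^sub>R x)\<bar> < 1" using \<delta>(2) f0 by fastforce
      then have "r * \<bar>f x\<bar> < 1" using f(2)[OF x x, of r] \<delta>(1) by (simp add: abs_mult r_def)
      then show ?thesis using \<delta>(1) False by (simp add: r_def field_simps)
    qed (simp add: f0)
    then obtain z where "z \<in> closure (dom T)" "\<And>x. x \<in> dom T \<Longrightarrow> f x = inner x z"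
      using riesz_subspace[OF sub, of f "2 / \<delta>"] f by metis
    then show "\<exists>z. ?P z" unfolding f_def by blast
  qed
  have the_eq: "(THE z. z \<in> closure (dom T) \<and> (\<forall>x\<in>dom T. cinner (the (T x)) y = cinner x z)) = z"
    if "?P z" for z
    unfolding adj_iff by (rule the_equality) (use that uniq in blast)+
  show ?thesis
  proof
    assume "op_adj T y = Some z"
    then have c: "continuous_on (dom T) (\<lambda>x. cinner (the (T x)) y)"
      and "z = (THE z. z \<in> closure (dom T) \<and> (\<forall>x\<in>dom T. cinner (the (T x)) y = cinner x z))"
      unfolding op_adj_def by (auto split: if_splits)
    then show "?P z" using cont_iff the_eq by metis
  next
    assume P: "?P z"
    then have "continuous_on (dom T) (\<lambda>x. cinner (the (T x)) y)" using cont_iff by blast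
    then show "op_adj T y = Some z" using the_eq[OF P] unfolding op_adj_def by simp
  qed
qed

text \<open>A vector lies in both domains iff it is B1 x1 = B2 x2, so the pairs (x1, x2) in question
  form the kernel of the row (B1, -B2), which the projection turns into a range.\<close>

lemma graph_op_plus_quot:
  assumes "null B1 \<subseteq> null A1" "null B2 \<subseteq> null A2"
  shows "Map.graph (op_plus (quot A1 B1) (quot A2 B2)) =
    range (blinfun_apply (opmat B1 0 A1 A2 o\<^sub>L nproj (opmat B1 (- B2) 0 0)))"
proof -
  let ?X = "opmat B1 (- B2) 0 0"
  have "range (blinfun_apply (opmat B1 0 A1 A2 o\<^sub>L nproj ?X)) = blinfun_apply (opmat B1 0 A1 A2) ` {u. ?X u = 0}"
    unfolding range_nproj[symmetric] by auto
  also have "\<dots> = Map.graph (op_plus (quot A1 B1) (quot A2 B2))"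
  proof -
    have l: "(y, z) \<in> blinfun_apply (opmat B1 0 A1 A2) ` {u. ?X u = 0} \<longleftrightarrow>
        (\<exists>x1 x2. y = B1 x1 \<and> z = A1 x1 + A2 x2 \<and> B1 x1 = B2 x2)" for y z
      unfolding image_iff Bex_def split_paired_Ex
      by (auto simp: opmat_apply blinfun.bilinear_simps zero_prod_def)
    have s1: "quot A1 B1 (B1 x) = Some (A1 x)" for x using quot_eq_Some_iff[OF assms(1)] by blast
    have s2: "quot A2 B2 (B2 x) = Some (A2 x)" for x using quot_eq_Some_iff[OF assms(2)] by blast
    have "(y, z) \<in> Map.graph (op_plus (quot A1 B1) (quot A2 B2)) \<longleftrightarrow>
        (\<exists>x1 x2. y = B1 x1 \<and> z = A1 x1 + A2 x2 \<and> B1 x1 = B2 x2)" for y z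
    proof
      assume "(y, z) \<in> Map.graph (op_plus (quot A1 B1) (quot A2 B2))"
      then have *: "y \<in> range B1" "y \<in> range B2" "z = the (quot A1 B1 y) + the (quot A2 B2 y)"
        unfolding in_graph_iff op_plus_def dom_quot by (auto split: if_splits)
      then obtain x1 x2 where "y = B1 x1" "y = B2 x2" by blast
      then show "\<exists>x1 x2. y = B1 x1 \<and> z = A1 x1 + A2 x2 \<and> B1 x1 = B2 x2"
        using * s1 s2 by (metis option.sel)
    next
      assume "\<exists>x1 x2. y = B1 x1 \<and> z = A1 x1 + A2 x2 \<and> B1 x1 = B2 x2"
      then obtain x1 x2 where x: "y = B1 x1" "z = A1 x1 + A2 x2" "y = B2 x2" by metis
      then have "quot A1 B1 y = Some (A1 x1)" "quot A2 B2 y = Some (A2 x2)"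
        using s1[of x1] s2[of x2] by simp_all
      then show "(y, z) \<in> Map.graph (op_plus (quot A1 B1) (quot A2 B2))"
        using x(2) unfolding in_graph_iff op_plus_def by auto
    qed
    with l show ?thesis by (intro pair_set_eqI) (simp only:)
  qed
  finally show ?thesis by (rule sym)
qed

text \<open>Composability of A1/B1 after A2/B2 at B2 x2 means A2 x2 = B1 x1 for some x1. Here x1 is
  the first coordinate, so the input B2 x2 is read from the second.\<close>

lemma graph_map_comp_quot:
  assumes "null B1 \<subseteq> null A1" "null B2 \<subseteq> null A2"
  shows "Map.graph (quot A1 B1 \<circ>\<^sub>m quot A2 B2) =
    range (blinfun_apply (opmat 0 B2 A1 0 o\<^sub>L nproj (opmat (- B1) A2 0 0)))"
proof -
  let ?X = "opmat (- B1) A2 0 0"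
  have "range (blinfun_apply (opmat 0 B2 A1 0 o\<^sub>L nproj ?X)) = blinfun_apply (opmat 0 B2 A1 0) ` {u. ?X u = 0}"
    unfolding range_nproj[symmetric] by auto
  also have "\<dots> = Map.graph (quot A1 B1 \<circ>\<^sub>m quot A2 B2)"
  proof -
    have l: "(y, z) \<in> blinfun_apply (opmat 0 B2 A1 0) ` {u. ?X u = 0} \<longleftrightarrow>
        (\<exists>x1 x2. y = B2 x2 \<and> z = A1 x1 \<and> A2 x2 = B1 x1)" for y z
      unfolding image_iff Bex_def split_paired_Ex
      by (auto simp: opmat_apply blinfun.bilinear_simps zero_prod_def)
    have "(y, z) \<in> Map.graph (quot A1 B1 \<circ>\<^sub>m quot A2 B2) \<longleftrightarrow>
        (\<exists>x1 x2. y = B2 x2 \<and> z = A1 x1 \<and> A2 x2 = B1 x1)" for y z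
      unfolding in_graph_iff map_comp_Some_iff quot_eq_Some_iff[OF assms(1)] quot_eq_Some_iff[OF assms(2)]
      by auto
    with l show ?thesis by (intro pair_set_eqI) (simp only:)
  qed
  finally show ?thesis by (rule sym)
qed

lemma unbounded_op_quot:
  assumes "A \<in> bounded_ops" "B \<in> bounded_ops" "null B \<subseteq> null A"
  shows "unbounded_op (quot A B)"
proof -
  have "0 \<in> (bounded_ops :: ('a \<Rightarrow>\<^sub>L 'a) set)" by (simp add: bounded_ops_def)
  then show ?thesis
    unfolding unbounded_op_iff_csubspace graph_quot[OF assms(3)]
    by (intro csubspace_range opmat_in_mats assms)
qed

text \<open>The first row of the matrix encodes radj A y = radj B z. The second row forces z into
  the closure of the domain, which singles out the value when the domain is not dense. Being a
  kernel, the graph is closed.\<close>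

lemma graph_op_adj_quot:
  assumes "A \<in> bounded_ops" "B \<in> bounded_ops" "null B \<subseteq> null A"
  shows "Map.graph (op_adj (quot A B)) =
    range (blinfun_apply (nproj (opmat (radj A) (- radj B) 0 (nproj (radj B)))))"
proof -
  have "(y, z) \<in> Map.graph (op_adj (quot A B)) \<longleftrightarrow>
      z \<in> closure (range B) \<and> (\<forall>x. inner (A x) y = inner (B x) z)" for y z
  proof -
    have "the (quot A B (B x)) = A x" for x
      using quot_eq_Some_iff[OF assms(3), of "B x" "A x"] by auto
    then show ?thesis
      unfolding in_graph_iff op_adj_eq_Some_iff[OF unbounded_op_quot[OF assms]] dom_quot by auto
  qed
  also have "\<dots> y z \<longleftrightarrow> nproj (radj B) z = 0 \<and> radj A y = radj B z" for y z
    unfolding mem_closure_range_iff_nproj inner_radj_right by (metis inner_ext)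
  finally have "(y, z) \<in> Map.graph (op_adj (quot A B)) \<longleftrightarrow>
      opmat (radj A) (- radj B) 0 (nproj (radj B)) (y, z) = 0" for y z
    by (auto simp: opmat_apply blinfun.bilinear_simps zero_prod_def)
  then show ?thesis unfolding range_nproj by auto
qed

section \<open>Affiliated operators as quotients\<close>

lemma orth_projection:
  fixes V :: "'a::{real_inner,banach} set"
  assumes V: "subspace V" "closed V"
  obtains P where "radj P = P" "\<And>u. blinfun_apply P u \<in> V" "\<And>u. u \<in> V \<Longrightarrow> P u = u"
proof -
  have "\<exists>p\<in>V. \<forall>x\<in>V. inner x (w - p) = 0" for w
    by (rule closed_subspace_projection[OF V, of w]) blast
  then obtain f where f: "\<And>w. f w \<in> V" "\<And>w x. x \<in> V \<Longrightarrow> inner x (w - f w) = 0" by metis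
  have uniq: "f w = p" if "p \<in> V" "\<And>x. x \<in> V \<Longrightarrow> inner x (w - p) = 0" for w p
  proof -
    have d: "f w - p \<in> V" using f that V by (simp add: subspace_diff)
    have "inner (f w - p) (f w - p) = inner (f w - p) (w - p) - inner (f w - p) (w - f w)"
      by (simp add: inner_diff_right)
    also have "\<dots> = 0" using f(2)[OF d] that(2)[OF d] by simp
    finally show ?thesis by simp
  qed
  have "bounded_linear f"
  proof (rule bounded_linear_intro[where K = 1])
    show "f (x + y) = f x + f y" for x y
      using f(2)[of _ x] f(2)[of _ y]
      by (intro uniq) (auto simp: f V subspace_add inner_diff_right inner_add_right)
    show "f (r *\<^sub>R x) = r *\<^sub>R f x" for r x
      using f(2)[of _ x]
      by (intro uniq) (auto simp: f V subspace_scale inner_diff_right)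
    show "norm (f x) \<le> norm x * 1" for x
    proof -
      have "inner (f x) (f x) = inner (f x) x" using f(2)[OF f(1), of x x] by (simp add: inner_diff_right)
      also have "\<dots> \<le> norm (f x) * norm x" by (rule norm_cauchy_schwarz)
      finally have "norm (f x) * norm (f x) \<le> norm (f x) * norm x"
        by (simp add: power2_norm_eq_inner[symmetric] power2_eq_square)
      then show ?thesis by (cases "f x = 0") auto
    qed
  qed
  then have P: "Blinfun f u = f u" for u by (rule bounded_linear_Blinfun_apply[THEN fun_cong])
  have "inner (f x) y = inner x (f y)" for x y
    using f(2)[OF f(1), of x y] f(2)[OF f(1), of y x]
    by (simp add: inner_diff_right inner_commute)
  then have "radj (Blinfun f) = Blinfun f" by (intro radj_unique) (simp add: P)
  moreover have "f u = u" if "u \<in> V" for u using that by (intro uniq) auto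
  ultimately show ?thesis using that[of "Blinfun f"] f(1) by (simp add: P)
qed

text \<open>Invariance of V under D gives P D P = D P, and invariance under \<open>radj D\<close>
  gives P D P = P D after taking adjoints.\<close>

lemma projection_commutes:
  assumes P: "radj P = P" "\<And>u. blinfun_apply P u \<in> V" "\<And>u. u \<in> V \<Longrightarrow> blinfun_apply P u = u"
    and D: "\<And>u. u \<in> V \<Longrightarrow> blinfun_apply D u \<in> V" "\<And>u. u \<in> V \<Longrightarrow> radj D u \<in> V"
  shows "P (D u) = D (P u)"
proof -
  have 1: "P o\<^sub>L D o\<^sub>L P = D o\<^sub>L P" and "P o\<^sub>L radj D o\<^sub>L P = radj D o\<^sub>L P"
    by (auto intro!: blinfun_eqI P D)
  then have "radj (P o\<^sub>L radj D o\<^sub>L P) = radj (radj D o\<^sub>L P)" by simp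
  then have "P o\<^sub>L D o\<^sub>L P = P o\<^sub>L D" by (simp add: radj_compose P(1) blinfun_compose_assoc)
  with 1 have "P o\<^sub>L D = D o\<^sub>L P" by simp
  from arg_cong[OF this, of "\<lambda>X. blinfun_apply X u"] show ?thesis by simp
qed

context vn_alg
begin

lemma commutant_radj: "Z \<in> commutant M \<Longrightarrow> radj Z \<in> commutant M"
  using op_alg.radj_in[OF op_alg_commutant] by blast

lemma aff_MvN_commutes:
  assumes T: "T \<in> aff_MvN M" and U: "U \<in> commutant M" "unitary U"
    and Tx: "T x = Some y"
  shows "T (U x) = Some (U y)"
proof -
  have "(op_of (adj U) \<circ>\<^sub>m T \<circ>\<^sub>m op_of U) x = Some y"
    using T U Tx unfolding aff_MvN_def by simp
  then obtain y' where y': "T (U x) = Some y'" "y = adj U y'"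
    by (auto simp: op_of_def map_comp_Some_iff)
  have "U (adj U y') = y'"
    using U(2) unfolding unitary_def by (metis blinfun_apply_blinfun_compose blinfun_apply_id_blinfun)
  then show ?thesis using y' by simp
qed

text \<open>One inclusion for all unitaries is enough: the inverse \<open>radj U\<close> is again a
  unitary of the commutant and gives the other.\<close>

lemma aff_MvN_intro:
  assumes T: "closed_op T"
    and comm: "\<And>U x y. U \<in> commutant M \<Longrightarrow> unitary U \<Longrightarrow> T x = Some y \<Longrightarrow> T (U x) = Some (U y)"
  shows "T \<in> aff_MvN M"
proof -
  have "op_of (adj U) \<circ>\<^sub>m T \<circ>\<^sub>m op_of U = T" if U: "U \<in> commutant M" "unitary U" for U
  proof
    fix x
    have adj: "adj U = radj U" using U(1) by (simp add: adj_eq_radj commutant_bounded_ops)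
    have UU: "radj U (U v) = v" for v
      using unitary_radj(2)[OF U(2)] by (metis blinfun_apply_blinfun_compose blinfun_apply_id_blinfun)
    have inverse: "T x = Some (radj U z)" if "T (U x) = Some z" for z
      using comm[OF commutant_radj[OF U(1)] unitary_radj(1)[OF U(2)] that] by (simp add: UU)
    show "(op_of (adj U) \<circ>\<^sub>m T \<circ>\<^sub>m op_of U) x = T x"
    proof (cases "T (U x)")
      case None
      then have "T x = None" using comm[OF U] by (metis not_Some_eq)
      then show ?thesis using None by (simp add: op_of_def map_comp_def)
    next
      case (Some z)
      then show ?thesis using inverse[OF Some] by (simp add: op_of_def map_comp_def adj)
    qed
  qed
  then show ?thesis using T by (simp add: aff_MvN_def)
qed

text \<open>The diagonal matrix of U commutes with Z, so its adjoint preserves the kernel of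
  \<open>radj Z\<close> and it preserves the closure of the range.\<close>

lemma aff_MvN_of_range:
  assumes T: "unbounded_op T" and Z: "Z \<in> mats M"
    and graph: "Map.graph T = closure (range (blinfun_apply Z))"
  shows "T \<in> aff_MvN M"
proof (rule aff_MvN_intro)
  show "closed_op T" using T graph by (simp add: closed_op_def)
  fix U x y assume U: "U \<in> commutant M" and Tx: "T x = Some y"
  define D where "D = opmat U 0 0 U"
  have comm: "radj D (radj Z v) = radj Z (radj D v)" for v
  proof -
    have "Z o\<^sub>L D = D o\<^sub>L Z"
    proof (rule ent_ext)
      have "U o\<^sub>L ent i j Z = ent i j Z o\<^sub>L U" for i j
      proof (rule blinfun_eqI)
        have "ent i j Z \<in> M" using Z by (simp add: mats_def)
        then show "(U o\<^sub>L ent i j Z) v = (ent i j Z o\<^sub>L U) v" for v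
          using commutantD[OF U] by simp
      qed
      then show "ent i j (Z o\<^sub>L D) = ent i j (D o\<^sub>L Z)" for i j
        by (cases i; cases j) (simp_all add: ent_comp D_def)
    qed
    then have "radj D o\<^sub>L radj Z = radj Z o\<^sub>L radj D" by (metis radj_compose)
    from arg_cong[OF this, of "\<lambda>X. blinfun_apply X v"] show ?thesis by simp
  qed
  have "(x, y) \<in> closure (range (blinfun_apply Z))" using Tx graph by (simp add: in_graph_iff[symmetric])
  then have "D (x, y) \<in> closure (range (blinfun_apply Z))"
    unfolding closure_range_iff
    by (metis blinfun.zero_right comm inner_radj_right)
  then show "T (U x) = Some (U y)"
    unfolding graph[symmetric] D_def by (simp add: opmat_apply in_graph_iff)
qed

lemma quot_in_aff_MvN:
  assumes "A \<in> M" "B \<in> M" "null B \<subseteq> null A" "closed (Map.graph (quot A B))"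
  shows "quot A B \<in> aff_MvN M"
proof (rule aff_MvN_of_range[of _ "opmat B 0 A 0"])
  show "unbounded_op (quot A B)" using assms by (intro unbounded_op_quot sub_bounded_ops)
  show "opmat B 0 A 0 \<in> mats M" using assms by (intro opmat_in_mats zero_in)
  show "Map.graph (quot A B) = closure (range (blinfun_apply (opmat B 0 A 0)))"
    using assms(3,4) by (simp add: graph_quot closure_closed)
qed

text \<open>
  If \<open>P\<close> is the projection onto the graph of \<open>T\<close>, then \<open>T = A/B\<close> for \<open>B = P\<^sub>1\<^sub>1\<^bsup>1/2\<^esup>\<close> and \<open>A = T B\<close>: the map
  \<open>B u \<mapsto> P (u, 0)\<close> is isometric because \<open>\<parallel>P (u, 0)\<parallel>\<^sup>2 = \<langle>P\<^sub>1\<^sub>1 u, u\<rangle> = \<parallel>B u\<parallel>\<^sup>2\<close>.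
\<close>

lemma aff_MvN_quot:
  assumes T: "T \<in> aff_MvN M"
  obtains A B where "A \<in> M" "B \<in> M" "null B \<subseteq> null A" "T = quot A B"
proof -
  define V where "V = Map.graph T"
  have csub: "csubspace V" and closed: "closed V"
    using T unfolding aff_MvN_def closed_op_def V_def by (auto simp: unbounded_op_iff_csubspace)
  have sub: "subspace V" by (rule csubspace_imp_subspace[OF csub])
  have V_iff: "(x, y) \<in> V \<longleftrightarrow> T x = Some y" for x y by (simp add: V_def in_graph_iff)
  have T0: "T 0 = Some 0" using subspace_0[OF sub] by (simp add: zero_prod_def V_iff)
  obtain P where P: "radj P = P" "\<And>u. blinfun_apply P u \<in> V" "\<And>u. u \<in> V \<Longrightarrow> P u = u"
    using orth_projection[OF sub closed] by blast
  have P_sym: "inner (P u) v = inner u (P v)" for u v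
    using inner_radj_right[of P] P(1) by simp
  have P_form: "inner (P u) u = (norm (P u))\<^sup>2" for u
    using P_sym[of "P u" u] P(3)[OF P(2)] by (simp add: power2_norm_eq_inner inner_commute)
  have P_norm: "(norm (P u))\<^sup>2 \<le> (norm u)\<^sup>2" for u
  proof -
    have "(norm (P u))\<^sup>2 \<le> norm (P u) * norm u"
      unfolding P_form[symmetric] by (rule norm_cauchy_schwarz)
    then have "norm (P u) \<le> norm u" by (cases "P u = 0") (auto simp: power2_eq_square)
    then show ?thesis by (simp add: power_mono)
  qed
  \<comment> \<open>Scaling by c and its adjoint, scaling by the conjugate, both leave V invariant.
    Hence the corner K of P is complex-linear.\<close>
  have P_scale: "P (c *\<^sub>C x, c *\<^sub>C y) = (c *\<^sub>C fst (P (x, y)), c *\<^sub>C snd (P (x, y)))" for c x y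
  proof -
    define D :: "('a \<times> 'a) \<Rightarrow>\<^sub>L ('a \<times> 'a)"
      where "D = opmat (scale_op c id_blinfun) 0 0 (scale_op c id_blinfun)"
    have D: "D u = (c *\<^sub>C fst u, c *\<^sub>C snd u)" for u by (simp add: D_def opmat_apply scale_op_apply)
    have "radj D = opmat (scale_op (cnj c) id_blinfun) 0 0 (scale_op (cnj c) id_blinfun)"
      by (simp add: D_def radj_opmat radj_scale_op bounded_ops_def)
    then have rD: "radj D u = (cnj c *\<^sub>C fst u, cnj c *\<^sub>C snd u)" for u
      by (simp add: opmat_apply scale_op_apply)
    have "P (D u) = D (P u)" for u
    proof (rule projection_commutes[OF P])
      show "D u \<in> V" "radj D u \<in> V" if "u \<in> V" for u
        using csub that unfolding csubspace_def D rD by (metis prod.collapse)+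
    qed
    from this[of "(x, y)"] show ?thesis by (simp add: D)
  qed
  have P_comm: "P (U x, U y) = (U (fst (P (x, y))), U (snd (P (x, y))))"
    if U: "U \<in> commutant M" "unitary U" for U x y
  proof -
    define D where "D = opmat U 0 0 U"
    have D: "D u = (U (fst u), U (snd u))" "radj D u = (radj U (fst u), radj U (snd u))" for u
      by (simp_all add: D_def opmat_apply radj_opmat)
    have "P (D u) = D (P u)" for u
    proof (rule projection_commutes[OF P])
      show "D u \<in> V" if "u \<in> V" for u
        using that aff_MvN_commutes[OF T U] unfolding D by (metis V_iff prod.collapse)
      show "radj D u \<in> V" if "u \<in> V" for u
        using that aff_MvN_commutes[OF T commutant_radj[OF U(1)] unitary_radj(1)[OF U(2)]]
        unfolding D by (metis V_iff prod.collapse)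
    qed
    from this[of "(x, y)"] show ?thesis by (simp add: D)
  qed
  define K where "K = ent False False P"
  have K: "K x = fst (P (x, 0))" for x by (simp add: K_def ent_apply emb_apply)
  have K_form: "inner (K x) x = (norm (P (x, 0)))\<^sup>2" for x
    using P_form[of "(x, 0)"] by (simp add: K inner_prod_def)
  have K_in: "K \<in> M"
  proof (rule in_if_commutes_unitaries)
    show "K \<in> bounded_ops" unfolding bounded_ops_def using P_scale[of _ _ 0] by (simp add: K)
    show "K (U x) = U (K x)" if "U \<in> commutant M" "unitary U" for U x
      using P_comm[OF that, of x 0] by (simp add: K)
  qed
  have rK: "radj K = K" by (simp add: K_def ent_radj[symmetric] P(1))
  have "norm (id_blinfun - K) \<le> 1"
  proof (rule norm_le_1_of_form)
    have form: "inner ((id_blinfun - K) x) x = (norm x)\<^sup>2 - (norm (P (x, 0)))\<^sup>2" for x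
      by (simp add: blinfun.diff_left inner_diff_left K_form power2_norm_eq_inner)
    show "radj (id_blinfun - K) = id_blinfun - K" by (simp add: radj_diff rK)
    show "0 \<le> inner ((id_blinfun - K) x) x" for x
      using P_norm[of "(x, 0)"] by (simp add: form norm_Pair)
    show "inner ((id_blinfun - K) x) x \<le> (norm x)\<^sup>2" for x by (simp add: form)
  qed
  then obtain B where B: "B \<in> M" "radj B = B" "B o\<^sub>L B = id_blinfun - (id_blinfun - K)"
    using sqrt_exists[of "id_blinfun - K"] K_in id_in diff_in by (metis radj_diff radj_id rK)
  have BB: "B (B x) = K x" for x
    using arg_cong[OF B(3), of "\<lambda>X. blinfun_apply X x"] by simp
  have B_sym: "inner (B x) y = inner x (B y)" for x y
    using inner_radj_right[of B] B(2) by simp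
  have iso: "norm (P (u, 0)) = norm (B u)" for u
  proof -
    have "(norm (P (u, 0)))\<^sup>2 = (norm (B u))\<^sup>2"
      using K_form[of u] by (simp add: BB[symmetric] B_sym power2_norm_eq_inner)
    then show ?thesis by (simp add: power2_eq_iff_nonneg)
  qed
  have P_diff: "P (u, 0) - P (v, 0) = P (u - v, 0)" for u v
    by (simp add: blinfun.diff_right[symmetric])
  have ex_a: "\<exists>a. T (B x) = Some a \<and> norm a \<le> norm x" for x
  proof -
    \<comment> \<open>Removing the kernel component of x leaves B x unchanged and puts x - n into
      the closure of the range of the self-adjoint B.\<close>
    define n where "n = nproj B x"
    have Bn: "B n = 0" by (simp add: n_def apply_nproj)
    have perp: "inner (x - n) z = 0" if "B z = 0" for z
    proof -
      have "inner n z = inner x (nproj B z)"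
        using inner_radj_right[of "nproj B" x z] by (simp add: n_def radj_nproj)
      then show ?thesis using nproj_fix[OF that] by (simp add: inner_diff_left)
    qed
    then have "x - n \<in> closure (range (blinfun_apply B))" by (simp add: closure_range_iff B(2))
    then obtain w where w: "\<forall>k. w k \<in> range B" "w \<longlonglongrightarrow> x - n" unfolding closure_sequential by blast
    then have "\<forall>k. \<exists>v. w k = B v" by blast
    then obtain u where u: "\<And>k. w k = B (u k)" by metis
    \<comment> \<open>The isometry B u \<mapsto> P (u, 0) extends to the closure of the range of B,
      with values in the closed set V; its value at x - n is a point of the graph over B x.\<close>
    have "norm (P (u k, 0) - P (u l, 0)) = norm (w k - w l)" for k l
      unfolding P_diff iso u by (simp add: blinfun.diff_right)
    then have "Cauchy (\<lambda>k. P (u k, 0))"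
      using LIMSEQ_imp_Cauchy[OF w(2)] by (simp add: Cauchy_iff)
    then obtain g where g: "(\<lambda>k. P (u k, 0)) \<longlonglongrightarrow> g" using Cauchy_convergent convergent_def by blast
    have "g \<in> V" using closed_sequentially[OF closed _ g] P(2) by simp
    moreover have "fst g = B x"
    proof -
      have "(\<lambda>k. B (w k)) \<longlonglongrightarrow> B (x - n)" by (intro tendsto_intros w)
      moreover have "(\<lambda>k. B (w k)) \<longlonglongrightarrow> fst g"
        using tendsto_fst[OF g] by (simp add: u BB K)
      ultimately have "B (x - n) = fst g" by (rule LIMSEQ_unique)
      then show ?thesis using Bn by (simp add: blinfun.diff_right)
    qed
    moreover have "norm (snd g) \<le> norm x"
    proof -
      have "(\<lambda>k. norm (w k)) \<longlonglongrightarrow> norm g" using tendsto_norm[OF g] by (simp add: iso u)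
      then have "norm g = norm (x - n)" using tendsto_norm[OF w(2)] LIMSEQ_unique by blast
      moreover have "norm (x - n) \<le> norm x"
      proof -
        have "inner (x - n) (x - n) = inner (x - n) x" using perp[OF Bn] by (simp add: inner_diff_right)
        also have "\<dots> \<le> norm (x - n) * norm x" by (rule norm_cauchy_schwarz)
        finally have "norm (x - n) * norm (x - n) \<le> norm (x - n) * norm x"
          by (simp add: power2_norm_eq_inner[symmetric] power2_eq_square)
        then show ?thesis by (cases "x - n = 0") auto
      qed
      ultimately show ?thesis using norm_snd_le[of "snd g" "fst g"] by simp
    qed
    ultimately show ?thesis by (metis V_iff prod.collapse)
  qed
  define a where "a x = the (T (B x))" for x
  have a: "T (B x) = Some (a x)" "norm (a x) \<le> norm x" for x
    using ex_a[of x] by (auto simp: a_def)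
  have a_eqI: "a x = y" if "(B x, y) \<in> V" for x y using that by (simp add: a_def V_iff)
  have "bounded_linear a"
  proof (rule bounded_linear_intro[where K = 1])
    show "a (x + y) = a x + a y" for x y
      using subspace_add[OF sub, of "(B x, a x)" "(B y, a y)"] a
      by (intro a_eqI) (simp add: V_iff blinfun.add_right)
    show "a (r *\<^sub>R x) = r *\<^sub>R a x" for r x
      using subspace_scale[OF sub, of "(B x, a x)" r] a
      by (intro a_eqI) (simp add: V_iff blinfun.scaleR_right)
    show "norm (a x) \<le> norm x * 1" for x using a by simp
  qed
  then have A: "Blinfun a x = a x" for x by (rule bounded_linear_Blinfun_apply[THEN fun_cong])
  have A_in: "Blinfun a \<in> M"
  proof (rule in_if_commutes_unitaries)
    have "a (c *\<^sub>C x) = c *\<^sub>C a x" for c x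
      using csub a(1)[of x] sub_bounded_ops[OF B(1)]
      by (intro a_eqI) (simp add: csubspace_def V_iff bounded_opsD)
    then show "Blinfun a \<in> bounded_ops" by (simp add: bounded_ops_def A)
    show "Blinfun a (U x) = U (Blinfun a x)" if U: "U \<in> commutant M" "unitary U" for U x
      unfolding A
      using aff_MvN_commutes[OF T U a(1)] commutantD[OF U(1) B(1)] by (intro a_eqI) (simp add: V_iff)
  qed
  have null: "null B \<subseteq> null (Blinfun a)"
    using T0 by (auto simp: null_def A a_def)
  have "y \<in> range B" if "T y = Some z" for y z
  proof -
    \<comment> \<open>The vectors P (u, 0) are dense in V because T is single-valued: if v is
      orthogonal to all of them, P v is a point of the graph with first coordinate 0, so P v = 0.
      This shows that the domain of T is no larger than the range of B.\<close>
    define X where "X = P o\<^sub>L emb False"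
    have "inner (y, z) v = 0" if v: "radj X v = 0" for v
    proof -
      have "fst (P v) = 0" using v by (simp add: X_def radj_compose P(1) radj_emb)
      then have "P v = 0" using P(2)[of v] T0 V_iff by (metis option.inject prod.collapse zero_prod_def)
      moreover have "P (y, z) = (y, z)" using P(3) V_iff \<open>T y = Some z\<close> by blast
      ultimately show ?thesis using P_sym[of "(y, z)" v] by simp
    qed
    then have "(y, z) \<in> closure (range (blinfun_apply X))" by (simp add: closure_range_iff)
    then obtain w where w: "\<forall>k. w k \<in> range X" "w \<longlonglongrightarrow> (y, z)" unfolding closure_sequential by blast
    then have "\<forall>k. \<exists>v. w k = X v" by blast
    then obtain u where u: "\<And>k. w k = X (u k)" by metis
    have u': "w k = P (u k, 0)" for k by (simp add: u X_def emb_apply)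
    have "norm (B (u k) - B (u l)) = norm (w k - w l)" for k l
      unfolding u' P_diff iso by (simp add: blinfun.diff_right)
    then have "Cauchy (\<lambda>k. B (u k))" using LIMSEQ_imp_Cauchy[OF w(2)] by (simp add: Cauchy_iff)
    then obtain r where r: "(\<lambda>k. B (u k)) \<longlonglongrightarrow> r" using Cauchy_convergent convergent_def by blast
    have "(\<lambda>k. B (B (u k))) \<longlonglongrightarrow> B r" by (intro tendsto_intros r)
    moreover have "(\<lambda>k. B (B (u k))) \<longlonglongrightarrow> y" using tendsto_fst[OF w(2)] by (simp add: BB K u')
    ultimately show ?thesis using LIMSEQ_unique by blast
  qed
  then have "T y = Some z \<longleftrightarrow> quot (Blinfun a) B y = Some z" for y z
    unfolding quot_eq_Some_iff[OF null] A using a(1) by (metis imageE option.inject)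
  then have "T = quot (Blinfun a) B" by (intro ext) (metis not_Some_eq)
  then show ?thesis using that A_in B(1) null by blast
qed

end

section \<open>The extension of a normal homomorphism\<close>

locale vn_hom = M: vn_alg M + N: vn_alg N
  for M :: "('a::chilbert_space \<Rightarrow>\<^sub>L 'a) set" and N :: "('b::chilbert_space \<Rightarrow>\<^sub>L 'b) set" +
  fixes \<Phi> :: "('a \<Rightarrow>\<^sub>L 'a) \<Rightarrow> ('b \<Rightarrow>\<^sub>L 'b)"
  assumes star_hom: "unital_star_hom M N \<Phi>" and normal_map: "normal_map M N \<Phi>"
begin

lemma op_hom: "op_hom M N \<Phi>"
proof
  show "\<Phi> A \<in> N" if "A \<in> M" for A
    using star_hom that unfolding unital_star_hom_def by blast
  show "\<Phi> (A + B) = \<Phi> A + \<Phi> B" "\<Phi> (A o\<^sub>L B) = \<Phi> A o\<^sub>L \<Phi> B" if "A \<in> M" "B \<in> M" for A B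
    using star_hom that unfolding unital_star_hom_def by blast+
  show "\<Phi> id_blinfun = id_blinfun"
    using star_hom unfolding unital_star_hom_def by blast
  show "\<Phi> (c *\<^sub>R A) = c *\<^sub>R \<Phi> A" if "A \<in> M" for c A
    using star_hom that unfolding unital_star_hom_def scale_op_of_real[symmetric] by blast
  show "\<Phi> (radj A) = radj (\<Phi> A)" if A: "A \<in> M" for A
  proof -
    have "\<Phi> A \<in> N" "\<Phi> (adj A) = adj (\<Phi> A)"
      using star_hom A unfolding unital_star_hom_def by blast+
    then show ?thesis using A by (simp add: adj_eq_radj M.sub_bounded_ops N.sub_bounded_ops)
  qed
qed

sublocale normal_hom M N \<Phi>
proof -
  interpret op_hom M N \<Phi> by (rule op_hom)
  have le: "op_le A B \<longleftrightarrow> (\<forall>x. inner (A x) x \<le> inner (B x) x)"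
    for A B :: "'x::chilbert_space \<Rightarrow>\<^sub>L 'x"
    by (simp add: op_le_def inner_eq_Re_cinner)
  have sa_M: "A \<in> self_adjoints M \<longleftrightarrow> A \<in> M \<and> radj A = A" for A
    by (auto simp: self_adjoints_def adj_eq_radj M.sub_bounded_ops)
  have sa_N: "A \<in> self_adjoints N \<longleftrightarrow> A \<in> N \<and> radj A = A" for A
    by (auto simp: self_adjoints_def adj_eq_radj N.sub_bounded_ops)
  have radj_uminus: "radj (- A) = - radj A" for A :: "'x::{real_inner,banach} \<Rightarrow>\<^sub>L 'y::{real_inner,banach}"
    using radj_diff[of 0 A] by simp
  show "normal_hom M N \<Phi>"
  proof
    fix F :: "nat \<Rightarrow> ('a \<Rightarrow>\<^sub>L 'a)" and G :: "'b \<Rightarrow>\<^sub>L 'b" and y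
    assume F: "\<And>n. F n \<in> M" "\<And>n. radj (F n) = F n"
      and dec: "\<And>n x. inner (F (Suc n) x) x \<le> inner (F n x) x"
      and lim: "\<And>x. (\<lambda>n. inner (F n x) x) \<longlonglongrightarrow> 0"
      and G: "G \<in> N" "radj G = G" and le_F: "\<And>n y. inner (G y) y \<le> inner (\<Phi> (F n) y) y"
    \<comment> \<open>Normality speaks of suprema, so the decreasing sequence is negated: D is
      directed with supremum 0, and -G bounds its image from above.\<close>
    define D where "D = range (\<lambda>n. - F n)"
    have dec_n: "decseq (\<lambda>n. inner (F n x) x)" for x using dec by (rule decseq_SucI)
    have "is_op_lub M D 0"
      unfolding is_op_lub_def
    proof (intro conjI ballI impI)
      show "0 \<in> self_adjoints M" by (simp add: sa_M M.zero_in)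
      show "op_le A 0" if "A \<in> D" for A
        using that decseq_ge[OF dec_n lim] by (auto simp: D_def le blinfun.minus_left)
      fix B assume B: "\<forall>A\<in>D. op_le A B"
      have "0 \<le> inner (B x) x" for x
      proof (rule LIMSEQ_le_const2)
        show "(\<lambda>n. - inner (F n x) x) \<longlonglongrightarrow> 0" using tendsto_minus[OF lim[of x]] by simp
        show "\<exists>N. \<forall>n\<ge>N. - inner (F n x) x \<le> inner (B x) x"
          using B by (auto simp: D_def le blinfun.minus_left)
      qed
      then show "op_le 0 B" by (simp add: le)
    qed
    moreover have "D \<noteq> {}" "D \<subseteq> self_adjoints M"
      using F by (auto simp: D_def sa_M M.uminus_in radj_uminus)
    moreover have "\<forall>A\<in>D. \<forall>B\<in>D. \<exists>C\<in>D. op_le A C \<and> op_le B C"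
    proof (intro ballI)
      fix A B assume "A \<in> D" "B \<in> D"
      then obtain m n where "A = - F m" "B = - F n" by (auto simp: D_def)
      then have "op_le A (- F (max m n))" "op_le B (- F (max m n))"
        using decseqD[OF dec_n] by (auto simp: le blinfun.minus_left)
      then show "\<exists>C\<in>D. op_le A C \<and> op_le B C" by (auto simp: D_def)
    qed
    ultimately have "is_op_lub N (\<Phi> ` D) (\<Phi> 0)"
      using normal_map unfolding normal_map_def by blast
    moreover have "- G \<in> self_adjoints N" using G by (simp add: sa_N N.uminus_in radj_uminus)
    moreover have "\<forall>A\<in>\<Phi> ` D. op_le A (- G)"
      using le_F F by (auto simp: D_def le hom_uminus blinfun.minus_left)
    ultimately have "op_le 0 (- G)" unfolding is_op_lub_def by (auto simp: hom_zero)
    then show "inner (G y) y \<le> 0" by (simp add: le blinfun.minus_left)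
  qed
qed

section \<open>Images of quotients and of their graphs\<close>

lemma graph_col_in_mats: "A \<in> M \<Longrightarrow> B \<in> M \<Longrightarrow> opmat B 0 A 0 \<in> mats M"
  by (intro opmat_in_mats M.zero_in)

lemma null_hom:
  assumes "A \<in> M" "B \<in> M" "null B \<subseteq> null A"
  shows "null (\<Phi> B) \<subseteq> null (\<Phi> A)"
proof
  fix v assume "v \<in> null (\<Phi> B)"
  then have "mat_hom \<Phi> (opmat B 0 0 0) (v, 0) = 0"
    by (simp add: mat_hom_opmat opmat_apply null_def hom_zero zero_prod_def)
  moreover have "opmat A 0 0 0 u = 0" if "opmat B 0 0 0 u = 0" for u
    using that assms(3) by (auto simp: opmat_apply zero_prod_def null_def)
  ultimately have "mat_hom \<Phi> (opmat A 0 0 0) (v, 0) = 0"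
    using mat_hom_null_mono[of "opmat B 0 0 0" "opmat A 0 0 0"] assms
    by (simp add: opmat_in_mats M.zero_in)
  then show "v \<in> null (\<Phi> A)"
    by (simp add: mat_hom_opmat opmat_apply null_def hom_zero zero_prod_def)
qed

text \<open>Any Z whose range is dense in the graph computes the image graph. The column matrix of
  A/B has closed range, its image too, and closures of image ranges depend only on closures of
  ranges.\<close>

lemma graph_quot_hom:
  assumes A: "A \<in> M" "B \<in> M" "null B \<subseteq> null A"
    and Z: "Z \<in> mats M" "Map.graph (quot A B) = closure (range (blinfun_apply Z))"
  shows "Map.graph (quot (\<Phi> A) (\<Phi> B)) = closure (range (blinfun_apply (mat_hom \<Phi> Z)))"
proof -
  define V where "V = opmat B 0 A 0"
  have V: "V \<in> mats M" unfolding V_def by (rule graph_col_in_mats[OF A(1,2)])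
  have g: "range (blinfun_apply V) = closure (range (blinfun_apply Z))"
    using Z(2) by (simp add: V_def graph_quot[OF A(3)])
  then have cl: "closed (range (blinfun_apply V))" by simp
  have "Map.graph (quot (\<Phi> A) (\<Phi> B)) = range (blinfun_apply (mat_hom \<Phi> V))"
    unfolding graph_quot[OF null_hom[OF A]] by (simp add: V_def mat_hom_opmat hom_zero)
  also have "\<dots> = closure (range (blinfun_apply (mat_hom \<Phi> V)))"
    using M2.hom_closed_range[OF V cl] by (simp add: closure_closed)
  also have "\<dots> = closure (range (blinfun_apply (mat_hom \<Phi> Z)))"
    using g cl by (intro subset_antisym mat_hom_closure_range_mono V Z) simp_all
  finally show ?thesis .
qed

text \<open>Independence of the representation: for A/B = A'/B' the column matrix of one is a
  dense-range matrix for the graph of the other, so both image quotients have the same graph and the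
  \<open>THE\<close> in \<open>aff_ext\<close> is determined.\<close>

lemma aff_ext_quot:
  assumes A: "A \<in> M" "B \<in> M" "null B \<subseteq> null A" and closed: "closed (Map.graph (quot A B))"
  shows "aff_ext M \<Phi> (quot A B) = quot (\<Phi> A) (\<Phi> B)"
proof -
  have Z: "opmat B 0 A 0 \<in> mats M"
    "Map.graph (quot A B) = closure (range (blinfun_apply (opmat B 0 A 0)))"
    using closed by (simp_all add: graph_col_in_mats A graph_quot[OF A(3)] closure_closed)
  have "quot (\<Phi> A') (\<Phi> B') = quot (\<Phi> A) (\<Phi> B)"
    if "A' \<in> M" "B' \<in> M" "null B' \<subseteq> null A'" "quot A B = quot A' B'" for A' B'
    using graph_quot_hom[OF that(1-3) Z(1)] graph_quot_hom[OF A Z] Z(2) that(4)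
    by (simp add: graph_inject[symmetric])
  then have "(THE S. \<exists>A'\<in>M. \<exists>B'\<in>M. null B' \<subseteq> null A' \<and> quot A B = quot A' B' \<and>
      S = quot (\<Phi> A') (\<Phi> B')) = quot (\<Phi> A) (\<Phi> B)"
    using A by (intro the_equality) blast+
  moreover have "quot A B \<in> aff M" using A unfolding aff_def by blast
  ultimately show ?thesis by (simp add: aff_ext_def)
qed

lemma closed_graph_aff_MvN: "T \<in> aff_MvN M \<Longrightarrow> closed (Map.graph T)"
  by (simp add: aff_MvN_def closed_op_def)

lemma graph_aff_ext:
  assumes T: "T \<in> aff_MvN M" and Z: "Z \<in> mats M" "Map.graph T = closure (range (blinfun_apply Z))"
  shows "Map.graph (aff_ext M \<Phi> T) = closure (range (blinfun_apply (mat_hom \<Phi> Z)))"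
proof -
  obtain A B where AB: "A \<in> M" "B \<in> M" "null B \<subseteq> null A" "T = quot A B"
    using M.aff_MvN_quot[OF T] by blast
  then show ?thesis
    using aff_ext_quot[OF AB(1-3)] graph_quot_hom[OF AB(1-3)] closed_graph_aff_MvN[OF T] Z by simp
qed

lemma aff_ext_in:
  assumes T: "T \<in> aff_MvN M"
  shows "aff_ext M \<Phi> T \<in> aff_MvN N"
proof -
  obtain A B where AB: "A \<in> M" "B \<in> M" "null B \<subseteq> null A" "T = quot A B"
    using M.aff_MvN_quot[OF T] by blast
  have Z: "opmat B 0 A 0 \<in> mats M" by (rule graph_col_in_mats[OF AB(1,2)])
  have g: "Map.graph T = closure (range (blinfun_apply (opmat B 0 A 0)))"
    using closed_graph_aff_MvN[OF T] by (simp add: AB(4) graph_quot[OF AB(3)] closure_closed)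
  have "aff_ext M \<Phi> T = quot (\<Phi> A) (\<Phi> B)"
    using aff_ext_quot[OF AB(1-3)] closed_graph_aff_MvN[OF T] AB(4) by simp
  moreover have "unbounded_op (quot (\<Phi> A) (\<Phi> B))"
    by (intro unbounded_op_quot N.sub_bounded_ops hom_in null_hom AB)
  ultimately show ?thesis
    using N.aff_MvN_of_range[OF _ M2.hom_in[OF Z] graph_aff_ext[OF T Z g]] by simp
qed

text \<open>
  The closure of an operator range is the graph of an operator iff it meets \<open>0 \<oplus> H\<close> trivially, that is, iff the sum of the
  projections onto its orthogonal complement and onto \<open>H \<oplus> 0\<close> is injective.
\<close>

lemma mat_hom_single_valued:
  assumes Z: "Z \<in> mats M" and sv: "\<And>y. (0, y) \<in> closure (range (blinfun_apply Z)) \<Longrightarrow> y = 0"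
    and y: "(0, y) \<in> closure (range (blinfun_apply (mat_hom \<Phi> Z)))"
  shows "y = 0"
proof -
  define L where "L = nproj (radj Z)"
  define E where "E = opmat id_blinfun 0 0 (0 :: 'a \<Rightarrow>\<^sub>L 'a)"
  have L: "L \<in> mats M" unfolding L_def by (intro M2.A.nproj_in M2.A.radj_in Z)
  have E: "E \<in> mats M" unfolding E_def by (intro opmat_in_mats M.id_in M.zero_in)
  have LE: "L + E \<in> mats M" by (intro M2.A.add_in L E)
  have inj: "u = 0" if u: "(L + E) u = 0" for u
  proof -
    have LL: "L (L u) = L u" unfolding L_def by (rule nproj_fix[OF apply_nproj])
    have "inner (L u) u = inner (L u) (L u)"
      using inner_radj_right[of L "L u" u] LL by (simp add: L_def radj_nproj)
    moreover have "inner (E u) u = inner (fst u) (fst u)"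
      by (simp add: E_def opmat_apply inner_prod_def)
    moreover have "inner (L u) u + inner (E u) u = 0"
      using u by (metis blinfun.add_left inner_add_left inner_zero_left)
    ultimately have "inner (L u) (L u) = 0" "inner (fst u) (fst u) = 0"
      using inner_ge_zero[of "L u"] inner_ge_zero[of "fst u"] by linarith+
    then have "L u = 0" "fst u = 0" by simp_all
    then have "(0, snd u) \<in> closure (range (blinfun_apply Z))"
      by (simp add: mem_closure_range_iff_nproj L_def[symmetric]) (metis prod.collapse)
    then show ?thesis using sv \<open>fst u = 0\<close> by (simp add: prod_eq_iff)
  qed
  have "mat_hom \<Phi> L = nproj (radj (mat_hom \<Phi> Z))"
    by (simp add: L_def mat_hom_nproj M2.A.radj_in Z M2.hom_radj)
  then have "mat_hom \<Phi> L (0, y) = 0" using y by (simp add: mem_closure_range_iff_nproj)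
  moreover have "mat_hom \<Phi> E (0, y) = 0"
    by (simp add: E_def mat_hom_opmat hom_zero opmat_apply zero_prod_def blinfun.zero_right)
  ultimately have "mat_hom \<Phi> (L + E) (0, y) = 0"
    by (simp add: M2.hom_add[OF L E] blinfun.add_left)
  \<comment> \<open>Injectivity of L + E is an inclusion of its kernel in that of the identity, and
    such inclusions are transported.\<close>
  then have "mat_hom \<Phi> id_blinfun (0, y) = 0"
    using mat_hom_null_mono[OF LE M2.A.id_in] inj by force
  then show ?thesis by (simp add: M2.hom_id zero_prod_def)
qed

text \<open>The common mechanism behind strong sums and products: it applies as soon as the graph of
  the unclosed operator is the range of a matrix over M and the graph formed from the images is the
  range of the image matrix.\<close>

lemma closure_op_transfer:
  assumes Z: "Z \<in> mats M"
    and P: "preclosed_op P" "Map.graph P = range (blinfun_apply Z)"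
    and P': "Map.graph P' = range (blinfun_apply (mat_hom \<Phi> Z))"
  shows "preclosed_op P'" "closure_op P \<in> aff_MvN M" "aff_ext M \<Phi> (closure_op P) = closure_op P'"
proof -
  note cP = graph_closure_op[OF P(1)]
  have g: "Map.graph (closure_op P) = closure (range (blinfun_apply Z))" using cP P(2) by simp
  show in_M: "closure_op P \<in> aff_MvN M" by (rule M.aff_MvN_of_range[OF cP(1) Z g])
  have "y = 0" if "(0, y) \<in> closure (range (blinfun_apply Z))" for y
  proof -
    have "(0, 0) \<in> Map.graph (closure_op P)"
      using cP(1) unfolding unbounded_op_iff_csubspace csubspace_def zero_prod_def by blast
    then show ?thesis using that g by (metis in_graph_iff option.inject)
  qed
  then have sv: "y = 0" if "(0, y) \<in> closure (range (blinfun_apply (mat_hom \<Phi> Z)))" for y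
    using mat_hom_single_valued[OF Z] that by blast
  have "mats N \<subseteq> mats bounded_ops" using N.sub_bounded_ops by (auto simp: mats_def)
  then have "csubspace (closure (range (blinfun_apply (mat_hom \<Phi> Z))))"
    using M2.hom_in[OF Z] by (intro csubspace_closure csubspace_range) blast
  then obtain S where S: "unbounded_op S" "Map.graph S = closure (range (blinfun_apply (mat_hom \<Phi> Z)))"
    using ex_op_of_csubspace sv by blast
  then show "preclosed_op P'" using P' unfolding preclosed_op_def by auto
  have "closure_op P' = S" using S P' by (intro closure_op_eqI) simp
  then show "aff_ext M \<Phi> (closure_op P) = closure_op P'"
    using graph_aff_ext[OF in_M Z g] S(2) by (simp add: graph_inject[symmetric])
qed

text \<open>The matrix for the graph of the sum is a product of a matrix and a kernel projection;
  applying \<Phi> entrywise yields the same expression in the images.\<close>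

lemma aff_ext_strong_sum:
  assumes S: "S \<in> aff_MvN M" and T: "T \<in> aff_MvN M" and pre: "preclosed_op (op_plus S T)"
  shows "preclosed_op (op_plus (aff_ext M \<Phi> S) (aff_ext M \<Phi> T))"
    "strong_sum S T \<in> aff_MvN M"
    "aff_ext M \<Phi> (strong_sum S T) = strong_sum (aff_ext M \<Phi> S) (aff_ext M \<Phi> T)"
proof -
  obtain A1 B1 where 1: "A1 \<in> M" "B1 \<in> M" "null B1 \<subseteq> null A1" "S = quot A1 B1"
    using M.aff_MvN_quot[OF S] by blast
  obtain A2 B2 where 2: "A2 \<in> M" "B2 \<in> M" "null B2 \<subseteq> null A2" "T = quot A2 B2"
    using M.aff_MvN_quot[OF T] by blast
  have S': "aff_ext M \<Phi> S = quot (\<Phi> A1) (\<Phi> B1)"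
    using aff_ext_quot[OF 1(1-3)] closed_graph_aff_MvN[OF S] 1(4) by simp
  have T': "aff_ext M \<Phi> T = quot (\<Phi> A2) (\<Phi> B2)"
    using aff_ext_quot[OF 2(1-3)] closed_graph_aff_MvN[OF T] 2(4) by simp
  define X where "X = opmat B1 (- B2) 0 0"
  define C where "C = opmat B1 0 A1 A2"
  have X: "X \<in> mats M" and C: "C \<in> mats M"
    unfolding X_def C_def by (intro opmat_in_mats 1 2 M.zero_in M.uminus_in)+
  have Z: "C o\<^sub>L nproj X \<in> mats M" by (intro M2.A.comp_in M2.A.nproj_in X C)
  have "mat_hom \<Phi> (C o\<^sub>L nproj X) =
      opmat (\<Phi> B1) 0 (\<Phi> A1) (\<Phi> A2) o\<^sub>L nproj (opmat (\<Phi> B1) (- \<Phi> B2) 0 0)"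
    by (simp add: M2.hom_comp[OF C M2.A.nproj_in[OF X]] mat_hom_nproj[OF X])
      (simp add: C_def X_def mat_hom_opmat hom_zero hom_uminus 2)
  then have g': "Map.graph (op_plus (aff_ext M \<Phi> S) (aff_ext M \<Phi> T)) =
      range (blinfun_apply (mat_hom \<Phi> (C o\<^sub>L nproj X)))"
    unfolding S' T' by (simp add: graph_op_plus_quot null_hom 1 2)
  have g: "Map.graph (op_plus S T) = range (blinfun_apply (C o\<^sub>L nproj X))"
    unfolding 1(4) 2(4) X_def C_def by (rule graph_op_plus_quot[OF 1(3) 2(3)])
  show "preclosed_op (op_plus (aff_ext M \<Phi> S) (aff_ext M \<Phi> T))"
    "strong_sum S T \<in> aff_MvN M"
    "aff_ext M \<Phi> (strong_sum S T) = strong_sum (aff_ext M \<Phi> S) (aff_ext M \<Phi> T)"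
    unfolding strong_sum_def using closure_op_transfer[OF Z pre g g'] by blast+
qed

lemma aff_ext_strong_prod:
  assumes S: "S \<in> aff_MvN M" and T: "T \<in> aff_MvN M" and pre: "preclosed_op (S \<circ>\<^sub>m T)"
  shows "preclosed_op (aff_ext M \<Phi> S \<circ>\<^sub>m aff_ext M \<Phi> T)"
    "strong_prod S T \<in> aff_MvN M"
    "aff_ext M \<Phi> (strong_prod S T) = strong_prod (aff_ext M \<Phi> S) (aff_ext M \<Phi> T)"
proof -
  obtain A1 B1 where 1: "A1 \<in> M" "B1 \<in> M" "null B1 \<subseteq> null A1" "S = quot A1 B1"
    using M.aff_MvN_quot[OF S] by blast
  obtain A2 B2 where 2: "A2 \<in> M" "B2 \<in> M" "null B2 \<subseteq> null A2" "T = quot A2 B2"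
    using M.aff_MvN_quot[OF T] by blast
  have S': "aff_ext M \<Phi> S = quot (\<Phi> A1) (\<Phi> B1)"
    using aff_ext_quot[OF 1(1-3)] closed_graph_aff_MvN[OF S] 1(4) by simp
  have T': "aff_ext M \<Phi> T = quot (\<Phi> A2) (\<Phi> B2)"
    using aff_ext_quot[OF 2(1-3)] closed_graph_aff_MvN[OF T] 2(4) by simp
  define X where "X = opmat (- B1) A2 0 0"
  define C where "C = opmat 0 B2 A1 0"
  have X: "X \<in> mats M" and C: "C \<in> mats M"
    unfolding X_def C_def by (intro opmat_in_mats 1 2 M.zero_in M.uminus_in)+
  have Z: "C o\<^sub>L nproj X \<in> mats M" by (intro M2.A.comp_in M2.A.nproj_in X C)
  have "mat_hom \<Phi> (C o\<^sub>L nproj X) =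
      opmat 0 (\<Phi> B2) (\<Phi> A1) 0 o\<^sub>L nproj (opmat (- \<Phi> B1) (\<Phi> A2) 0 0)"
    by (simp add: M2.hom_comp[OF C M2.A.nproj_in[OF X]] mat_hom_nproj[OF X])
      (simp add: C_def X_def mat_hom_opmat hom_zero hom_uminus 1)
  then have g': "Map.graph (aff_ext M \<Phi> S \<circ>\<^sub>m aff_ext M \<Phi> T) =
      range (blinfun_apply (mat_hom \<Phi> (C o\<^sub>L nproj X)))"
    unfolding S' T' graph_map_comp_quot[OF null_hom[OF 1(1-3)] null_hom[OF 2(1-3)]] by simp
  have g: "Map.graph (S \<circ>\<^sub>m T) = range (blinfun_apply (C o\<^sub>L nproj X))"
    unfolding 1(4) 2(4) X_def C_def by (rule graph_map_comp_quot[OF 1(3) 2(3)])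
  show "preclosed_op (aff_ext M \<Phi> S \<circ>\<^sub>m aff_ext M \<Phi> T)"
    "strong_prod S T \<in> aff_MvN M"
    "aff_ext M \<Phi> (strong_prod S T) = strong_prod (aff_ext M \<Phi> S) (aff_ext M \<Phi> T)"
    unfolding strong_prod_def using closure_op_transfer[OF Z pre g g'] by blast+
qed

lemma closure_range_nproj: "closure (range (blinfun_apply (nproj X))) = range (blinfun_apply (nproj X))"
  unfolding range_nproj by (rule closure_closed[OF closed_null_blinfun])

text \<open>The graph of the adjoint is the range of a kernel projection, on both sides, so it is
  closed and no closure enters the comparison.\<close>

lemma aff_ext_op_adj:
  assumes T: "T \<in> aff_MvN M"
  shows "op_adj T \<in> aff_MvN M" "aff_ext M \<Phi> (op_adj T) = op_adj (aff_ext M \<Phi> T)"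
proof -
  obtain A B where AB: "A \<in> M" "B \<in> M" "null B \<subseteq> null A" "T = quot A B"
    using M.aff_MvN_quot[OF T] by blast
  have T': "aff_ext M \<Phi> T = quot (\<Phi> A) (\<Phi> B)"
    using aff_ext_quot[OF AB(1-3)] closed_graph_aff_MvN[OF T] AB(4) by simp
  define X where "X = opmat (radj A) (- radj B) 0 (nproj (radj B))"
  have X: "X \<in> mats M" unfolding X_def
    by (intro opmat_in_mats M.radj_in M.uminus_in M.zero_in M.nproj_in AB)
  have Z: "nproj X \<in> mats M" by (rule M2.A.nproj_in[OF X])
  have g: "Map.graph (op_adj T) = closure (range (blinfun_apply (nproj X)))"
    unfolding closure_range_nproj AB(4) X_def
    by (intro graph_op_adj_quot M.sub_bounded_ops AB)
  have "mat_hom \<Phi> (nproj X) =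
      nproj (opmat (radj (\<Phi> A)) (- radj (\<Phi> B)) 0 (nproj (radj (\<Phi> B))))"
    by (simp add: mat_hom_nproj[OF X])
      (simp add: X_def mat_hom_opmat hom_zero hom_uminus hom_radj hom_nproj M.radj_in AB)
  then have g': "Map.graph (op_adj (aff_ext M \<Phi> T)) = range (blinfun_apply (mat_hom \<Phi> (nproj X)))"
    unfolding T' by (simp add: graph_op_adj_quot N.sub_bounded_ops hom_in null_hom AB)
  have "mats M \<subseteq> mats bounded_ops" using M.sub_bounded_ops by (auto simp: mats_def)
  then have "unbounded_op (op_adj T)"
    unfolding unbounded_op_iff_csubspace g
    using Z by (intro csubspace_closure csubspace_range) blast
  then show in_M: "op_adj T \<in> aff_MvN M" by (rule M.aff_MvN_of_range[OF _ Z g])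
  have "Map.graph (aff_ext M \<Phi> (op_adj T)) = Map.graph (op_adj (aff_ext M \<Phi> T))"
    unfolding graph_aff_ext[OF in_M Z g] g' mat_hom_nproj[OF X] closure_range_nproj ..
  then show "aff_ext M \<Phi> (op_adj T) = op_adj (aff_ext M \<Phi> T)" by (simp add: graph_inject)
qed

section \<open>Bounded operators as quotients, and existence of the extension\<close>

lemma op_of_eq_quot: "op_of A = quot A id_blinfun"
  by (rule ext) (auto simp: op_of_def quot_def)

lemma null_id: "null id_blinfun \<subseteq> null A"
  by (auto simp: null_def blinfun.zero_right)

lemma closed_graph_op_of: "closed (Map.graph (op_of A))"
proof -
  have "Map.graph (op_of A) = {u. snd u = A (fst u)}" by (auto simp: Map.graph_def op_of_def)
  then show ?thesis by (auto intro!: closed_Collect_eq continuous_intros)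
qed

lemma op_of_in_aff_MvN:
  assumes "A \<in> M"
  shows "op_of A \<in> aff_MvN M"
  using M.quot_in_aff_MvN[OF assms M.id_in null_id] closed_graph_op_of[of A]
  by (simp add: op_of_eq_quot)

lemma aff_ext_op_of:
  assumes "A \<in> M"
  shows "aff_ext M \<Phi> (op_of A) = op_of (\<Phi> A)"
  using aff_ext_quot[OF assms M.id_in null_id] closed_graph_op_of[of A]
  by (simp add: op_of_eq_quot hom_id)

lemma MvN_extension_aff_ext: "MvN_extension M N \<Phi> (restrict (aff_ext M \<Phi>) (aff_MvN M))"
  unfolding MvN_extension_def extends_def respects_strong_sum_def respects_strong_prod_def
    respects_adjoint_def
  using aff_ext_in aff_ext_op_of op_of_in_aff_MvN aff_ext_strong_sum aff_ext_strong_prod aff_ext_op_adj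
  by auto

end

section \<open>Uniqueness of the extension\<close>

text \<open>This quotient inverts B on the orthogonal complement of its kernel. Its graph is the
  flipped graph of a bounded operator restricted to a closed subspace, hence closed even if the
  range of B is not.\<close>

lemma closed_graph_quot_complement:
  shows "null B \<subseteq> null (id_blinfun - nproj B)" "closed (Map.graph (quot (id_blinfun - nproj B) B))"
proof -
  show n: "null B \<subseteq> null (id_blinfun - nproj B)"
    by (auto simp: null_def blinfun.diff_left nproj_fix)
  have "Map.graph (quot (id_blinfun - nproj B) B) = {u. B (snd u) = fst u \<and> nproj B (snd u) = 0}"
  proof (rule pair_set_eqI)
    fix y z
    show "(y, z) \<in> Map.graph (quot (id_blinfun - nproj B) B) \<longleftrightarrow>
        (y, z) \<in> {u. B (snd u) = fst u \<and> nproj B (snd u) = 0}"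
    proof
      assume "(y, z) \<in> Map.graph (quot (id_blinfun - nproj B) B)"
      then obtain x where "y = B x" "z = x - nproj B x"
        unfolding in_graph_iff quot_eq_Some_iff[OF n] by (auto simp: blinfun.diff_left)
      then show "(y, z) \<in> {u. B (snd u) = fst u \<and> nproj B (snd u) = 0}"
        using apply_nproj[of B x] nproj_fix[of B "nproj B x"] by (simp add: blinfun.diff_right)
    next
      assume "(y, z) \<in> {u. B (snd u) = fst u \<and> nproj B (snd u) = 0}"
      then show "(y, z) \<in> Map.graph (quot (id_blinfun - nproj B) B)"
        unfolding in_graph_iff quot_eq_Some_iff[OF n]
        by (intro exI[of _ z]) (simp add: blinfun.diff_left)
    qed
  qed
  then show "closed (Map.graph (quot (id_blinfun - nproj B) B))"
    by (simp add: closed_Collect_conj closed_Collect_eq continuous_intros)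
qed

lemma quot_self_eq_Some_iff:
  assumes "E o\<^sub>L E = E"
  shows "quot E E y = Some z \<longleftrightarrow> E y = y \<and> z = y"
proof -
  have "E (E x) = E x" for x using arg_cong[OF assms, of "\<lambda>X. blinfun_apply X x"] by simp
  then show ?thesis unfolding quot_eq_Some_iff[OF subset_refl] by metis
qed

lemma closed_op_map_comp_op_of:
  assumes S: "closed_op S" and B: "B \<in> bounded_ops"
  shows "closed_op (S \<circ>\<^sub>m op_of B)"
proof -
  have iff: "(S \<circ>\<^sub>m op_of B) x = S (B x)" for x by (simp add: op_of_def map_comp_def)
  have g: "Map.graph (S \<circ>\<^sub>m op_of B) = (\<lambda>u. (B (fst u), snd u)) -` Map.graph S"
    by (auto simp: Map.graph_def iff)
  have "csubspace (Map.graph S)" "closed (Map.graph S)"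
    using S by (auto simp: closed_op_def unbounded_op_iff_csubspace)
  then have "csubspace (Map.graph (S \<circ>\<^sub>m op_of B))"
    unfolding g csubspace_def
    by (auto simp: zero_prod_def blinfun.zero_right blinfun.add_right bounded_opsD[OF B])
      (metis add_Pair)
  moreover have "closed (Map.graph (S \<circ>\<^sub>m op_of B))"
    unfolding g by (intro closed_vimage \<open>closed (Map.graph S)\<close> continuous_intros)
  ultimately show ?thesis by (simp add: closed_op_def unbounded_op_iff_csubspace)
qed

context vn_hom
begin

text \<open>The product of R with B on the right shows that the image of R is defined at least on
  the range of \<open>\<Phi> B\<close>, with the expected values. The product on the left shows that
  it is defined nowhere else.\<close>

lemma MvN_extension_unique_quot:
  assumes \<Psi>: "MvN_extension M N \<Phi> \<Psi>"
    and AB: "A \<in> M" "B \<in> M" "null B \<subseteq> null A" "quot A B \<in> aff_MvN M"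
  shows "\<Psi> (quot A B) = quot (\<Phi> A) (\<Phi> B)"
proof -
  have \<Psi>_in: "\<Psi> T \<in> aff_MvN N" if "T \<in> aff_MvN M" for T
    using \<Psi> that unfolding MvN_extension_def by blast
  have \<Psi>_op: "\<Psi> (op_of A) = op_of (\<Phi> A)" if "A \<in> M" for A
    using \<Psi> that unfolding MvN_extension_def extends_def by blast
  have \<Psi>_sum: "preclosed_op (op_plus (\<Psi> S) (\<Psi> T))" "\<Psi> (strong_sum S T) = strong_sum (\<Psi> S) (\<Psi> T)"
    if "S \<in> aff_MvN M" "T \<in> aff_MvN M" "preclosed_op (op_plus S T)" for S T
    using \<Psi> that unfolding MvN_extension_def respects_strong_sum_def by blast+
  have \<Psi>_prod: "preclosed_op (\<Psi> S \<circ>\<^sub>m \<Psi> T)" "\<Psi> (strong_prod S T) = strong_prod (\<Psi> S) (\<Psi> T)"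
    if "S \<in> aff_MvN M" "T \<in> aff_MvN M" "preclosed_op (S \<circ>\<^sub>m T)" for S T
    using \<Psi> that unfolding MvN_extension_def respects_strong_prod_def by blast+

  define E where "E = id_blinfun - nproj B"
  define E' where "E' = id_blinfun - nproj (radj B)"
  have E: "E \<in> M" "E' \<in> M" unfolding E_def E'_def
    by (intro M.diff_in M.id_in M.nproj_in M.radj_in AB)+
  have E_idem: "E o\<^sub>L E = E" and E'_idem: "E' o\<^sub>L E' = E'"
    by (auto intro!: blinfun_eqI simp: E_def E'_def blinfun.bilinear_simps nproj_fix apply_nproj)
  have BE: "B (E x) = B x" and AE: "A (E x) = A x" for x
  proof -
    show "B (E x) = B x" by (simp add: E_def blinfun.bilinear_simps apply_nproj)
    have "nproj B x \<in> null A" using AB(3) apply_nproj[of B x] by (auto simp: null_def)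
    then show "A (E x) = A x" by (simp add: E_def blinfun.bilinear_simps null_def)
  qed
  have ran_E': "E' y = y \<longleftrightarrow> y \<in> closure (range (blinfun_apply B))" for y
    unfolding mem_closure_range_iff_nproj E'_def by (simp add: blinfun.diff_left)
  have null_BE: "null B \<subseteq> null E" and closed_R: "closed (Map.graph (quot E B))"
    unfolding E_def
    by (intro closed_graph_quot_complement)+
  define R where "R = quot E B"
  \<comment> \<open>E' projects onto the closure of the range of B, and a projection divided by
    itself is the identity on its range.\<close>
  define J where "J = quot E' E'"
  have R_in: "R \<in> aff_MvN M"
    unfolding R_def by (intro M.quot_in_aff_MvN E AB null_BE closed_R)
  have R_iff: "R y = Some z \<longleftrightarrow> (\<exists>x. y = B x \<and> z = E x)" for y z
    unfolding R_def by (rule quot_eq_Some_iff[OF null_BE])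
  have J_iff: "J y = Some z \<longleftrightarrow> E' y = y \<and> z = y" for y z
    unfolding J_def by (rule quot_self_eq_Some_iff[OF E'_idem])
  have graph_J: "Map.graph J = {u. E' (fst u) = fst u \<and> snd u = fst u}"
    by (auto simp: Map.graph_def J_iff)
  have J_in: "J \<in> aff_MvN M"
  proof -
    have "closed (Map.graph J)"
      unfolding graph_J by (intro closed_Collect_conj closed_Collect_eq continuous_intros)
    then show ?thesis unfolding J_def by (intro M.quot_in_aff_MvN E) auto
  qed

  text \<open>The identity \<open>J + (-1) = 0 \<cdot> J\<close> forces \<open>\<Psi> J\<close> to be the identity on its domain.\<close>
  have \<Psi>J: "k = y" if k: "\<Psi> J y = Some k" for y k
  proof -
    define U where "U = op_plus J (op_of (- id_blinfun))"
    have U_eq: "U = op_of 0 \<circ>\<^sub>m J"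
    proof
      fix x
      show "U x = (op_of 0 \<circ>\<^sub>m J) x"
        using J_iff[of x] unfolding U_def op_plus_def op_of_def map_comp_def
        by (cases "J x") (auto simp: blinfun.minus_left)
    qed
    have U_iff: "U x = Some z \<longleftrightarrow> E' x = x \<and> z = 0" for x z
      unfolding U_eq map_comp_Some_iff J_iff by (auto simp: op_of_def)
    have "closed_op U"
    proof -
      have g: "Map.graph U = {u. E' (fst u) = fst u \<and> snd u = 0}"
        by (auto simp: Map.graph_def U_iff)
      have "closed (Map.graph U)"
        unfolding g by (intro closed_Collect_conj closed_Collect_eq continuous_intros)
      moreover have "csubspace (Map.graph U)"
        unfolding g csubspace_def
        by (auto simp: blinfun.bilinear_simps bounded_opsD[OF M.sub_bounded_ops[OF E(2)]])
      ultimately show ?thesis by (simp add: closed_op_def unbounded_op_iff_csubspace)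
    qed
    then have pre: "preclosed_op U" by (rule closed_op_imp_preclosed)
    have i: "- id_blinfun \<in> M" "0 \<in> M" by (intro M.uminus_in M.id_in M.zero_in)+
    have i': "\<Psi> (op_of (- id_blinfun)) = op_of (- id_blinfun)" "\<Psi> (op_of 0) = op_of 0"
      using i by (simp_all add: \<Psi>_op hom_uminus M.id_in hom_id hom_zero)
    have "strong_sum J (op_of (- id_blinfun)) = strong_prod (op_of 0) J"
      using U_eq by (simp add: strong_sum_def strong_prod_def U_def)
    then have eq: "strong_sum (\<Psi> J) (op_of (- id_blinfun)) = strong_prod (op_of 0) (\<Psi> J)"
      and p1: "preclosed_op (op_plus (\<Psi> J) (op_of (- id_blinfun)))"
      and p2: "preclosed_op (op_of 0 \<circ>\<^sub>m \<Psi> J)"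
      using \<Psi>_sum[OF J_in op_of_in_aff_MvN[OF i(1)]] \<Psi>_prod[OF op_of_in_aff_MvN[OF i(2)] J_in]
        pre U_eq i' by (simp_all add: U_def)
    \<comment> \<open>This point survives in the closure of the sum, which is also the closure of 0
      times the image of J; all values of the latter are 0.\<close>
    have "op_plus (\<Psi> J) (op_of (- id_blinfun)) y = Some (k - y)"
      using k by (auto simp: op_plus_def op_of_def blinfun.minus_left)
    then have "(y, k - y) \<in> closure (Map.graph (op_plus (\<Psi> J) (op_of (- id_blinfun))))"
      by (intro subsetD[OF closure_subset] in_graphI)
    then have "(y, k - y) \<in> closure (Map.graph (op_of 0 \<circ>\<^sub>m \<Psi> J))"
      using graph_closure_op(2)[OF p1] graph_closure_op(2)[OF p2] eq
      by (simp add: strong_sum_def strong_prod_def)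
    moreover have "closure (Map.graph (op_of 0 \<circ>\<^sub>m \<Psi> J)) \<subseteq> {u. snd u = 0}"
      by (intro closure_minimal closed_Collect_eq continuous_intros)
        (auto simp: Map.graph_def map_comp_Some_iff op_of_def)
    ultimately show "k = y" by auto
  qed

  have \<Psi>R1: "\<Psi> R (\<Phi> B x) = Some (\<Phi> E x)" for x
  proof -
    have eq: "R \<circ>\<^sub>m op_of B = op_of E"
    proof
      fix x show "(R \<circ>\<^sub>m op_of B) x = op_of E x"
        using R_iff[of "B x" "E x"] by (auto simp: op_of_def map_comp_def)
    qed
    have "closed_op (op_of E)" using op_of_in_aff_MvN[OF E(1)] by (simp add: aff_MvN_def)
    note c = closed_op_imp_preclosed[OF this]
    have "\<Psi> (op_of E) = strong_prod (\<Psi> R) (\<Psi> (op_of B))"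
      using \<Psi>_prod(2)[OF R_in op_of_in_aff_MvN[OF AB(2)]] c by (simp add: eq strong_prod_def)
    then have "op_of (\<Phi> E) = closure_op (\<Psi> R \<circ>\<^sub>m op_of (\<Phi> B))"
      by (simp add: \<Psi>_op E AB strong_prod_def)
    \<comment> \<open>The image of R is closed and \<open>\<Phi> B\<close> is bounded, so the
      product is closed already and the identity holds at every x, not merely after closure.\<close>
    also have "\<dots> = \<Psi> R \<circ>\<^sub>m op_of (\<Phi> B)"
      using \<Psi>_in[OF R_in]
      by (intro closed_op_imp_preclosed closed_op_map_comp_op_of N.sub_bounded_ops hom_in AB)
        (simp add: aff_MvN_def)
    finally have "(\<Psi> R \<circ>\<^sub>m op_of (\<Phi> B)) x = op_of (\<Phi> E) x" by simp
    then show ?thesis by (simp add: op_of_def map_comp_def)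
  qed
  have \<Psi>R2: "y = \<Phi> B r" if r: "\<Psi> R y = Some r" for y r
  proof -
    have "(op_of B \<circ>\<^sub>m R) y = Some z \<longleftrightarrow> y \<in> range B \<and> z = y" for y z
      unfolding map_comp_Some_iff R_iff by (auto simp: op_of_def BE)
    then have g: "Map.graph (op_of B \<circ>\<^sub>m R) = (\<lambda>y. (y, y)) ` range B"
      by (auto simp: Map.graph_def)
    have "closure ((\<lambda>y. (y, y)) ` range B) = (\<lambda>y. (y, y)) ` closure (range B)"
    proof
      have "Map.graph J = (\<lambda>y. (y, y)) ` closure (range B)"
        unfolding graph_J ran_E' by (auto simp: image_iff prod_eq_iff)
      then have "closed ((\<lambda>y. (y, y)) ` closure (range B))"
        using closed_graph_aff_MvN[OF J_in] by simp
      then show "closure ((\<lambda>y. (y, y)) ` range B) \<subseteq> (\<lambda>y. (y, y)) ` closure (range B)"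
        by (intro closure_minimal image_mono closure_subset)
      show "(\<lambda>y. (y, y)) ` closure (range B) \<subseteq> closure ((\<lambda>y. (y, y)) ` range B)"
        by (intro image_closure_subset continuous_intros closed_closure closure_subset)
    qed
    also have "\<dots> = Map.graph J" unfolding graph_J ran_E' by (auto simp: image_iff prod_eq_iff)
    finally have gJ: "Map.graph J = closure (Map.graph (op_of B \<circ>\<^sub>m R))"
      unfolding g by (rule sym)
    have "unbounded_op J" using J_in by (simp add: aff_MvN_def closed_op_def)
    then have pre: "preclosed_op (op_of B \<circ>\<^sub>m R)" unfolding preclosed_op_def using gJ by blast
    have J_eq: "J = strong_prod (op_of B) R"
      unfolding strong_prod_def by (rule closure_op_eqI[OF gJ, symmetric])
    have p: "preclosed_op (op_of (\<Phi> B) \<circ>\<^sub>m \<Psi> R)" "\<Psi> J = closure_op (op_of (\<Phi> B) \<circ>\<^sub>m \<Psi> R)"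
      using \<Psi>_prod[OF op_of_in_aff_MvN[OF AB(2)] R_in pre]
      by (simp_all add: \<Psi>_op AB J_eq strong_prod_def)
    have "(op_of (\<Phi> B) \<circ>\<^sub>m \<Psi> R) y = Some (\<Phi> B r)" using r by (simp add: op_of_def map_comp_def)
    then have "(y, \<Phi> B r) \<in> closure (Map.graph (op_of (\<Phi> B) \<circ>\<^sub>m \<Psi> R))"
      by (intro subsetD[OF closure_subset] in_graphI)
    \<comment> \<open>The image of J extends the unclosed product of \<open>\<Phi> B\<close> with
      the image of R, so \<open>\<Psi>J\<close> forces \<Phi> B r = y.\<close>
    then have "\<Psi> J y = Some (\<Phi> B r)"
      unfolding p(2) graph_closure_op(2)[OF p(1), symmetric] in_graph_iff .
    then show ?thesis by (rule \<Psi>J[symmetric])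
  qed
  have hom_AE: "\<Phi> A (\<Phi> E x) = \<Phi> A x" for x
  proof -
    have "A o\<^sub>L E = A" by (rule blinfun_eqI) (simp add: AE)
    then have "\<Phi> A o\<^sub>L \<Phi> E = \<Phi> A" using hom_comp[OF AB(1) E(1)] by simp
    from arg_cong[OF this, of "\<lambda>X. blinfun_apply X x"] show ?thesis by simp
  qed
  have \<Psi>R_iff: "\<Psi> R y = Some z \<longleftrightarrow> (\<exists>x. y = \<Phi> B x \<and> z = \<Phi> E x)" for y z
    using \<Psi>R1 \<Psi>R2 by (metis option.inject)
  have T_eq: "op_of A \<circ>\<^sub>m R = quot A B"
  proof
    fix y
    have "(op_of A \<circ>\<^sub>m R) y = Some z \<longleftrightarrow> quot A B y = Some z" for z
      unfolding map_comp_Some_iff R_iff quot_eq_Some_iff[OF AB(3)] by (auto simp: op_of_def AE)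
    then show "(op_of A \<circ>\<^sub>m R) y = quot A B y" by (metis not_Some_eq)
  qed
  have T'_eq: "op_of (\<Phi> A) \<circ>\<^sub>m \<Psi> R = quot (\<Phi> A) (\<Phi> B)"
  proof
    fix y
    have "(op_of (\<Phi> A) \<circ>\<^sub>m \<Psi> R) y = Some z \<longleftrightarrow> quot (\<Phi> A) (\<Phi> B) y = Some z" for z
      unfolding map_comp_Some_iff \<Psi>R_iff quot_eq_Some_iff[OF null_hom[OF AB(1-3)]]
      by (auto simp: op_of_def hom_AE)
    then show "(op_of (\<Phi> A) \<circ>\<^sub>m \<Psi> R) y = quot (\<Phi> A) (\<Phi> B) y" by (metis not_Some_eq)
  qed
  have c: "closed_op (quot A B)" using AB(4) by (simp add: aff_MvN_def)
  have "aff_ext M \<Phi> (quot A B) = quot (\<Phi> A) (\<Phi> B)"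
    using aff_ext_quot[OF AB(1-3)] closed_graph_aff_MvN[OF AB(4)] by simp
  then have c': "closed_op (quot (\<Phi> A) (\<Phi> B))"
    using aff_ext_in[OF AB(4)] by (simp add: aff_MvN_def)
  \<comment> \<open>Both A R and the corresponding product of images are quotients with closed
    graphs, so passing to strong products changes neither.\<close>
  have "\<Psi> (quot A B) = strong_prod (\<Psi> (op_of A)) (\<Psi> R)"
    using \<Psi>_prod(2)[OF op_of_in_aff_MvN[OF AB(1)] R_in] closed_op_imp_preclosed[OF c] T_eq
    by (simp add: strong_prod_def)
  then show ?thesis
    using closed_op_imp_preclosed(2)[OF c'] T'_eq by (simp add: \<Psi>_op AB strong_prod_def)
qed

lemma MvN_extension_unique:
  assumes \<Psi>: "MvN_extension M N \<Phi> \<Psi>"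
  shows "\<Psi> = restrict (aff_ext M \<Phi>) (aff_MvN M)"
proof
  fix T
  show "\<Psi> T = restrict (aff_ext M \<Phi>) (aff_MvN M) T"
  proof (cases "T \<in> aff_MvN M")
    case True
    then obtain A B where AB: "A \<in> M" "B \<in> M" "null B \<subseteq> null A" "T = quot A B"
      using M.aff_MvN_quot by blast
    then show ?thesis
      using MvN_extension_unique_quot[OF \<Psi> AB(1-3)] aff_ext_quot[OF AB(1-3)]
        closed_graph_aff_MvN[OF True] True by simp
  next
    case False
    have "\<Psi> \<in> aff_MvN M \<rightarrow>\<^sub>E aff_MvN N" using \<Psi> by (simp add: MvN_extension_def)
    then show ?thesis using False PiE_arb by fastforce
  qed
qed

end

theorem theorem5p8:
  fixes M :: "('a::chilbert_space \<Rightarrow>\<^sub>L 'a) set"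
    and N :: "('b::chilbert_space \<Rightarrow>\<^sub>L 'b) set"
    and \<Phi> :: "('a \<Rightarrow>\<^sub>L 'a) \<Rightarrow> ('b \<Rightarrow>\<^sub>L 'b)"
  assumes "von_neumann_algebra M"
    and "von_neumann_algebra N"
    and "unital_star_hom M N \<Phi>"
    and "normal_map M N \<Phi>"
  shows "MvN_extension M N \<Phi> (restrict (aff_ext M \<Phi>) (aff_MvN M)) \<and>
    (\<forall>\<Psi>. MvN_extension M N \<Phi> \<Psi> \<longrightarrow> \<Psi> = restrict (aff_ext M \<Phi>) (aff_MvN M))"
proof -
  interpret vn_hom M N \<Phi> by unfold_locales (rule assms)+
  show ?thesis using MvN_extension_aff_ext MvN_extension_unique by blast
qed

end
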